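(* Let $n, k$ be integers such that $10^{37} \le k \le n$. Then there exists a subset $S \subseteq [n]^2$ with $|S| = kn$ such that every (affine) line in $\mathbb{R}^2$ contains at most $k$ points of $S$.
   Context: $[n] = \{1, \ldots, n\}$, and $[n]^2 \subseteq \mathbb{R}^2$ is the $n \times n$ grid. *)

theory Defs
  imports "HOL-Analysis.Analysis"
begin

definition grid :: "nat \<Rightarrow> (real \<times> real) set" where
  "grid n = (real ` {1..n}) \<times> (real ` {1..n})"

definition affine_line :: "(real \<times> real) set \<Rightarrow> bool" where
  "affine_line L \<longleftrightarrow> affine L \<and> aff_dim L = 1"

end

(* If 2 k > n, only lines of slope 1 and -1 can be too rich, and the complement of the set can be
   written down.

   If 2 k <= n, a set with slightly fewer than k points per row and column is chosen at random and
   then completed.  The random set T is symmetric, avoids the cells with x = y mod 20, and its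
   density is lowered where x and y lie both in or both outside the middle half of [n], so that lines
   of slope 1 and -1 carry about 0.85 k points only.  By Chernoff bounds a line with primitive
   direction of length m is too rich with probability at most m^-4 exp (- k / 500) up to constants,
   so deleting the points on all bad lines affects only a tiny proportion of the rows, and none at
   all unless n is enormous compared with k.

   By symmetry, the missing numbers f y of points in row y and in column y agree.  Hence one can
   match f y half-edges at row y with f x half-edges at column x by a uniformly random permutation
   preserving the residue class mod 20; all new points lie on cells with x = y mod 20, so they are
   disjoint from T.  The lopsided local lemma shows that the permutation can be chosen without
   repeated cells and without more than k / 100 new points on any line that is not parallel to an
   axis: the expected number of such collinear (k / 100 + 1)-tuples on a line whose direction has
   length m is of order (c / m) ^ (k / 100), which is summable over all lines through a cell. *)
theory Submission
  imports Defs "HOL-Combinatorics.Permutations"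
begin

section \<open>Lattice lines\<close>

text \<open>The critical lines are the rows, the columns and the lines of slope 1 and -1, all with
  up to \<open>n\<close> cells. A longer direction leaves at most about \<open>n / 2\<close> cells
  and hence ample slack, but a long diagonal that avoids the cells congruent mod 20 would carry
  about \<open>20 k / 19\<close> points under a uniform density; this is why the density is tilted.
  Rows must be met exactly, which independent choices cannot do. They give row sums near
  \<open>k - 2 k / 10 ^ 8\<close> up to an error \<open>k / 10 ^ 8\<close>, a deviation that
  Chernoff bounds convert into the failure rate \<open>exp (- k / 10 ^ 17)\<close>. The window must
  be that narrow because the completion puts on a line with about \<open>n\<close> cells a number of
  new points of the order of the deficits, and the local lemma loses a further large constant, while
  only \<open>k / 100\<close> new points are allowed. It must also stay below \<open>k\<close>, so
  that every row has a deficit and every residue class has enough half-edges for the local lemma.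
  Reserving one residue class per row for the new points avoids conditioning on the random
  set.\<close>

definition square :: "nat \<Rightarrow> (int \<times> int) set" where
  "square n = {1..int n} \<times> {1..int n}"

text \<open>\<open>(a, b)\<close> is the direction, not the normal vector. For coprime
  \<open>a\<close> and \<open>b\<close> neighbouring lattice points on the line differ by
  \<open>(a, b)\<close>, so the larger coordinate of the direction is the spacing that governs all
  counts.\<close>

definition lat_line :: "int \<Rightarrow> int \<Rightarrow> int \<Rightarrow> (int \<times> int) set" where
  "lat_line a b c = {p. b * fst p - a * snd p = c}"

definition oblique :: "int \<Rightarrow> int \<Rightarrow> bool" where
  "oblique a b \<longleftrightarrow> coprime a b \<and> a \<noteq> 0 \<and> b \<noteq> 0"

lemma finite_square [simp]: "finite (square n)"
  by (simp add: square_def)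

lemma oblique_commute: "oblique a b \<longleftrightarrow> oblique b a"
  by (auto simp: oblique_def coprime_commute)

lemma card_spaced_le:
  fixes A :: "int set"
  assumes A: "A \<subseteq> {1..int n}" and m: "m > 0"
    and d: "\<And>x y. x \<in> A \<Longrightarrow> y \<in> A \<Longrightarrow> int m dvd x - y"
  shows "card A \<le> (n - 1) div m + 1"
proof -
  let ?f = "\<lambda>x. nat ((x - 1) div int m)"
  have "inj_on ?f A"
  proof (rule inj_onI)
    fix x y assume xy: "x \<in> A" "y \<in> A" "?f x = ?f y"
    have "(x - 1) div int m = (y - 1) div int m"
    proof -
      have "0 \<le> (x - 1) div int m" "0 \<le> (y - 1) div int m"
        using xy(1,2) A m by (auto simp: subset_iff pos_imp_zdiv_nonneg_iff)
      then show ?thesis using xy(3) by (simp only: eq_nat_nat_iff)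
    qed
    moreover have "(x - 1) mod int m = (y - 1) mod int m"
      using d[OF xy(1,2)] by (simp add: mod_eq_dvd_iff)
    ultimately have "x - 1 = y - 1" by (metis div_mult_mod_eq)
    then show "x = y" by simp
  qed
  moreover have "?f ` A \<subseteq> {..(n - 1) div m}"
  proof (rule image_subsetI)
    fix x assume "x \<in> A"
    then have x: "1 \<le> x" "x \<le> int n" using A by auto
    have "(x - 1) div int m \<le> int (n - 1) div int m"
      by (rule zdiv_mono1) (use x m in auto)
    also have "\<dots> = int ((n - 1) div m)" by (simp add: zdiv_int)
    finally show "?f x \<in> {..(n - 1) div m}" by simp
  qed
  ultimately have "card A \<le> card {..(n - 1) div m}" by (rule card_inj_on_le) simp
  then show ?thesis by simp
qed

text \<open>Project to the coordinate in which the direction is longer. The projection is injective,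
  and by coprimality \<open>m\<close> divides all differences of its values.\<close>

lemma card_lat_line_le:
  assumes ob: "oblique a b" and m: "m = nat (max \<bar>a\<bar> \<bar>b\<bar>)"
  shows "card (square n \<inter> lat_line a b c) \<le> (n - 1) div m + 1"
proof -
  let ?L = "square n \<inter> lat_line a b c"
  have ab: "coprime a b" "a \<noteq> 0" "b \<noteq> 0" using ob by (auto simp: oblique_def)
  have mpos: "m > 0" using m ab by auto
  have diff: "b * (fst p - fst q) = a * (snd p - snd q)" if "p \<in> ?L" "q \<in> ?L" for p q
    using that by (auto simp: lat_line_def algebra_simps)
  show ?thesis
  proof (cases "\<bar>a\<bar> \<le> \<bar>b\<bar>")
    case True
    have "card ?L = card (snd ` ?L)"
    proof (rule card_image[symmetric], rule inj_onI)
      fix p q assume pq: "p \<in> ?L" "q \<in> ?L" "snd p = snd q"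
      then show "p = q" using diff[OF pq(1,2)] ab by (simp add: prod_eq_iff)
    qed
    also have "\<dots> \<le> (n - 1) div m + 1"
    proof (rule card_spaced_le)
      show "snd ` ?L \<subseteq> {1..int n}" by (auto simp: square_def)
      fix x y assume "x \<in> snd ` ?L" "y \<in> snd ` ?L"
      then obtain p q where pq: "p \<in> ?L" "q \<in> ?L" "x = snd p" "y = snd q" by blast
      have "b dvd a * (x - y)" using diff[OF pq(1,2)] pq by (metis dvd_triv_left)
      then have "b dvd x - y" using ab by (simp add: coprime_commute coprime_dvd_mult_right_iff)
      then show "int m dvd x - y" using True m by simp
    qed (use mpos in auto)
    finally show ?thesis .
  next
    case False
    have "card ?L = card (fst ` ?L)"
    proof (rule card_image[symmetric], rule inj_onI)
      fix p q assume pq: "p \<in> ?L" "q \<in> ?L" "fst p = fst q"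
      then show "p = q" using diff[OF pq(1,2)] ab by (simp add: prod_eq_iff)
    qed
    also have "\<dots> \<le> (n - 1) div m + 1"
    proof (rule card_spaced_le)
      show "fst ` ?L \<subseteq> {1..int n}" by (auto simp: square_def)
      fix x y assume "x \<in> fst ` ?L" "y \<in> fst ` ?L"
      then obtain p q where pq: "p \<in> ?L" "q \<in> ?L" "x = fst p" "y = fst q" by blast
      have "a dvd b * (x - y)" using diff[OF pq(1,2)] pq by (metis dvd_triv_left)
      then have "a dvd x - y" using ab by (simp add: coprime_dvd_mult_right_iff)
      then show "int m dvd x - y" using False m by simp
    qed (use mpos in auto)
    finally show ?thesis .
  qed
qed

text \<open>Real lines reduce to lattice lines: a line with two points of the set has an integer
  direction vector, which becomes primitive after division by its gcd and is then parallel to an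
  axis or \<open>oblique\<close>. Lines with at most one point are covered by
  \<open>1 \<le> k\<close>.\<close>

lemma exists_set_of_lattice_set:
  fixes n k :: nat
  assumes k: "1 \<le> k" and S: "S \<subseteq> square n" "card S = k * n"
    and col: "\<And>x. card {p\<in>S. fst p = x} \<le> k" and row: "\<And>y. card {p\<in>S. snd p = y} \<le> k"
    and obl: "\<And>a b c. oblique a b \<Longrightarrow> card (S \<inter> lat_line a b c) \<le> k"
  shows "\<exists>S. S \<subseteq> grid n \<and> card S = k * n \<and> (\<forall>L. affine_line L \<longrightarrow> card (S \<inter> L) \<le> k)"
proof (intro exI conjI allI impI)
  define e :: "int \<times> int \<Rightarrow> real \<times> real" where "e p = (of_int (fst p), of_int (snd p))" for p
  have inj: "inj_on e A" for A by (auto simp: inj_on_def e_def prod_eq_iff)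
  have finS: "finite S" using S(1) by (rule finite_subset) simp
  have real: "real_of_int x \<in> real ` {1..n}" if "1 \<le> x" "x \<le> int n" for x
    using that by (intro image_eqI[of _ _ "nat x"]) auto
  show "e ` S \<subseteq> grid n"
    using S(1) real by (auto simp: grid_def e_def square_def)
  show "card (e ` S) = k * n" using S(2) by (simp add: card_image[OF inj])
  fix L :: "(real \<times> real) set" assume L: "affine_line L"
  define A where "A = {p\<in>S. e p \<in> L}"
  have "e ` S \<inter> L = e ` A" by (auto simp: A_def)
  then have card: "card (e ` S \<inter> L) = card A" by (simp add: card_image[OF inj])
  have finA: "finite A" using finS by (simp add: A_def)
  show "card (e ` S \<inter> L) \<le> k"
  proof (cases "\<exists>p\<in>A. \<exists>q\<in>A. p \<noteq> q")
    case False
    then have "card A \<le> 1" using card_le_Suc0_iff_eq[OF finA] by auto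
    then show ?thesis using card k by simp
  next
    case True
    then obtain p q where pq: "p \<in> A" "q \<in> A" "p \<noteq> q" by blast
    have "collinear L" using L by (simp add: affine_line_def collinear_aff_dim)
    then obtain u where u: "\<And>x y. x \<in> L \<Longrightarrow> y \<in> L \<Longrightarrow> \<exists>c. x - y = c *\<^sub>R u"
      unfolding collinear_def by blast
    define d1 where "d1 = fst p - fst q"
    define d2 where "d2 = snd p - snd q"
    have d: "d1 \<noteq> 0 \<or> d2 \<noteq> 0" using pq by (auto simp: d1_def d2_def prod_eq_iff)
    have cross: "d2 * (fst r - fst q) = d1 * (snd r - snd q)" if r: "r \<in> A" for r
    proof -
      have L: "e p \<in> L" "e q \<in> L" "e r \<in> L" using pq r by (auto simp: A_def)
      obtain c where c: "e p - e q = c *\<^sub>R u" using u L by blast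
      obtain c' where c': "e r - e q = c' *\<^sub>R u" using u L by blast
      have "real_of_int d1 = c * fst u" "real_of_int d2 = c * snd u"
        using c by (auto simp: e_def d1_def d2_def prod_eq_iff)
      moreover have "real_of_int (fst r - fst q) = c' * fst u" "real_of_int (snd r - snd q) = c' * snd u"
        using c' by (auto simp: e_def prod_eq_iff)
      ultimately have "real_of_int d2 * real_of_int (fst r - fst q) = real_of_int d1 * real_of_int (snd r - snd q)"
        by simp
      then show ?thesis by (metis of_int_eq_iff of_int_mult)
    qed
    define g where "g = gcd d1 d2"
    have g: "g > 0" using d by (auto simp: g_def)
    obtain a b where ab: "d1 = a * g" "d2 = b * g" "coprime a b"
      using gcd_coprime_exists[of d1 d2] g unfolding g_def by auto
    have A: "b * fst r - a * snd r = b * fst q - a * snd q" if "r \<in> A" for r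
    proof -
      have "g * (b * (fst r - fst q)) = g * (a * (snd r - snd q))"
        using cross[OF that] ab by (simp add: algebra_simps)
      then have "b * (fst r - fst q) = a * (snd r - snd q)" using g by simp
      then show ?thesis by (simp add: algebra_simps)
    qed
    consider "a = 0" | "b = 0" | "oblique a b" using ab(3) by (auto simp: oblique_def)
    then have "card A \<le> k"
    proof cases
      case 1
      then have "b \<noteq> 0" using ab d by auto
      then have "A \<subseteq> {p\<in>S. fst p = fst q}" using A 1 by (auto simp: A_def)
      then have "card A \<le> card {p\<in>S. fst p = fst q}" by (rule card_mono[rotated]) (use finS in simp)
      then show ?thesis using col[of "fst q"] by linarith
    next
      case 2
      then have "a \<noteq> 0" using ab d by auto
      then have "A \<subseteq> {p\<in>S. snd p = snd q}" using A 2 by (auto simp: A_def)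
      then have "card A \<le> card {p\<in>S. snd p = snd q}" by (rule card_mono[rotated]) (use finS in simp)
      then show ?thesis using row[of "snd q"] by linarith
    next
      case 3
      have "A \<subseteq> S \<inter> lat_line a b (b * fst q - a * snd q)" using A by (auto simp: A_def lat_line_def)
      then have "card A \<le> card (S \<inter> lat_line a b (b * fst q - a * snd q))"
        by (rule card_mono[rotated]) (use finS in simp)
      then show ?thesis using obl[OF 3, of "b * fst q - a * snd q"] by linarith
    qed
    then show ?thesis using card by simp
  qed
qed

lemma card_by_rows:
  assumes "S \<subseteq> square n" "\<And>y. y \<in> {1..int n} \<Longrightarrow> card {p\<in>S. snd p = y} = k"
  shows "card S = k * n"
proof -
  have "card S = card (\<Union>y\<in>{1..int n}. {p\<in>S. snd p = y})"
    by (rule arg_cong[of _ _ card]) (use assms(1) in \<open>auto simp: square_def\<close>)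
  also have "\<dots> = (\<Sum>y\<in>{1..int n}. card {p\<in>S. snd p = y})"
    by (rule card_UN_disjoint) (use finite_subset[OF assms(1)] in auto)
  also have "\<dots> = k * n" using assms(2) by simp
  finally show ?thesis .
qed

lemma exists_set_of_regular_lattice_set:
  fixes n k :: nat
  assumes k: "1 \<le> k" and S: "S \<subseteq> square n"
    and col: "\<And>x. x \<in> {1..int n} \<Longrightarrow> card {p\<in>S. fst p = x} = k"
    and row: "\<And>y. y \<in> {1..int n} \<Longrightarrow> card {p\<in>S. snd p = y} = k"
    and obl: "\<And>a b c. oblique a b \<Longrightarrow> card (S \<inter> lat_line a b c) \<le> k"
  shows "\<exists>S. S \<subseteq> grid n \<and> card S = k * n \<and> (\<forall>L. affine_line L \<longrightarrow> card (S \<inter> L) \<le> k)"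
proof (rule exists_set_of_lattice_set[OF k S card_by_rows[OF S row] _ _ obl])
  show "card {p\<in>S. fst p = x} \<le> k" for x
  proof (cases "x \<in> {1..int n}")
    case False
    then have "{p\<in>S. fst p = x} = {}" using S by (auto simp: square_def)
    then show ?thesis by (simp only: card.empty)
  qed (use col in simp)
  show "card {p\<in>S. snd p = y} \<le> k" for y
  proof (cases "y \<in> {1..int n}")
    case False
    then have "{p\<in>S. snd p = y} = {}" using S by (auto simp: square_def)
    then show ?thesis by (simp only: card.empty)
  qed (use row in simp)
qed auto

section \<open>More than half of the square\<close>

lemma card_residues_lt:
  fixes K j :: nat and c :: int
  assumes K: "K > 0" and j: "j \<le> K"
  shows "card {t\<in>{1..int K}. (t - c) mod int K < int j} = j"
proof -
  let ?A = "{t\<in>{1..int K}. (t - c) mod int K < int j}"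
  have "bij_betw (\<lambda>t. (t - c) mod int K) ?A {0..<int j}"
  proof (rule bij_betw_imageI)
    show "inj_on (\<lambda>t. (t - c) mod int K) ?A"
    proof (rule inj_onI)
      fix x y assume A: "x \<in> ?A" "y \<in> ?A" "(x - c) mod int K = (y - c) mod int K"
      then have "int K dvd (x - c) - (y - c)" by (simp add: mod_eq_dvd_iff)
      then have dvd: "int K dvd \<bar>x - y\<bar>" by simp
      have "\<bar>x - y\<bar> < int K" using A by auto
      then have "\<bar>x - y\<bar> = 0" using dvd zdvd_not_zless by (metis abs_ge_zero order_le_less)
      then show "x = y" by simp
    qed
    show "(\<lambda>t. (t - c) mod int K) ` ?A = {0..<int j}"
    proof (intro equalityI subsetI)
      fix s assume s: "s \<in> {0..<int j}"
      define t where "t = (s + c - 1) mod int K + 1"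
      have "(t - c) mod int K = ((s + c - 1) mod int K + (1 - c)) mod int K"
        by (simp add: t_def algebra_simps)
      also have "\<dots> = ((s + c - 1) + (1 - c)) mod int K" by (rule mod_add_left_eq)
      also have "\<dots> = s" using s j by simp
      finally have "(t - c) mod int K = s" .
      moreover have "t \<in> {1..int K}"
      proof -
        have "(s + c - 1) mod int K < int K" "0 \<le> (s + c - 1) mod int K" using K by simp_all
        then show ?thesis unfolding t_def atLeastAtMost_iff by linarith
      qed
      ultimately show "s \<in> (\<lambda>t. (t - c) mod int K) ` ?A" using s by (intro image_eqI[of _ _ t]) auto
    qed (use K in auto)
  qed
  then have "card ?A = card {0..<int j}" by (rule bij_betw_same_card)
  then show ?thesis by simp
qed

text \<open>The interval is the intersection of \<open>{a + 1..a + J}\<close> with its translate by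
  \<open>d\<close>. It parametrises the cells of a square block of side \<open>J\<close> on a line
  of slope 1 or -1; truncated subtraction handles disjoint translates.\<close>

lemma card_overlap:
  fixes a d :: int
  shows "card {max (a + 1) (a + 1 + d)..min (a + int J) (a + int J + d)} = J - nat \<bar>d\<bar>"
proof -
  have "min (a + int J) (a + int J + d) + 1 - max (a + 1) (a + 1 + d) = int J - \<bar>d\<bar>"
    by (simp add: min_def max_def abs_if)
  then show ?thesis by (simp add: nat_diff_distrib)
qed

text \<open>For \<open>k > n/2\<close> only the lines of slope \<open>\<plusminus>1\<close> can contain more than \<open>k\<close> points of the square.  The
  complement \<open>T\<close> of the desired set has \<open>j = n - k\<close> points in each row and column and consists of a
  central block and a circulant on the remaining rows and columns.  The block has to be exactly
  central, so for odd \<open>k\<close> it has side \<open>j + 1\<close> and its main diagonal is removed.\<close>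

lemma dense_case:
  fixes n k :: nat
  assumes k: "2 \<le> k" "k \<le> n" "n < 2 * k"
  shows "\<exists>S. S \<subseteq> square n \<and> (\<forall>x\<in>{1..int n}. card {p\<in>S. fst p = x} = k) \<and>
    (\<forall>y\<in>{1..int n}. card {p\<in>S. snd p = y} = k) \<and>
    (\<forall>a b c. oblique a b \<longrightarrow> card (S \<inter> lat_line a b c) \<le> k)"
proof -
  define j where "j = n - k"
  define e where "e = k mod 2"
  define K where "K = k - e"
  define h where "h = K div 2"
  define J where "J = j + e"
  have n: "n = K + J" "K = 2 * h" "k = K + e" "j \<le> K" "j < k" "e \<le> 1" "K > 0"
  proof -
    have 1: "k = 2 * (k div 2) + e" "e \<le> 1" unfolding e_def by simp_all
    have 2: "K = 2 * (k div 2)" using 1 by (simp add: K_def)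
    show "K = 2 * h" using 2 by (simp add: h_def)
    show "n = K + J" "k = K + e" "j \<le> K" "j < k" "e \<le> 1" "K > 0"
      using 1 2 k by (simp_all add: J_def j_def)
  qed
  define B where "B = {int h + 1..int h + int J}"
  define Out where "Out = {1..int n} - B"
  \<comment> \<open>\<open>\<rho>\<close> closes the gap left by the block: the outer indices become
    \<open>1..K\<close>, on which the circulant lives with period \<open>K\<close>.\<close>
  define \<rho> where "\<rho> x = (if x \<le> int h then x else x - int J)" for x :: int
  define T where "T = {p \<in> square n. fst p \<in> B \<and> snd p \<in> B \<and> (e = 1 \<longrightarrow> fst p \<noteq> snd p)
      \<or> fst p \<in> Out \<and> snd p \<in> Out \<and> (\<rho> (fst p) - \<rho> (snd p)) mod int K < int j}"
  have finT: "finite T" unfolding T_def by simp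
  have T: "T \<subseteq> square n" unfolding T_def by auto
  have Bn: "B \<subseteq> {1..int n}" using n by (auto simp: B_def)
  have rho: "bij_betw \<rho> Out {1..int K}"
  proof (rule bij_betw_byWitness[where f' = "\<lambda>t. if t \<le> int h then t else t + int J"])
    show "\<rho> ` Out \<subseteq> {1..int K}" using n by (auto simp: \<rho>_def Out_def B_def)
    show "(\<lambda>t. if t \<le> int h then t else t + int J) ` {1..int K} \<subseteq> Out"
      using n by (auto simp: Out_def B_def)
  qed (auto simp: \<rho>_def Out_def B_def)
  have count: "card {t\<in>Out. (\<rho> t - c) mod int K < int j} = j" for c
  proof -
    have "bij_betw \<rho> {t\<in>Out. (\<rho> t - c) mod int K < int j} {t\<in>{1..int K}. (t - c) mod int K < int j}"
      using rho by (auto simp: bij_betw_def inj_on_def)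
    then show ?thesis using card_residues_lt[of K j c] n bij_betw_same_card by fastforce
  qed
  have count': "card {t\<in>Out. (c - \<rho> t) mod int K < int j} = j" for c
  proof -
    \<comment> \<open>The reflection reverses the sign in front of \<open>\<rho> t\<close>, so the
      same residue count applies with another constant.\<close>
    have "bij_betw (\<lambda>t. int K + 1 - \<rho> t) {t\<in>Out. (c - \<rho> t) mod int K < int j}
        {t\<in>{1..int K}. (t - (- c + int K + 1)) mod int K < int j}"
    proof -
      have "bij_betw (\<lambda>t. int K + 1 - t) {t\<in>{1..int K}. (c - t) mod int K < int j}
        {t\<in>{1..int K}. (t - (- c + int K + 1)) mod int K < int j}"
        by (rule bij_betw_byWitness[where f' = "\<lambda>t. int K + 1 - t"]) (auto simp: algebra_simps)
      moreover have "bij_betw \<rho> {t\<in>Out. (c - \<rho> t) mod int K < int j} {t\<in>{1..int K}. (c - t) mod int K < int j}"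
        using rho by (auto simp: bij_betw_def inj_on_def)
      ultimately show ?thesis using bij_betw_trans[of \<rho>] by (simp add: o_def) blast
    qed
    then show ?thesis
      using card_residues_lt[of K j "- c + int K + 1"] n bij_betw_same_card by fastforce
  qed
  have cardB: "card {t\<in>B. e = 1 \<longrightarrow> t \<noteq> x} = j" if "x \<in> B" for x
  proof (cases "e = 1")
    case True
    then have "{t\<in>B. e = 1 \<longrightarrow> t \<noteq> x} = B - {x}" by auto
    then show ?thesis using that True by (simp add: B_def J_def)
  next
    case False
    then have "{t\<in>B. e = 1 \<longrightarrow> t \<noteq> x} = B" and "e = 0" using n by auto
    then show ?thesis by (simp add: B_def J_def)
  qed
  have colT: "card {p\<in>T. fst p = x} = j" if x: "x \<in> {1..int n}" for x
  proof (cases "x \<in> B")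
    case True
    have "{p\<in>T. fst p = x} = Pair x ` {t\<in>B. e = 1 \<longrightarrow> t \<noteq> x}"
      using True Bn by (auto simp: T_def Out_def square_def)
    then show ?thesis using cardB[OF True] by (simp add: card_image inj_on_def)
  next
    case False
    then have "{p\<in>T. fst p = x} = Pair x ` {t\<in>Out. (\<rho> x - \<rho> t) mod int K < int j}"
      using x by (auto simp: T_def Out_def square_def)
    then show ?thesis using count'[of "\<rho> x"] by (simp add: card_image inj_on_def)
  qed
  have rowT: "card {p\<in>T. snd p = y} = j" if y: "y \<in> {1..int n}" for y
  proof (cases "y \<in> B")
    case True
    have "{p\<in>T. snd p = y} = (\<lambda>t. (t, y)) ` {t\<in>B. e = 1 \<longrightarrow> t \<noteq> y}"
      using True Bn by (auto simp: T_def Out_def square_def)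
    then show ?thesis using cardB[OF True] by (simp add: card_image inj_on_def)
  next
    case False
    then have "{p\<in>T. snd p = y} = (\<lambda>t. (t, y)) ` {t\<in>Out. (\<rho> t - \<rho> y) mod int K < int j}"
      using y by (auto simp: T_def Out_def square_def)
    then show ?thesis using count[of "\<rho> y"] by (simp add: card_image inj_on_def)
  qed
  have kj: "k = n - j" "j \<le> n" using k by (auto simp: j_def)
  \<comment> \<open>The line has \<open>n - |d|\<close> cells, at most \<open>k\<close> if
    \<open>|d| \<ge> j\<close>. Otherwise \<open>j - |d|\<close> of them must lie in
    \<open>T\<close>, and the parallel diagonal of the central block supplies
    \<open>J - |d|\<close>.\<close>
  have diag: "card ((square n - T) \<inter> {p. fst p - snd p = d}) \<le> k" for d
  proof -
    let ?L = "square n \<inter> {p. fst p - snd p = d}"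
    have L: "?L = (\<lambda>t. (t, t - d)) ` {max 1 (1 + d)..min (int n) (int n + d)}"
      by (auto simp: square_def)
    have cL: "card ?L = n - nat \<bar>d\<bar>"
      unfolding L using card_overlap[of 0 d n] by (subst card_image) (simp_all add: inj_on_def)
    show ?thesis
    proof (cases "\<bar>d\<bar> < int j")
      case False
      have "card ((square n - T) \<inter> {p. fst p - snd p = d}) \<le> card ?L" by (rule card_mono) auto
      then show ?thesis using cL False kj by auto
    next
      case True
      have "j - nat \<bar>d\<bar> \<le> card (T \<inter> {p. fst p - snd p = d})"
      proof (cases "e = 1 \<and> d = 0")
        case True
        \<comment> \<open>The block has lost exactly this line. The circulant replaces it: residue 0
          is admissible since \<open>j > 0\<close>, so all \<open>K \<ge> j\<close> diagonal cells
          of the outer part lie in \<open>T\<close>.\<close>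
        have "(\<lambda>t. (t, t)) ` Out \<subseteq> T \<inter> {p. fst p - snd p = d}"
          using True \<open>\<bar>d\<bar> < int j\<close> by (auto simp: T_def Out_def square_def)
        then have "card ((\<lambda>t. (t, t)) ` Out) \<le> card (T \<inter> {p. fst p - snd p = d})"
          using finT by (intro card_mono) auto
        moreover have "card ((\<lambda>t. (t, t)) ` Out) = K"
          using bij_betw_same_card[OF rho] by (simp add: card_image inj_on_def)
        ultimately show ?thesis using n by simp
      next
        case False
        let ?I = "{max (int h + 1) (int h + 1 + d)..min (int h + int J) (int h + int J + d)}"
        have "(\<lambda>t. (t, t - d)) ` ?I \<subseteq> T \<inter> {p. fst p - snd p = d}"
          using False n by (auto simp: T_def B_def square_def)
        then have "card ((\<lambda>t. (t, t - d)) ` ?I) \<le> card (T \<inter> {p. fst p - snd p = d})"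
          using finT by (intro card_mono) auto
        moreover have "card ((\<lambda>t. (t, t - d)) ` ?I) = J - nat \<bar>d\<bar>"
          by (subst card_image) (simp_all add: inj_on_def card_overlap)
        ultimately show ?thesis unfolding J_def by linarith
      qed
      moreover have "card ((square n - T) \<inter> {p. fst p - snd p = d}) = card (?L - T \<inter> {p. fst p - snd p = d})"
        by (rule arg_cong[of _ _ card]) auto
      moreover have "\<dots> = card ?L - card (T \<inter> {p. fst p - snd p = d})"
        by (rule card_Diff_subset) (use finT T in auto)
      ultimately show ?thesis using cL True kj by linarith
    qed
  qed
  have antidiag: "card ((square n - T) \<inter> {p. fst p + snd p = int n + 1 + d}) \<le> k" for d
  proof -
    let ?D = "{p. fst p + snd p = int n + 1 + d}"
    let ?L = "square n \<inter> ?D"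
    have L: "?L = (\<lambda>t. (t, int n + 1 + d - t)) ` {max 1 (1 + d)..min (int n) (int n + d)}"
      by (auto simp: square_def)
    have cL: "card ?L = n - nat \<bar>d\<bar>"
      unfolding L using card_overlap[of 0 d n] by (subst card_image) (simp_all add: inj_on_def)
    show ?thesis
    proof (cases "\<bar>d\<bar> < int j")
      case False
      have "card ((square n - T) \<inter> ?D) \<le> card ?L" by (rule card_mono) auto
      then show ?thesis using cL False kj by auto
    next
      case True
      let ?I = "{max (int h + 1) (int h + 1 + d)..min (int h + int J) (int h + int J + d)}"
      let ?I' = "{t\<in>?I. e = 1 \<longrightarrow> t \<noteq> int n + 1 + d - t}"
      \<comment> \<open>Being central, the block has the same main antidiagonal as the square. A
        line of slope -1 meets the removed diagonal at most once, a loss covered by the extra side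
        length in \<open>J = j + e\<close>.\<close>
      have "card ?I - e \<le> card ?I'"
      proof (cases "e = 1")
        case True
        have "card ?I - card {(int n + 1 + d) div 2} \<le> card (?I - {(int n + 1 + d) div 2})"
          by (rule diff_card_le_card_Diff) simp
        also have "\<dots> \<le> card ?I'"
          by (rule card_mono[OF finite_subset[of _ ?I]]) auto
        finally show ?thesis using True by simp
      next
        case False
        then have "?I' = ?I" by auto
        then show ?thesis by simp
      qed
      also have "card ?I' = card ((\<lambda>t. (t, int n + 1 + d - t)) ` ?I')"
        by (simp add: card_image inj_on_def)
      also have "\<dots> \<le> card (T \<inter> ?D)"
        by (rule card_mono) (use finT n in \<open>auto simp: T_def B_def square_def\<close>)
      finally have "card ?I - e \<le> card (T \<inter> ?D)" .
      then have "j - nat \<bar>d\<bar> \<le> card (T \<inter> ?D)" unfolding card_overlap J_def by linarith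
      moreover have "card ((square n - T) \<inter> ?D) = card (?L - T \<inter> ?D)"
        by (rule arg_cong[of _ _ card]) auto
      moreover have "\<dots> = card ?L - card (T \<inter> ?D)"
        by (rule card_Diff_subset) (use finT T in auto)
      ultimately show ?thesis using cL True kj by linarith
    qed
  qed
  show ?thesis
  proof (intro exI conjI ballI allI impI)
    show "square n - T \<subseteq> square n" by auto
    show "card {p \<in> square n - T. fst p = x} = k" if x: "x \<in> {1..int n}" for x
    proof -
      have "{p \<in> square n - T. fst p = x} = Pair x ` {1..int n} - {p\<in>T. fst p = x}"
        using x by (auto simp: square_def)
      also have "card \<dots> = card (Pair x ` {1..int n}) - card {p\<in>T. fst p = x}"
        by (rule card_Diff_subset) (use finT T in \<open>auto simp: square_def\<close>)
      finally show ?thesis using colT[OF x] kj by (simp add: card_image inj_on_def)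
    qed
    show "card {p \<in> square n - T. snd p = y} = k" if y: "y \<in> {1..int n}" for y
    proof -
      have "{p \<in> square n - T. snd p = y} = (\<lambda>t. (t, y)) ` {1..int n} - {p\<in>T. snd p = y}"
        using y by (auto simp: square_def)
      also have "card \<dots> = card ((\<lambda>t. (t, y)) ` {1..int n}) - card {p\<in>T. snd p = y}"
        by (rule card_Diff_subset) (use finT T in \<open>auto simp: square_def\<close>)
      finally show ?thesis using rowT[OF y] kj by (simp add: card_image inj_on_def)
    qed
    fix a b c :: int assume ob: "oblique a b"
    define m where "m = nat (max \<bar>a\<bar> \<bar>b\<bar>)"
    have m: "m \<ge> 1" using ob by (auto simp: m_def oblique_def)
    show "card ((square n - T) \<inter> lat_line a b c) \<le> k"
    proof (cases "m = 1")
      case False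
      have "card ((square n - T) \<inter> lat_line a b c) \<le> card (square n \<inter> lat_line a b c)"
        by (rule card_mono) auto
      also have "\<dots> \<le> (n - 1) div m + 1" by (rule card_lat_line_le[OF ob m_def])
      also have "\<dots> \<le> (n - 1) div 2 + 1" using div_le_mono2[of 2 m "n - 1"] m False by simp
      also have "\<dots> \<le> k" using k by linarith
      finally show ?thesis .
    next
      case True
      then have ab: "\<bar>a\<bar> = 1" "\<bar>b\<bar> = 1" using ob by (auto simp: m_def oblique_def)
      show ?thesis
      proof (cases "a = b")
        case True
        have "lat_line a b c = {p. fst p - snd p = b * c}"
          using ab True by (auto simp: lat_line_def abs_if split: if_splits)
        then show ?thesis using diag[of "b * c"] by simp
      next
        case False
        have "lat_line a b c = {p. fst p + snd p = int n + 1 + (b * c - int n - 1)}"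
          using ab False by (auto simp: lat_line_def abs_if split: if_splits)
        then show ?thesis using antidiag[of "b * c - int n - 1"] by simp
      qed
    qed
  qed
qed

section \<open>The lopsided local lemma for permutations\<close>

text \<open>Counting form for the uniform distribution on \<open>\<Omega>\<close>. Independence is
  replaced by \<open>neg\<close>: conditioned on avoiding any family of events outside
  \<open>N i\<close>, the event \<open>A i\<close> has probability at most \<open>p i\<close>. By
  induction on \<open>card J\<close>, \<open>x i\<close> bounds the probability of
  \<open>A i\<close> conditioned on avoiding \<open>J\<close>.\<close>

lemma lopsided_local_lemma:
  fixes A :: "'i \<Rightarrow> 'a set" and x p :: "'i \<Rightarrow> real" and N :: "'i \<Rightarrow> 'i set"
  assumes finI: "finite I" and fin: "finite \<Omega>" and ne: "\<Omega> \<noteq> {}"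
    and NI: "\<And>i. i \<in> I \<Longrightarrow> N i \<subseteq> I" and self: "\<And>i. i \<in> I \<Longrightarrow> i \<in> N i"
    and neg: "\<And>i J. i \<in> I \<Longrightarrow> J \<subseteq> I - N i \<Longrightarrow>
      real (card {\<omega>\<in>\<Omega>. \<omega> \<in> A i \<and> (\<forall>j\<in>J. \<omega> \<notin> A j)}) \<le> p i * real (card {\<omega>\<in>\<Omega>. \<forall>j\<in>J. \<omega> \<notin> A j})"
    and x: "\<And>i. i \<in> I \<Longrightarrow> 0 \<le> x i" "\<And>i. i \<in> I \<Longrightarrow> x i < 1"
    and px: "\<And>i. i \<in> I \<Longrightarrow> p i \<le> x i * (\<Prod>j\<in>N i. 1 - x j)"
  shows "\<exists>\<omega>\<in>\<Omega>. \<forall>i\<in>I. \<omega> \<notin> A i"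
proof -
  define c where "c J = real (card {\<omega>\<in>\<Omega>. \<forall>j\<in>J. \<omega> \<notin> A j})" for J
  define a where "a i J = real (card {\<omega>\<in>\<Omega>. \<omega> \<in> A i \<and> (\<forall>j\<in>J. \<omega> \<notin> A j)})" for i J
  have split: "c (insert i J) = c J - a i J" for i J
  proof -
    have "card {\<omega>\<in>\<Omega>. \<forall>j\<in>J. \<omega> \<notin> A j} =
        card ({\<omega>\<in>\<Omega>. \<forall>j\<in>insert i J. \<omega> \<notin> A j} \<union> {\<omega>\<in>\<Omega>. \<omega> \<in> A i \<and> (\<forall>j\<in>J. \<omega> \<notin> A j)})"
      by (rule arg_cong[of _ _ card]) auto
    also have "\<dots> = card {\<omega>\<in>\<Omega>. \<forall>j\<in>insert i J. \<omega> \<notin> A j} + card {\<omega>\<in>\<Omega>. \<omega> \<in> A i \<and> (\<forall>j\<in>J. \<omega> \<notin> A j)}"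
      by (rule card_Un_disjoint) (use fin in auto)
    finally show ?thesis by (simp add: c_def a_def)
  qed
  \<comment> \<open>Chain rule: the events of \<open>K\<close> are avoided one after the other, each
    step keeping at least the fraction \<open>1 - x i\<close>.\<close>
  have chain: "(\<Prod>j\<in>K. 1 - x j) * c J \<le> c (J \<union> K)"
    if "finite K" "J \<subseteq> I" "K \<subseteq> I" "J \<inter> K = {}"
      and "\<And>i L. i \<in> K \<Longrightarrow> J \<subseteq> L \<Longrightarrow> L \<subseteq> J \<union> K - {i} \<Longrightarrow> a i L \<le> x i * c L" for J K
    using that
  proof (induction K rule: finite_induct)
    case empty
    then show ?case by simp
  next
    case (insert i K)
    have "(\<Prod>j\<in>insert i K. 1 - x j) * c J = (1 - x i) * ((\<Prod>j\<in>K. 1 - x j) * c J)"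
      using insert.hyps by simp
    also have "\<dots> \<le> (1 - x i) * c (J \<union> K)"
    proof (rule mult_left_mono)
      show "(\<Prod>j\<in>K. 1 - x j) * c J \<le> c (J \<union> K)"
      proof (rule insert.IH)
        fix i' L assume "i' \<in> K" "J \<subseteq> L" "L \<subseteq> J \<union> K - {i'}"
        then show "a i' L \<le> x i' * c L" using insert.prems(4)[of i' L] by auto
      qed (use insert.prems in auto)
      show "0 \<le> 1 - x i" using x(2)[of i] insert.prems by auto
    qed
    also have "\<dots> = c (J \<union> K) - x i * c (J \<union> K)" by (simp add: algebra_simps)
    also have "\<dots> \<le> c (J \<union> K) - a i (J \<union> K)"
      using insert.prems(4)[of i "J \<union> K"] insert.hyps insert.prems(3) by auto
    also have "\<dots> = c (J \<union> insert i K)" using split[of i "J \<union> K"] by simp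
    finally show ?case .
  qed
  have main: "a i J \<le> x i * c J" if "i \<in> I" "J \<subseteq> I - {i}" for i J
    using that
  proof (induction "card J" arbitrary: i J rule: less_induct)
    case less
    define J1 where "J1 = J \<inter> N i"
    define J2 where "J2 = J - N i"
    have finJ: "finite J" using less.prems finI finite_subset by blast
    have J: "J = J2 \<union> J1" by (auto simp: J1_def J2_def)
    \<comment> \<open>In the numerator the neighbours are simply forgotten; in the denominator they
      are reinstated by \<open>chain\<close>, whose hypothesis concerns smaller sets and so follows
      by induction.\<close>
    have "a i J \<le> a i J2"
      unfolding a_def of_nat_le_iff by (rule card_mono) (use fin J in auto)
    also have "\<dots> \<le> p i * c J2"
      unfolding a_def c_def by (rule neg) (use less.prems J2_def in auto)
    also have "\<dots> \<le> (x i * (\<Prod>j\<in>N i. 1 - x j)) * c J2"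
      by (rule mult_right_mono[OF px]) (use less.prems in \<open>auto simp: c_def\<close>)
    also have "\<dots> \<le> (x i * (\<Prod>j\<in>J1. 1 - x j)) * c J2"
    proof (intro mult_right_mono mult_left_mono)
      have "(\<Prod>j\<in>N i. 1 - x j) = (\<Prod>j\<in>J1. 1 - x j) * (\<Prod>j\<in>N i - J1. 1 - x j)"
        using NI[OF less.prems(1)] finI finite_subset
        by (metis J1_def inf_le2 mult.commute prod.subset_diff)
      also have "\<dots> \<le> (\<Prod>j\<in>J1. 1 - x j) * 1"
        by (intro mult_left_mono prod_le_1 prod_nonneg)
          (use NI[OF less.prems(1)] x in \<open>force simp: J1_def\<close>)+
      finally show "(\<Prod>j\<in>N i. 1 - x j) \<le> (\<Prod>j\<in>J1. 1 - x j)" by simp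
    qed (use x less.prems in \<open>auto simp: c_def\<close>)
    also have "\<dots> = x i * ((\<Prod>j\<in>J1. 1 - x j) * c J2)" by simp
    also have "\<dots> \<le> x i * c (J2 \<union> J1)"
    proof (rule mult_left_mono[OF chain])
      fix i' L assume L: "i' \<in> J1" "J2 \<subseteq> L" "L \<subseteq> J2 \<union> J1 - {i'}"
      have "card L < card J"
        using L finJ J by (intro psubset_card_mono) auto
      then show "a i' L \<le> x i' * c L"
        using less.hyps[of L i'] L J less.prems by blast
    qed (use finJ less.prems x in \<open>auto simp: J1_def J2_def\<close>)
    finally show ?case using J by simp
  qed
  have "0 < (\<Prod>j\<in>I. 1 - x j) * c {}"
    using x fin ne by (auto simp: c_def card_gt_0_iff intro!: mult_pos_pos prod_pos)
  also have "\<dots> \<le> c ({} \<union> I)"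
    by (rule chain) (use finI main in auto)
  finally have "c I \<noteq> 0" by simp
  show ?thesis
  proof (rule ccontr)
    assume "\<not> ?thesis"
    then have "{\<omega>\<in>\<Omega>. \<forall>j\<in>I. \<omega> \<notin> A j} = {}" by blast
    then have "c I = 0" by (simp only: c_def card.empty of_nat_0)
    with \<open>c I \<noteq> 0\<close> show False by simp
  qed
qed

lemma sum_UN_le:
  fixes f :: "'b \<Rightarrow> real"
  assumes "finite A" "\<And>a. a \<in> A \<Longrightarrow> finite (B a)" "\<And>x. 0 \<le> f x"
  shows "sum f (\<Union>a\<in>A. B a) \<le> (\<Sum>a\<in>A. sum f (B a))"
  using assms(1,2)
proof (induction A rule: finite_induct)
  case empty
  then show ?case by simp
next
  case (insert a A)
  have "sum f (\<Union>a\<in>insert a A. B a) = sum f (B a) + sum f (\<Union>a\<in>A. B a) - sum f (B a \<inter> (\<Union>a\<in>A. B a))"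
    using insert by (simp add: sum_Un)
  also have "\<dots> \<le> sum f (B a) + sum f (\<Union>a\<in>A. B a)" using assms(3) by (simp add: sum_nonneg)
  also have "\<dots> \<le> sum f (B a) + (\<Sum>a\<in>A. sum f (B a))" using insert by simp
  finally show ?case using insert by simp
qed

section \<open>Permutations avoiding prescribed partial matchings\<close>

definition class_perms :: "'h set \<Rightarrow> ('h \<Rightarrow> 'c) \<Rightarrow> ('h \<Rightarrow> 'h) set" where
  "class_perms H cls = {\<pi>. \<pi> permutes H \<and> (\<forall>h\<in>H. cls (\<pi> h) = cls h)}"

definition extends :: "('h \<Rightarrow> 'h) \<Rightarrow> ('h \<times> 'h) set \<Rightarrow> bool" where
  "extends \<pi> M \<longleftrightarrow> (\<forall>p\<in>M. \<pi> (fst p) = snd p)"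

lemma extends_empty [simp]: "extends \<pi> {}"
  by (simp add: extends_def)

lemma extends_insert [simp]: "extends \<pi> (insert e M) \<longleftrightarrow> \<pi> (fst e) = snd e \<and> extends \<pi> M"
  by (simp add: extends_def)

lemma finite_class_perms: "finite H \<Longrightarrow> finite (class_perms H cls)"
  using finite_permutations[of H] by (rule finite_subset[rotated]) (auto simp: class_perms_def)

lemma class_perms_swap:
  assumes "\<pi> \<in> class_perms H cls" "h \<in> H" "z \<in> H" "cls z = cls h"
  shows "\<pi> \<circ> Transposition.transpose h z \<in> class_perms H cls"
  using assms
  by (auto simp: class_perms_def Transposition.transpose_def intro!: permutes_compose permutes_swap_id)

text \<open>Composing with the transposition of \<open>h\<close> and \<open>z\<close> destroys the pair \<open>(h, h')\<close> and only creates
  pairs that touch \<open>h\<close> on the left or \<open>h'\<close> on the right, so it cannot complete a partial matching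
  disjoint from \<open>{(h, h')}\<close>.\<close>

lemma card_class_perms_extending:
  fixes cls :: "'h \<Rightarrow> 'c" and J :: "('h \<times> 'h) set set" and N t :: nat
  assumes finH: "finite H"
    and many: "\<And>h. h \<in> H \<Longrightarrow> N + t \<le> card {z\<in>H. cls z = cls h}"
    and M: "finite M" "M \<subseteq> H \<times> H" "inj_on fst M" "inj_on snd M" "card M \<le> t"
      "\<And>p. p \<in> M \<Longrightarrow> cls (fst p) = cls (snd p)"
    and J: "\<And>M'. M' \<in> J \<Longrightarrow> fst ` M \<inter> fst ` M' = {} \<and> snd ` M \<inter> snd ` M' = {}"
    and av: "av = {\<pi>\<in>class_perms H cls. \<forall>M'\<in>J. \<not> extends \<pi> M'}"
  shows "card {\<pi>\<in>av. extends \<pi> M} * N ^ card M \<le> card av"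
  using M J
proof (induction M rule: finite_induct)
  case empty
  then show ?case by simp
next
  case (insert e M)
  define h where "h = fst e"
  define h' where "h' = snd e"
  have h: "h \<in> H" "h' \<in> H" "cls h = cls h'"
    using insert.prems(1) insert.prems(5)[of e] by (auto simp: h_def h'_def)
  have h2: "h \<notin> fst ` M" "h' \<notin> snd ` M"
    using insert.prems(2,3) insert.hyps(2) by (auto simp: h_def h'_def)
  \<comment> \<open>The swap partners: in the class of \<open>h\<close>, so that classes are
    preserved, and not a left end of \<open>M\<close>, so that \<open>M\<close> survives the swap.
    Excluding at most \<open>t\<close> ends leaves at least \<open>N\<close> of them.\<close>
  define Z where "Z = {z\<in>H. cls z = cls h} - fst ` M"
  define B where "B = {\<pi>\<in>av. extends \<pi> (insert e M)}"
  have finav: "finite av"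
    by (rule finite_subset[OF _ finite_class_perms[OF finH, of cls]]) (auto simp: av)
  have "card (fst ` M) \<le> t"
    using card_image_le[OF insert.hyps(1), of fst] insert.prems(4) insert.hyps by simp
  then have "N \<le> card {z\<in>H. cls z = cls h} - card (fst ` M)" using many[OF h(1)] by linarith
  also have "\<dots> \<le> card Z" unfolding Z_def by (rule diff_card_le_card_Diff) (use insert.hyps in auto)
  finally have Z: "N \<le> card Z" .
  have pi: "\<pi> h = h'" "\<pi> \<in> class_perms H cls" "extends \<pi> M" "\<And>M'. M' \<in> J \<Longrightarrow> \<not> extends \<pi> M'"
    if "\<pi> \<in> B" for \<pi>
    using that by (simp_all add: B_def av h_def h'_def)
  let ?f = "\<lambda>(\<pi>, z). \<pi> \<circ> Transposition.transpose h z"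
  have "card (B \<times> Z) \<le> card {\<pi>\<in>av. extends \<pi> M}"
  proof (rule card_inj_on_le)
    show "inj_on ?f (B \<times> Z)"
    proof (rule inj_onI, clarify)
      fix \<pi> z \<sigma> w assume A: "\<pi> \<in> B" "z \<in> Z" "\<sigma> \<in> B" "w \<in> Z" "\<pi> \<circ> Transposition.transpose h z = \<sigma> \<circ> Transposition.transpose h w"
      \<comment> \<open>\<open>z\<close> is recovered as the preimage of \<open>h'\<close> under the
        composite, and the swap can then be undone.\<close>
      have "(\<pi> \<circ> Transposition.transpose h z) z = h'" "(\<sigma> \<circ> Transposition.transpose h w) w = h'"
        using pi(1) A(1,3) by auto
      moreover have "inj (\<pi> \<circ> Transposition.transpose h z)"
        using pi(2)[OF A(1)] permutes_inj by (intro inj_compose) (auto simp: class_perms_def)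
      ultimately have "z = w" using A(5) by (metis inj_def)
      moreover from this have "\<pi> = \<sigma>"
        using A(5) by (metis comp_assoc comp_id transpose_comp_involutory)
      ultimately show "\<pi> = \<sigma> \<and> z = w" by simp
    qed
    show "?f ` (B \<times> Z) \<subseteq> {\<pi>\<in>av. extends \<pi> M}"
    proof clarify
      fix \<pi> z assume A: "\<pi> \<in> B" "z \<in> Z"
      let ?g = "\<pi> \<circ> Transposition.transpose h z"
      note p = pi[OF A(1)]
      have z: "z \<in> H" "cls z = cls h" "z \<notin> fst ` M" using A by (auto simp: Z_def)
      have "?g \<in> class_perms H cls" using p(2) h(1) z by (intro class_perms_swap)
      moreover have "\<not> extends ?g M'" if "M' \<in> J" for M'
      proof
        assume g: "extends ?g M'"
        have "h \<notin> fst ` M'" "h' \<notin> snd ` M'"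
          using insert.prems(6)[OF that] by (auto simp: h_def h'_def)
        have "\<pi> (fst p) = snd p" if "p \<in> M'" for p
        proof -
          have gp: "?g (fst p) = snd p" using g that by (simp add: extends_def)
          have "fst p \<noteq> h" "snd p \<noteq> h'"
            using \<open>h \<notin> fst ` M'\<close> \<open>h' \<notin> snd ` M'\<close> that by force+
          moreover have "fst p \<noteq> z" using gp p(1) \<open>snd p \<noteq> h'\<close> by auto
          ultimately show ?thesis using gp by simp
        qed
        then show False using p(4)[OF that] by (simp add: extends_def)
      qed
      moreover have "extends ?g M"
        unfolding extends_def
      proof
        fix q assume "q \<in> M"
        then have "fst q \<in> fst ` M" by simp
        then have "fst q \<noteq> h" "fst q \<noteq> z" using h2 z by auto
        then show "?g (fst q) = snd q" using p(3) \<open>q \<in> M\<close> by (simp add: extends_def)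
      qed
      ultimately show "?g \<in> av \<and> extends ?g M"
        unfolding av by blast
    qed
    show "finite {\<pi>\<in>av. extends \<pi> M}" using finav by simp
  qed
  then have *: "card B * card Z \<le> card {\<pi>\<in>av. extends \<pi> M}" by (simp add: card_cartesian_product)
  have IH: "card {\<pi>\<in>av. extends \<pi> M} * N ^ card M \<le> card av"
  proof (rule insert.IH)
    show "card M \<le> t" using insert.prems(4) insert.hyps by simp
    show "fst ` M \<inter> fst ` M' = {} \<and> snd ` M \<inter> snd ` M' = {}" if "M' \<in> J" for M'
      using insert.prems(6)[OF that] by auto
    show "M \<subseteq> H \<times> H" "inj_on fst M" "inj_on snd M" using insert.prems(1-3) by auto
    show "\<And>p. p \<in> M \<Longrightarrow> cls (fst p) = cls (snd p)" using insert.prems(5) by auto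
  qed
  have "card B * N ^ card (insert e M) = (card B * N) * N ^ card M" using insert.hyps by simp
  also have "\<dots> \<le> (card B * card Z) * N ^ card M" using Z by simp
  also have "\<dots> \<le> card {\<pi>\<in>av. extends \<pi> M} * N ^ card M" using * by simp
  also note IH
  finally show ?case by (simp add: B_def)
qed

text \<open>The local lemma with probability bound \<open>(1 / N) ^ card M\<close> and weight
  \<open>x M = (4 / N) ^ card M\<close>. Events sharing an end with \<open>M\<close> have total
  weight at most \<open>card M / 2\<close>, one quarter for each left and each right end. As
  \<open>1 - x \<ge> exp (- 2 x)\<close> for the weights that occur, the product over them is at
  least \<open>exp (- card M)\<close>, and \<open>4 > exp 1\<close> pays for it.\<close>

lemma exists_class_perm_avoiding:
  fixes cls :: "'h \<Rightarrow> 'c" and I :: "('h \<times> 'h) set set" and N t :: nat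
  assumes finH: "finite H" and N: "N > 0"
    and many: "\<And>h. h \<in> H \<Longrightarrow> N + t \<le> card {z\<in>H. cls z = cls h}"
    and I: "\<And>M. M \<in> I \<Longrightarrow> M \<noteq> {}" "\<And>M. M \<in> I \<Longrightarrow> M \<subseteq> H \<times> H" "\<And>M. M \<in> I \<Longrightarrow> inj_on fst M"
      "\<And>M. M \<in> I \<Longrightarrow> inj_on snd M" "\<And>M. M \<in> I \<Longrightarrow> card M \<le> t"
      "\<And>M p. M \<in> I \<Longrightarrow> p \<in> M \<Longrightarrow> cls (fst p) = cls (snd p)"
    and left: "\<And>h. h \<in> H \<Longrightarrow> (\<Sum>h'\<in>H. \<Sum>M | M \<in> I \<and> (h, h') \<in> M. (4 / real N) ^ card M) \<le> 1/4"
    and right: "\<And>h'. h' \<in> H \<Longrightarrow> (\<Sum>h\<in>H. \<Sum>M | M \<in> I \<and> (h, h') \<in> M. (4 / real N) ^ card M) \<le> 1/4"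
  shows "\<exists>\<pi>\<in>class_perms H cls. \<forall>M\<in>I. \<not> extends \<pi> M"
proof -
  define x where "x M = (4 / real N) ^ card M" for M :: "('h \<times> 'h) set"
  have x0: "0 \<le> x M" for M by (simp add: x_def)
  have finI: "finite I"
    by (rule finite_subset[of _ "Pow (H \<times> H)"]) (use I(2) finH in auto)
  have finM: "finite M" if "M \<in> I" for M
    using I(2)[OF that] finH finite_subset by blast
  define nb where "nb M = {M'\<in>I. fst ` M \<inter> fst ` M' \<noteq> {} \<or> snd ` M \<inter> snd ` M' \<noteq> {}}" for M
  have L: "(\<Sum>M | M \<in> I \<and> h \<in> fst ` M. x M) \<le> 1/4" if "h \<in> H" for h
  proof -
    have "(\<Sum>M | M \<in> I \<and> h \<in> fst ` M. x M) \<le> (\<Sum>M\<in>(\<Union>h'\<in>H. {M. M \<in> I \<and> (h, h') \<in> M}). x M)"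
      by (rule sum_mono2) (use finI finH I(2) x0 in force)+
    also have "\<dots> \<le> (\<Sum>h'\<in>H. \<Sum>M | M \<in> I \<and> (h, h') \<in> M. x M)"
      by (rule sum_UN_le) (use finH finI x0 in auto)
    finally show ?thesis using left[OF that] by (simp add: x_def)
  qed
  have R: "(\<Sum>M | M \<in> I \<and> h' \<in> snd ` M. x M) \<le> 1/4" if "h' \<in> H" for h'
  proof -
    have "(\<Sum>M | M \<in> I \<and> h' \<in> snd ` M. x M) \<le> (\<Sum>M\<in>(\<Union>h\<in>H. {M. M \<in> I \<and> (h, h') \<in> M}). x M)"
      by (rule sum_mono2) (use finI finH I(2) x0 in force)+
    also have "\<dots> \<le> (\<Sum>h\<in>H. \<Sum>M | M \<in> I \<and> (h, h') \<in> M. x M)"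
      by (rule sum_UN_le) (use finH finI x0 in auto)
    finally show ?thesis using right[OF that] by (simp add: x_def)
  qed
  have x_le: "x M \<le> 1/4" if M: "M \<in> I" for M
  proof -
    obtain p where p: "p \<in> M" using I(1)[OF M] by auto
    have "x M \<le> (\<Sum>M | M \<in> I \<and> fst p \<in> fst ` M. x M)"
      by (rule member_le_sum) (use p M finI x0 in auto)
    also have "\<dots> \<le> 1/4" using L p I(2)[OF M] by auto
    finally show ?thesis .
  qed
  have "\<exists>\<pi>\<in>class_perms H cls. \<forall>M\<in>I. \<pi> \<notin> {\<pi>. extends \<pi> M}"
  proof (rule lopsided_local_lemma[where x = x and p = "\<lambda>M. (1 / real N) ^ card M" and N = nb])
    show "finite I" by fact
    show "finite (class_perms H cls)" using finH by (rule finite_class_perms)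
    have "id \<in> class_perms H cls" by (auto simp: class_perms_def permutes_id)
    then show "class_perms H cls \<noteq> {}" by auto
    show "nb M \<subseteq> I" for M by (auto simp: nb_def)
    show "M \<in> nb M" if "M \<in> I" for M using that I(1) by (auto simp: nb_def)
    show "0 \<le> x M" for M by (rule x0)
    show "x M < 1" if "M \<in> I" for M using x_le[OF that] by simp
    show "real (card {\<pi> \<in> class_perms H cls. \<pi> \<in> {\<pi>. extends \<pi> M} \<and> (\<forall>j\<in>J. \<pi> \<notin> {\<pi>. extends \<pi> j})})
        \<le> (1 / real N) ^ card M * real (card {\<pi> \<in> class_perms H cls. \<forall>j\<in>J. \<pi> \<notin> {\<pi>. extends \<pi> j}})"
      if M: "M \<in> I" "J \<subseteq> I - nb M" for M J
    proof -
      define av where "av = {\<pi>\<in>class_perms H cls. \<forall>M'\<in>J. \<not> extends \<pi> M'}"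
      have "card {\<pi>\<in>av. extends \<pi> M} * N ^ card M \<le> card av"
      proof (rule card_class_perms_extending[OF finH many finM[OF M(1)]])
        fix M' assume "M' \<in> J"
        then have "M' \<in> I" "M' \<notin> nb M" using M(2) by auto
        then show "fst ` M \<inter> fst ` M' = {} \<and> snd ` M \<inter> snd ` M' = {}" unfolding nb_def by blast
      qed (use I M(1) in \<open>auto simp: av_def\<close>)
      then have "real (card {\<pi>\<in>av. extends \<pi> M}) * real N ^ card M \<le> real (card av)"
        by (metis of_nat_le_iff of_nat_mult of_nat_power)
      then have "real (card {\<pi>\<in>av. extends \<pi> M}) \<le> (1 / real N) ^ card M * real (card av)"
        using N by (simp add: field_simps power_divide)
      moreover have "{\<pi> \<in> class_perms H cls. \<pi> \<in> {\<pi>. extends \<pi> M} \<and> (\<forall>j\<in>J. \<pi> \<notin> {\<pi>. extends \<pi> j})}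
          = {\<pi>\<in>av. extends \<pi> M}" by (auto simp: av_def)
      ultimately show ?thesis by (simp add: av_def)
    qed
    show "(1 / real N) ^ card M \<le> x M * (\<Prod>M'\<in>nb M. 1 - x M')" if M: "M \<in> I" for M
    proof -
      have fn: "finite (nb M)" using finI by (simp add: nb_def)
      have "(\<Sum>M'\<in>nb M. x M') \<le> (\<Sum>M'\<in>(\<Union>h\<in>fst ` M. {M'. M' \<in> I \<and> h \<in> fst ` M'})
          \<union> (\<Union>h\<in>snd ` M. {M'. M' \<in> I \<and> h \<in> snd ` M'}). x M')"
        by (rule sum_mono2) (use finI finM[OF M] x0 in \<open>auto simp: nb_def\<close>)
      also have "\<dots> \<le> (\<Sum>M'\<in>(\<Union>h\<in>fst ` M. {M'. M' \<in> I \<and> h \<in> fst ` M'}). x M')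
          + (\<Sum>M'\<in>(\<Union>h\<in>snd ` M. {M'. M' \<in> I \<and> h \<in> snd ` M'}). x M')"
        by (subst sum_Un) (use finI finM[OF M] x0 in \<open>auto intro!: sum_nonneg\<close>)
      also have "\<dots> \<le> (\<Sum>h\<in>fst ` M. \<Sum>M' | M' \<in> I \<and> h \<in> fst ` M'. x M')
          + (\<Sum>h\<in>snd ` M. \<Sum>M' | M' \<in> I \<and> h \<in> snd ` M'. x M')"
        by (intro add_mono sum_UN_le) (use finI finM[OF M] x0 in auto)
      also have "\<dots> \<le> (\<Sum>h\<in>fst ` M. 1/4) + (\<Sum>h\<in>snd ` M. 1/4)"
        by (intro add_mono sum_mono L R) (use I(2)[OF M] in auto)
      also have "\<dots> = real (card M) / 2"
        using I(3,4)[OF M] by (simp add: card_image)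
      finally have S: "(\<Sum>M'\<in>nb M. x M') \<le> real (card M) / 2" .
      have "(1 / 4) ^ card M \<le> exp (- 1 :: real) ^ card M"
      proof (rule power_mono)
        have "exp 1 \<le> (4::real)" using exp_le by linarith
        then show "1 / 4 \<le> exp (- 1 :: real)" by (simp add: exp_minus field_simps)
      qed simp
      also have "\<dots> = exp (- real (card M))" by (simp add: exp_of_nat_mult[symmetric])
      also have "\<dots> \<le> exp (\<Sum>M'\<in>nb M. - (2 * x M'))"
        using S by (simp add: sum_negf sum_distrib_left[symmetric])
      also have "\<dots> = (\<Prod>M'\<in>nb M. exp (- (2 * x M')))" using fn by (rule exp_sum)
      also have "\<dots> \<le> (\<Prod>M'\<in>nb M. 1 - x M')"
      proof (rule prod_mono, safe)
        fix M' assume "M' \<in> nb M"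
        then have x14: "x M' \<le> 1/4" using x_le by (auto simp: nb_def)
        have "x M' * x M' \<le> (1/4) * x M'" by (rule mult_right_mono[OF x14 x0])
        then have "- (2 * x M') \<le> - x M' - 2 * (x M')\<^sup>2" using x0[of M'] unfolding power2_eq_square by linarith
        also have "\<dots> \<le> ln (1 - x M')"
          by (rule ln_one_minus_pos_lower_bound) (use x0 x14 in auto)
        finally show "exp (- (2 * x M')) \<le> 1 - x M'" using x14 by (simp add: ln_ge_iff)
      qed simp
      finally have "(1 / 4) ^ card M * x M \<le> (\<Prod>M'\<in>nb M. 1 - x M') * x M"
        by (rule mult_right_mono[OF _ x0])
      moreover have "(1 / 4) ^ card M * x M = (1 / real N) ^ card M"
        by (simp add: x_def flip: power_mult_distrib)
      ultimately show ?thesis by (simp add: mult.commute)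
    qed
  qed
  then show ?thesis by simp
qed

section \<open>Completing a symmetric set\<close>

text \<open>One term of the exponential series. It gives \<open>t ^ t \<le> exp t * fact t\<close>
  for the binomial coefficients and, later, polynomial decay of \<open>exp (- x)\<close>.\<close>

lemma pow_le_exp_mult_fact:
  fixes x :: real
  assumes "0 \<le> x"
  shows "x ^ n \<le> exp x * fact n"
proof -
  have s: "summable (\<lambda>n. inverse (fact n) * x ^ n)" by (rule summable_exp)
  have "inverse (fact n) * x ^ n = (\<Sum>i\<in>{n}. inverse (fact i) * x ^ i)" by simp
  also have "\<dots> \<le> (\<Sum>i. inverse (fact i) * x ^ i)"
    by (rule sum_le_suminf[OF s]) (use assms in auto)
  also have "\<dots> = exp x" by (simp add: exp_def scaleR_conv_of_real field_simps)
  finally show ?thesis by (simp add: field_simps)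
qed

lemma binomial_le_exp_pow:
  assumes "0 < t"
  shows "real (w choose t) \<le> (3 * real w / real t) ^ t"
proof -
  have "real (w choose t) * fact t \<le> real w ^ t"
    using binomial_fact_pow[of w t] by (metis of_nat_fact of_nat_le_iff of_nat_mult of_nat_power)
  moreover have "real t ^ t \<le> exp (real t) * fact t" by (rule pow_le_exp_mult_fact) simp
  moreover have "exp (real t) \<le> 3 ^ t"
  proof -
    have "exp (real t) = exp 1 ^ t" by (simp add: exp_of_nat_mult[symmetric])
    also have "\<dots> \<le> 3 ^ t" by (rule power_mono) (use exp_le in auto)
    finally show ?thesis .
  qed
  ultimately have "real (w choose t) * real t ^ t \<le> real (w choose t) * (3 ^ t * fact t)"
    by (intro mult_left_mono) (meson fact_ge_zero mult_right_mono order_trans, simp)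
  also have "\<dots> \<le> 3 ^ t * real w ^ t"
    using \<open>real (w choose t) * fact t \<le> real w ^ t\<close> by (simp add: mult.assoc mult.left_commute)
  finally show ?thesis using assms by (simp add: power_divide power_mult_distrib field_simps)
qed

section \<open>Primitive directions and sums over them\<close>

definition dirs :: "nat \<Rightarrow> (int \<times> int) set" where
  "dirs n = {(a, b). oblique a b \<and> \<bar>a\<bar> \<le> int n \<and> \<bar>b\<bar> \<le> int n}"

definition len :: "int \<times> int \<Rightarrow> nat" where
  "len d = nat (max \<bar>fst d\<bar> \<bar>snd d\<bar>)"

lemma finite_dirs [simp]: "finite (dirs n)"
  by (rule finite_subset[of _ "{- int n..int n} \<times> {- int n..int n}"]) (auto simp: dirs_def)

lemma len_pos: "d \<in> dirs n \<Longrightarrow> 0 < len d"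
  by (auto simp: dirs_def len_def oblique_def)

lemma len_le: "d \<in> dirs n \<Longrightarrow> len d \<le> n"
  by (auto simp: dirs_def len_def)

text \<open>The correction \<open>2 / n\<close> makes the induction telescope, since
  \<open>1 / (n + 1)^2 \<le> 1 / n - 1 / (n + 1)\<close>.\<close>

lemma sum_inverse_squares_le:
  "(\<Sum>a\<in>{- int n..int n} - {0}. 1 / (real_of_int a)\<^sup>2) \<le> 4 - 2 / real n" if "n \<ge> 1"
  using that
proof (induction n rule: nat_induct_at_least)
  case base
  have "{- int 1..int 1} - {0} = {-1, 1 :: int}" by auto
  then show ?case by simp
next
  case (Suc n)
  have eq: "{- int (Suc n)..int (Suc n)} - {0} = insert (int (Suc n)) (insert (- int (Suc n)) ({- int n..int n} - {0}))"
    by auto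
  have "(\<Sum>a\<in>{- int (Suc n)..int (Suc n)} - {0}. 1 / (real_of_int a)\<^sup>2)
      = 2 / (real n + 1)\<^sup>2 + (\<Sum>a\<in>{- int n..int n} - {0}. 1 / (real_of_int a)\<^sup>2)"
  proof -
    have "(- 1 - real n)\<^sup>2 = (1 + real n)\<^sup>2" by (simp add: power2_eq_square algebra_simps)
    then show ?thesis unfolding eq by (simp add: add.commute)
  qed
  also have "\<dots> \<le> 2 / (real n + 1)\<^sup>2 + (4 - 2 / real n)" using Suc.IH by simp
  also have "\<dots> \<le> 4 - 2 / (real n + 1)"
  proof -
    have "2 / (real n + 1)\<^sup>2 \<le> 2 / (real n * (real n + 1))"
      using Suc.hyps by (intro divide_left_mono) (auto simp: power2_eq_square)
    also have "\<dots> = 2 / real n - 2 / (real n + 1)" using Suc.hyps by (simp add: field_simps)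
    finally show ?thesis by simp
  qed
  finally show ?case by (simp add: add.commute)
qed

text \<open>The maximum norm satisfies \<open>len ^ 4 \<ge> a^2 b^2\<close>, so the double sum
  factorises, each factor being at most 4. Both orientations of a line occur in
  \<open>dirs n\<close>; this is harmless, as the sum only serves in union bounds.\<close>

lemma sum_len_inverse_pow4_le: "(\<Sum>d\<in>dirs n. 1 / real (len d) ^ 4) \<le> 16"
proof (cases "n = 0")
  case True
  then have "dirs n = {}" by (auto simp: dirs_def oblique_def)
  then show ?thesis by simp
next
  case False
  let ?A = "{- int n..int n} - {0}"
  have "(\<Sum>d\<in>dirs n. 1 / real (len d) ^ 4) \<le> (\<Sum>d\<in>?A \<times> ?A. 1 / real (len d) ^ 4)"
    by (rule sum_mono2) (auto simp: dirs_def oblique_def)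
  also have "\<dots> \<le> (\<Sum>d\<in>?A \<times> ?A. 1 / (real_of_int (fst d))\<^sup>2 * (1 / (real_of_int (snd d))\<^sup>2))"
  proof (rule sum_mono)
    fix d assume d: "d \<in> ?A \<times> ?A"
    have l: "real (len d) = max \<bar>real_of_int (fst d)\<bar> \<bar>real_of_int (snd d)\<bar>"
      by (simp add: len_def)
    have "(real_of_int (fst d))\<^sup>2 * (real_of_int (snd d))\<^sup>2 \<le> (real (len d))\<^sup>2 * (real (len d))\<^sup>2"
      unfolding l by (intro mult_mono) (auto simp: abs_le_square_iff[symmetric])
    then have "(real_of_int (fst d))\<^sup>2 * (real_of_int (snd d))\<^sup>2 \<le> real (len d) ^ 4"
      by (simp add: power2_eq_square power4_eq_xxxx mult.assoc)
    moreover have "0 < (real_of_int (fst d))\<^sup>2 * (real_of_int (snd d))\<^sup>2"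
      using d by (intro mult_pos_pos) auto
    moreover have "0 < len d" using d by (auto simp: len_def)
    ultimately have "1 / real (len d) ^ 4 \<le> 1 / ((real_of_int (fst d))\<^sup>2 * (real_of_int (snd d))\<^sup>2)"
      by (intro divide_left_mono) (auto intro!: mult_pos_pos)
    then show "1 / real (len d) ^ 4 \<le> 1 / (real_of_int (fst d))\<^sup>2 * (1 / (real_of_int (snd d))\<^sup>2)" by simp
  qed
  also have "\<dots> = (\<Sum>a\<in>?A. 1 / (real_of_int a)\<^sup>2) * (\<Sum>a\<in>?A. 1 / (real_of_int a)\<^sup>2)"
    by (simp only: sum_product sum.cartesian_product case_prod_unfold)
  also have "\<dots> \<le> 4 * 4"
  proof -
    have "(\<Sum>a\<in>?A. 1 / (real_of_int a)\<^sup>2) \<le> 4 - 2 / real n"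
      by (rule sum_inverse_squares_le) (use False in simp)
    also have "\<dots> \<le> 4" by simp
    finally have *: "(\<Sum>a\<in>?A. 1 / (real_of_int a)\<^sup>2) \<le> 4" .
    show ?thesis by (rule mult_mono[OF * *]) (auto intro: sum_nonneg)
  qed
  finally show ?thesis by simp
qed

lemma inj_on_fst_lat_line: "oblique a b \<Longrightarrow> inj_on fst (lat_line a b c)"
  by (rule inj_onI) (auto simp: lat_line_def oblique_def prod_eq_iff)

lemma inj_on_snd_lat_line: "oblique a b \<Longrightarrow> inj_on snd (lat_line a b c)"
  by (rule inj_onI) (auto simp: lat_line_def oblique_def prod_eq_iff)

lemma dirs_if_two_points:
  assumes "oblique a b" "p \<in> square n \<inter> lat_line a b c" "q \<in> square n \<inter> lat_line a b c" "p \<noteq> q"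
  shows "(a, b) \<in> dirs n"
proof -
  have ab: "coprime a b" "a \<noteq> 0" "b \<noteq> 0" using assms(1) by (auto simp: oblique_def)
  have eq: "b * (fst p - fst q) = a * (snd p - snd q)"
    using assms(2,3) by (auto simp: lat_line_def algebra_simps)
  have ne: "fst p - fst q \<noteq> 0" "snd p - snd q \<noteq> 0"
    using assms(4) eq ab by (auto simp: prod_eq_iff)
  have "a dvd b * (fst p - fst q)" "b dvd a * (snd p - snd q)" using eq by (metis dvd_triv_left)+
  then have "a dvd fst p - fst q" "b dvd snd p - snd q"
    using ab by (auto simp: coprime_dvd_mult_right_iff coprime_commute)
  then have "\<bar>a\<bar> \<le> \<bar>fst p - fst q\<bar>" "\<bar>b\<bar> \<le> \<bar>snd p - snd q\<bar>"
    using ne by (auto intro: dvd_imp_le_int)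
  moreover have "\<bar>fst p - fst q\<bar> \<le> int n" "\<bar>snd p - snd q\<bar> \<le> int n"
    using assms(2,3) by (auto simp: square_def)
  ultimately show ?thesis using assms(1) by (auto simp: dirs_def)
qed

lemma card_line_real_le:
  assumes "(a, b) \<in> dirs n"
  shows "real (card (square n \<inter> lat_line a b c)) \<le> 2 * real n / real (len (a, b))"
proof -
  let ?m = "len (a, b)"
  have m: "0 < ?m" "?m \<le> n" using len_pos[OF assms] len_le[OF assms] by auto
  have "card (square n \<inter> lat_line a b c) \<le> (n - 1) div ?m + 1"
    by (rule card_lat_line_le) (use assms in \<open>auto simp: dirs_def len_def\<close>)
  then have "real (card (square n \<inter> lat_line a b c)) \<le> real ((n - 1) div ?m) + 1" by linarith
  also have "\<dots> \<le> real n / real ?m + real n / real ?m"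
  proof (rule add_mono)
    have "real ((n - 1) div ?m) \<le> real (n - 1) / real ?m" by (rule of_nat_div_le_of_nat)
    also have "\<dots> \<le> real n / real ?m" by (rule divide_right_mono) auto
    finally show "real ((n - 1) div ?m) \<le> real n / real ?m" .
    show "1 \<le> real n / real ?m" using m by simp
  qed
  finally show ?thesis by simp
qed

text \<open>An oblique line meets each row and each column at most once. Hence the cells with an
  exceptional coordinate, of weight up to \<open>\<kappa>^2\<close>, number at most twice the
  exceptional indices, and all other cells weigh at most \<open>\<beta>^2\<close>.\<close>

lemma line_weight_le:
  fixes f :: "int \<Rightarrow> nat" and \<beta> \<kappa> :: real
  assumes ob: "oblique a b" and f: "\<And>y. y \<in> {1..int n} \<Longrightarrow> real (f y) \<le> \<kappa>" and \<beta>: "0 \<le> \<beta>"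
  shows "(\<Sum>p\<in>square n \<inter> lat_line a b c. real (f (fst p) * f (snd p)))
    \<le> \<beta>\<^sup>2 * real (card (square n \<inter> lat_line a b c)) + 2 * \<kappa>\<^sup>2 * real (card {y\<in>{1..int n}. \<beta> < real (f y)})"
proof -
  let ?L = "square n \<inter> lat_line a b c" and ?E = "{y\<in>{1..int n}. \<beta> < real (f y)}"
  have "(\<Sum>p\<in>?L. real (f (fst p) * f (snd p)))
      \<le> (\<Sum>p\<in>?L. \<beta>\<^sup>2 + \<kappa>\<^sup>2 * of_bool (fst p \<in> ?E) + \<kappa>\<^sup>2 * of_bool (snd p \<in> ?E))"
  proof (rule sum_mono)
    fix p assume "p \<in> ?L"
    then have p: "fst p \<in> {1..int n}" "snd p \<in> {1..int n}" by (auto simp: square_def)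
    show "real (f (fst p) * f (snd p)) \<le> \<beta>\<^sup>2 + \<kappa>\<^sup>2 * of_bool (fst p \<in> ?E) + \<kappa>\<^sup>2 * of_bool (snd p \<in> ?E)"
    proof (cases "fst p \<in> ?E \<or> snd p \<in> ?E")
      case True
      have "real (f (fst p) * f (snd p)) \<le> \<kappa>\<^sup>2"
        unfolding of_nat_mult power2_eq_square by (rule mult_mono) (use f p \<beta> order_trans[OF _ f[OF p(1)]] in auto)
      also have "\<dots> \<le> \<kappa>\<^sup>2 * of_bool (fst p \<in> ?E) + \<kappa>\<^sup>2 * of_bool (snd p \<in> ?E)"
        using True by auto
      finally show ?thesis by (smt (verit) zero_le_power2)
    next
      case False
      have "real (f (fst p) * f (snd p)) \<le> \<beta>\<^sup>2"
        unfolding of_nat_mult power2_eq_square by (rule mult_mono) (use False p \<beta> in auto)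
      moreover have "0 \<le> \<kappa>\<^sup>2 * of_bool (fst p \<in> ?E)" "0 \<le> \<kappa>\<^sup>2 * of_bool (snd p \<in> ?E)"
        by simp_all
      ultimately show ?thesis by linarith
    qed
  qed
  also have "\<dots> = \<beta>\<^sup>2 * real (card ?L) + \<kappa>\<^sup>2 * real (card {p\<in>?L. fst p \<in> ?E}) + \<kappa>\<^sup>2 * real (card {p\<in>?L. snd p \<in> ?E})"
  proof -
    have ind: "(\<Sum>p\<in>?L. of_bool (P p)) = real (card {p\<in>?L. P p})" for P
      by (simp add: sum.If_cases of_bool_def Int_def)
    show ?thesis by (simp only: sum.distrib sum_distrib_left[symmetric] ind) (simp add: mult.commute)
  qed
  also have "\<dots> \<le> \<beta>\<^sup>2 * real (card ?L) + \<kappa>\<^sup>2 * real (card ?E) + \<kappa>\<^sup>2 * real (card ?E)"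
  proof (intro add_mono mult_left_mono order_refl of_nat_mono)
    have finE: "finite ?E" by (rule finite_subset[of _ "{1..int n}"]) auto
    show "card {p\<in>?L. fst p \<in> ?E} \<le> card ?E"
      by (rule card_inj_on_le[OF _ _ finE, of fst])
        (use inj_on_fst_lat_line[OF ob, of c] in \<open>auto simp: inj_on_def\<close>)
    show "card {p\<in>?L. snd p \<in> ?E} \<le> card ?E"
      by (rule card_inj_on_le[OF _ _ finE, of snd])
        (use inj_on_snd_lat_line[OF ob, of c] in \<open>auto simp: inj_on_def\<close>)
  qed auto
  finally show ?thesis by simp
qed

section \<open>Half-edges and bad partial matchings\<close>

text \<open>The deficits \<open>f\<close> of the rows, which are also those of the columns, are repaired by a random
  class-preserving permutation of the half-edges \<open>(y, i)\<close>, \<open>i < f y\<close>: the half-edge \<open>h\<close> of row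
  \<open>fst h\<close> is joined to the half-edge \<open>\<pi> h\<close>, regarded as one of column \<open>fst (\<pi> h)\<close>.\<close>

definition half_edges :: "nat \<Rightarrow> (int \<Rightarrow> nat) \<Rightarrow> (int \<times> nat) set" where
  "half_edges n f = Sigma {1..int n} (\<lambda>y. {..<f y})"

definition cell :: "(int \<times> nat) \<times> (int \<times> nat) \<Rightarrow> int \<times> int" where
  "cell p = (fst (snd p), fst (fst p))"

lemma finite_half_edges [simp]: "finite (half_edges n f)"
  by (simp add: half_edges_def)

lemma card_half_edges_over:
  assumes "Y \<subseteq> {1..int n}"
  shows "card {h\<in>half_edges n f. fst h \<in> Y} = (\<Sum>y\<in>Y. f y)"
proof -
  have "{h\<in>half_edges n f. fst h \<in> Y} = Sigma Y (\<lambda>y. {..<f y})"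
    using assms by (auto simp: half_edges_def)
  then show ?thesis using finite_subset[OF assms] by simp
qed

lemma card_half_edges_row:
  assumes "y \<in> {1..int n}"
  shows "card {h\<in>half_edges n f. fst h = y} = f y"
  using card_half_edges_over[of "{y}" n f] assms by simp

lemma card_half_edge_pairs_le:
  "card {p\<in>half_edges n f \<times> half_edges n f. cell p \<in> L} \<le> (\<Sum>q\<in>square n \<inter> L. f (fst q) * f (snd q))"
proof -
  let ?P = "\<lambda>q. ({snd q} \<times> {..<f (snd q)}) \<times> ({fst q} \<times> {..<f (fst q)})"
  have "{p\<in>half_edges n f \<times> half_edges n f. cell p \<in> L} \<subseteq> (\<Union>q\<in>square n \<inter> L. ?P q)"
    by (force simp: half_edges_def cell_def square_def)
  then have "card {p\<in>half_edges n f \<times> half_edges n f. cell p \<in> L} \<le> card (\<Union>q\<in>square n \<inter> L. ?P q)"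
    by (rule card_mono[rotated]) auto
  also have "\<dots> \<le> (\<Sum>q\<in>square n \<inter> L. card (?P q))" by (rule card_UN_le) simp
  also have "\<dots> = (\<Sum>q\<in>square n \<inter> L. f (fst q) * f (snd q))"
    by (simp add: card_cartesian_product mult.commute)
  finally show ?thesis .
qed

lemma card_residue_class:
  "\<bar>real (card {z\<in>{1..int n}. z mod 20 = r mod 20}) - real n / 20\<bar> \<le> 1"
proof -
  define r' where "r' = (if r mod 20 = 0 then 20 else r mod 20)"
  have r': "1 \<le> r'" "r' \<le> 20" "r' mod 20 = r mod 20"
    using pos_mod_bound[of 20 r] pos_mod_sign[of 20 r] by (auto simp: r'_def simp del: pos_mod_bound pos_mod_sign)
  have "card ((\<lambda>i. r' + 20 * int i) ` {..<n div 20}) \<le> card {z\<in>{1..int n}. z mod 20 = r mod 20}"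
  proof (rule card_mono)
    show "finite {z\<in>{1..int n}. z mod 20 = r mod 20}" by (rule finite_subset[of _ "{1..int n}"]) auto
    show "(\<lambda>i. r' + 20 * int i) ` {..<n div 20} \<subseteq> {z\<in>{1..int n}. z mod 20 = r mod 20}"
    proof (rule image_subsetI)
      fix i assume "i \<in> {..<n div 20}"
      then have "20 * (i + 1) \<le> n" by (simp add: less_eq_div_iff_mult_less_eq Suc_le_eq)
      then show "r' + 20 * int i \<in> {z\<in>{1..int n}. z mod 20 = r mod 20}" using r' by auto
    qed
  qed
  then have "n div 20 \<le> card {z\<in>{1..int n}. z mod 20 = r mod 20}"
    by (subst (asm) card_image) (auto simp: inj_on_def)
  moreover have "real n / 20 - 1 \<le> real (n div 20)" by linarith
  moreover have "card {z\<in>{1..int n}. z mod 20 = r mod 20} \<le> (n - 1) div 20 + 1"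
  proof (rule card_spaced_le)
    fix x y assume "x \<in> {z\<in>{1..int n}. z mod 20 = r mod 20}" "y \<in> {z\<in>{1..int n}. z mod 20 = r mod 20}"
    then have "x mod 20 = y mod 20" by simp
    then show "int 20 dvd x - y" by (simp add: mod_eq_dvd_iff)
  qed auto
  moreover have "real ((n - 1) div 20) \<le> real n / 20" by linarith
  ultimately show ?thesis by linarith
qed

text \<open>Fixing the size keeps the weights in the local lemma small and loses nothing, since a
  line with more pairs contains such a subset. The congruence mod 20 singles out the pairs that a
  class-preserving permutation can contain.\<close>

definition collinear_matchings :: "nat \<Rightarrow> nat \<Rightarrow> (int \<times> nat) set \<Rightarrow> ((int \<times> nat) \<times> (int \<times> nat)) set set" where
  "collinear_matchings n t H = {M. M \<subseteq> H \<times> H \<and> inj_on fst M \<and> inj_on snd M \<and> card M = t \<and>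
     (\<forall>p\<in>M. fst (fst p) mod 20 = fst (snd p) mod 20) \<and>
     (\<exists>(a, b)\<in>dirs n. \<exists>c. cell ` M \<subseteq> lat_line a b c)}"

text \<open>Two pairs of half-edges without a common end that produce the same cell. Avoiding them
  makes the new points distinct, so that row and column counts agree with the numbers of
  half-edges.\<close>

definition double_matchings :: "(int \<times> nat) set \<Rightarrow> ((int \<times> nat) \<times> (int \<times> nat)) set set" where
  "double_matchings H = {M. \<exists>h h' u u'. M = {(h, h'), (u, u')} \<and> h \<in> H \<and> h' \<in> H \<and> u \<in> H \<and> u' \<in> H \<and>
     h \<noteq> u \<and> h' \<noteq> u' \<and> fst h = fst u \<and> fst h' = fst u' \<and> fst h mod 20 = fst h' mod 20}"

lemma card_double_matchings_le:
  assumes "h \<in> half_edges n f" "h' \<in> half_edges n f"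
  shows "card {M\<in>double_matchings (half_edges n f). (h, h') \<in> M} \<le> f (fst h) * f (fst h')"
proof -
  let ?H = "half_edges n f"
  let ?A = "{u\<in>?H. fst u = fst h}" and ?B = "{u\<in>?H. fst u = fst h'}"
  have "{M\<in>double_matchings ?H. (h, h') \<in> M} \<subseteq> (\<lambda>p. {(h, h'), p}) ` (?A \<times> ?B)"
  proof
    fix M assume M: "M \<in> {M\<in>double_matchings ?H. (h, h') \<in> M}"
    then obtain v v' u u' where *: "M = {(v, v'), (u, u')}" "v \<in> ?H" "v' \<in> ?H" "u \<in> ?H" "u' \<in> ?H"
       "fst v = fst u" "fst v' = fst u'"
      unfolding double_matchings_def by blast
    have "(h, h') = (v, v') \<or> (h, h') = (u, u')" using M * by auto
    then show "M \<in> (\<lambda>p. {(h, h'), p}) ` (?A \<times> ?B)"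
    proof
      assume "(h, h') = (v, v')"
      then show ?thesis using * by (intro image_eqI[of _ _ "(u, u')"]) auto
    next
      assume "(h, h') = (u, u')"
      then show ?thesis using * by (intro image_eqI[of _ _ "(v, v')"]) auto
    qed
  qed
  then have "card {M\<in>double_matchings ?H. (h, h') \<in> M} \<le> card ((\<lambda>p. {(h, h'), p}) ` (?A \<times> ?B))"
    by (rule card_mono[rotated]) simp
  also have "\<dots> \<le> card (?A \<times> ?B)" by (rule card_image_le) simp
  also have "\<dots> = f (fst h) * f (fst h')"
    using card_half_edges_row[of "fst h" n f] card_half_edges_row[of "fst h'" n f] assms
    by (auto simp: card_cartesian_product half_edges_def)
  finally show ?thesis .
qed

text \<open>Once the pair \<open>e\<close> is fixed, a direction determines the line, on which
  \<open>t\<close> further pairs are chosen. The directions are handled by a union bound.\<close>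

lemma card_collinear_matchings_le:
  assumes W: "\<And>a b c. (a, b) \<in> dirs n \<Longrightarrow>
      real (card {p\<in>half_edges n f \<times> half_edges n f. cell p \<in> lat_line a b c}) \<le> W (a, b)"
    and t: "0 < t"
  shows "real (card {M\<in>collinear_matchings n (Suc t) (half_edges n f). e \<in> M})
    \<le> (\<Sum>d\<in>dirs n. (3 * W d / real t) ^ t)"
proof -
  let ?H = "half_edges n f"
  define P where "P d = {p\<in>?H \<times> ?H. cell p \<in> lat_line (fst d) (snd d) (snd d * fst (cell e) - fst d * snd (cell e))}" for d
  have finP: "finite (P d)" for d
    by (rule finite_subset[of _ "?H \<times> ?H"]) (auto simp: P_def)
  have "{M\<in>collinear_matchings n (Suc t) ?H. e \<in> M} \<subseteq> (\<Union>d\<in>dirs n. insert e ` {M. M \<subseteq> P d \<and> card M = t})"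
  proof
    fix M assume M: "M \<in> {M\<in>collinear_matchings n (Suc t) ?H. e \<in> M}"
    then have M1: "M \<subseteq> ?H \<times> ?H" "card M = Suc t" "e \<in> M" by (auto simp: collinear_matchings_def)
    obtain a b c where abc: "(a, b) \<in> dirs n" "cell ` M \<subseteq> lat_line a b c"
      using M by (auto simp: collinear_matchings_def)
    have c: "c = b * fst (cell e) - a * snd (cell e)" using abc M1 by (auto simp: lat_line_def)
    have "M - {e} \<subseteq> P (a, b)" using M1 abc c by (auto simp: P_def)
    moreover have "card (M - {e}) = t" using M1 by simp
    moreover have "M = insert e (M - {e})" using M1 by auto
    ultimately show "M \<in> (\<Union>d\<in>dirs n. insert e ` {M. M \<subseteq> P d \<and> card M = t})" using abc(1) by blast
  qed
  then have "card {M\<in>collinear_matchings n (Suc t) ?H. e \<in> M}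
      \<le> card (\<Union>d\<in>dirs n. insert e ` {M. M \<subseteq> P d \<and> card M = t})"
    by (rule card_mono[rotated]) (use finP in auto)
  also have "\<dots> \<le> (\<Sum>d\<in>dirs n. card (insert e ` {M. M \<subseteq> P d \<and> card M = t}))"
    by (rule card_UN_le) simp
  also have "\<dots> \<le> (\<Sum>d\<in>dirs n. card {M. M \<subseteq> P d \<and> card M = t})"
    by (rule sum_mono, rule card_image_le) (use finP in auto)
  also have "\<dots> = (\<Sum>d\<in>dirs n. card (P d) choose t)"
    using finP by (simp add: n_subsets)
  finally have "real (card {M\<in>collinear_matchings n (Suc t) ?H. e \<in> M}) \<le> real (\<Sum>d\<in>dirs n. card (P d) choose t)"
    by (rule of_nat_mono)
  also have "\<dots> = (\<Sum>d\<in>dirs n. real (card (P d) choose t))" by (rule of_nat_sum)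
  also have "\<dots> \<le> (\<Sum>d\<in>dirs n. (3 * W d / real t) ^ t)"
  proof (rule sum_mono)
    fix d assume d: "d \<in> dirs n"
    have "real (card (P d) choose t) \<le> (3 * real (card (P d)) / real t) ^ t"
      by (rule binomial_le_exp_pow[OF t])
    also have "\<dots> \<le> (3 * W d / real t) ^ t"
      using W[of "fst d" "snd d"] d by (intro power_mono divide_right_mono) (auto simp: P_def)
    finally show "real (card (P d) choose t) \<le> (3 * W d / real t) ^ t" .
  qed
  finally show ?thesis .
qed

lemma sum_half_edges:
  fixes g :: "int \<Rightarrow> real"
  shows "(\<Sum>h\<in>half_edges n f. g (fst h)) = (\<Sum>y\<in>{1..int n}. real (f y) * g y)"
proof -
  have "(\<Sum>h\<in>half_edges n f. g (fst h)) = (\<Sum>y\<in>{1..int n}. \<Sum>i\<in>{..<f y}. g y)"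
    unfolding half_edges_def by (subst sum.Sigma) (auto simp: case_prod_unfold)
  then show ?thesis by simp
qed

lemma scale_sum_pow:
  fixes x :: real
  shows "x ^ Suc t * (\<Sum>d\<in>D. (3 * w d / s) ^ t) = x * (\<Sum>d\<in>D. (3 * x * w d / s) ^ t)"
  by (simp add: power_mult_distrib power_divide sum_distrib_left mult_ac)

section \<open>Completion of prescribed deficits under size bounds\<close>

context
  fixes n k t :: nat and f :: "int \<Rightarrow> nat"
  assumes k: "10 ^ 37 \<le> k" "2 * k \<le> n"
    and f_low: "\<And>y. y \<in> {1..int n} \<Longrightarrow> real k / 10 ^ 8 \<le> real (f y)"
    and f_k: "\<And>y. y \<in> {1..int n} \<Longrightarrow> f y \<le> k"
    and f_n: "\<And>y. y \<in> {1..int n} \<Longrightarrow> 10 ^ 7 * f y \<le> n"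
    and f_exc: "real (card {y\<in>{1..int n}. 3 * real k / 10 ^ 8 < real (f y)}) \<le> real n / 10 ^ 17"
    and t: "t = k div 100"
begin

text \<open>An upper bound for \<open>4 / N\<close>, where \<open>N\<close> bounds the sizes of the residue classes of half-edges
  from below.\<close>

abbreviation (input) "\<theta> \<equiv> 168 * 10 ^ 8 / (real k * real n)"

lemma k_pos: "0 < real k" and n_pos: "0 < real n" and k_ge: "10 ^ 37 \<le> real k" and n_ge: "2 * 10 ^ 37 \<le> real n"
proof -
  have "real (10 ^ 37) \<le> real k" using k(1) by (rule of_nat_mono)
  then show 1: "10 ^ 37 \<le> real k" by simp
  have "real (2 * k) \<le> real n" using k(2) by (rule of_nat_mono)
  then show "2 * 10 ^ 37 \<le> real n" using 1 by simp
  then show "0 < real n" by simp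
  show "0 < real k" using 1 by simp
qed

lemma t_ge: "300 \<le> t" "real k \<le> 101 * real t" "real t \<le> real k / 100"
proof -
  have "k = 100 * t + k mod 100" by (simp add: t)
  moreover have "k mod 100 < 100" by simp
  ultimately have *: "real k \<le> 100 * real t + 100" "100 * real t \<le> real k" by linarith+
  show "real t \<le> real k / 100" using * by simp
  have "real k \<ge> 10 ^ 37" by (rule k_ge)
  then have "real t \<ge> 300" using * by simp
  then show "300 \<le> t" by simp
  show "real k \<le> 101 * real t" using * \<open>real t \<ge> 300\<close> by simp
qed

lemma exists_half_edge_count:
  obtains N :: nat where "0 < N" "4 / real N \<le> \<theta>"
    "\<And>h. h \<in> half_edges n f \<Longrightarrow> N + (t + 1) \<le> card {z\<in>half_edges n f. fst z mod 20 = fst h mod 20}"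
proof
  \<comment> \<open>A residue class has at least \<open>n / 40\<close> rows with at least
    \<open>k / 10 ^ 8\<close> half-edges each. Replacing \<open>40\<close> by \<open>41\<close>
    leaves room for the \<open>t + 1\<close> pairs of an event, and \<open>42\<close> absorbs the
    rounding; hence \<open>168 = 4 * 42\<close> in \<open>\<theta>\<close>.\<close>
  define N where "N = nat \<lfloor>real k * real n / (41 * 10 ^ 8)\<rfloor>"
  have kn: "10 ^ 37 * (2 * 10 ^ 37) \<le> real k * real n"
    by (rule mult_mono[OF k_ge n_ge]) auto
  have N1: "real N \<le> real k * real n / (41 * 10 ^ 8)" unfolding N_def by (rule of_nat_floor) simp
  have N2: "real k * real n / (41 * 10 ^ 8) - 1 \<le> real N"
    unfolding N_def by linarith
  have N3: "real k * real n / (42 * 10 ^ 8) \<le> real N" using N2 kn by simp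
  have N4: "0 < real N" using N3 kn by (simp add: field_simps)
  show "0 < N" using N4 by simp
  have "4 / real N \<le> 4 / (real k * real n / (42 * 10 ^ 8))"
    using N3 N4 k_pos n_pos by (intro divide_left_mono) auto
  then show "4 / real N \<le> \<theta>" by simp
  fix h assume "h \<in> half_edges n f"
  define Y where "Y = {z\<in>{1..int n}. z mod 20 = fst h mod 20}"
  have "real n / 40 \<le> real (card Y)"
    using card_residue_class[of n "fst h"] n_ge unfolding Y_def by simp
  then have "real k / 10 ^ 8 * (real n / 40) \<le> real k / 10 ^ 8 * real (card Y)"
    by (intro mult_left_mono) auto
  also have "\<dots> = (\<Sum>y\<in>Y. real k / 10 ^ 8)" by simp
  also have "\<dots> \<le> (\<Sum>y\<in>Y. real (f y))"
    by (rule sum_mono) (use f_low in \<open>auto simp: Y_def\<close>)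
  also have "\<dots> = real (card {z\<in>half_edges n f. fst z \<in> Y})"
    by (subst card_half_edges_over) (auto simp: Y_def)
  also have "{z\<in>half_edges n f. fst z \<in> Y} = {z\<in>half_edges n f. fst z mod 20 = fst h mod 20}"
    by (auto simp: Y_def half_edges_def)
  finally have A: "real k * real n / (40 * 10 ^ 8) \<le> real (card {z\<in>half_edges n f. fst z mod 20 = fst h mod 20})"
    by simp
  have "real k * (2 * 10 ^ 37) \<le> real k * real n" using n_ge by (intro mult_left_mono) auto
  then have "real k \<le> real k * real n / (40 * 10 ^ 8) - real k * real n / (41 * 10 ^ 8)" by simp
  moreover have "real (N + (t + 1)) \<le> real N + real k" using t_ge(3) k_ge by simp
  ultimately have "real (N + (t + 1)) \<le> real k * real n / (40 * 10 ^ 8)" using N1 by linarith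
  then show "N + (t + 1) \<le> card {z\<in>half_edges n f. fst z mod 20 = fst h mod 20}"
    using A by linarith
qed

text \<open>The first bound weighs every cell by \<open>k ^ 2\<close>; it decays with the direction
  and makes the sum over directions converge. The second uses that typical deficits are at most
  \<open>3 k / 10 ^ 8\<close> and is small even for short directions:
  \<open>2 * 9 / 10 ^ 16 + 2 / 10 ^ 17 = 182 / 10 ^ 17\<close>.\<close>

lemma line_pairs_le:
  assumes d: "(a, b) \<in> dirs n"
  shows "real (card {p\<in>half_edges n f \<times> half_edges n f. cell p \<in> lat_line a b c})
    \<le> (real k)\<^sup>2 * real n * min (2 / real (len (a, b))) (2 / 10 ^ 15)"
proof -
  let ?L = "square n \<inter> lat_line a b c"
  have ob: "oblique a b" using d by (auto simp: dirs_def)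
  have fk: "real (f y) \<le> real k" if "y \<in> {1..int n}" for y using f_k[OF that] by simp
  have "real (card {p\<in>half_edges n f \<times> half_edges n f. cell p \<in> lat_line a b c})
      \<le> real (\<Sum>q\<in>?L. f (fst q) * f (snd q))"
    by (rule of_nat_mono[OF card_half_edge_pairs_le])
  also have "\<dots> = (\<Sum>q\<in>?L. real (f (fst q) * f (snd q)))" by (rule of_nat_sum)
  finally have w: "real (card {p\<in>half_edges n f \<times> half_edges n f. cell p \<in> lat_line a b c})
      \<le> (\<Sum>q\<in>?L. real (f (fst q) * f (snd q)))" .
  have L: "real (card ?L) \<le> 2 * real n / real (len (a, b))" by (rule card_line_real_le[OF d])
  have E: "{y\<in>{1..int n}. real k < real (f y)} = {}" using fk by force
  have "(\<Sum>q\<in>?L. real (f (fst q) * f (snd q))) \<le> (real k)\<^sup>2 * real (card ?L)"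
    using line_weight_le[where \<beta> = "real k" and \<kappa> = "real k" and f = f and n = n and c = c, OF ob fk]
    unfolding E by simp
  also have "\<dots> \<le> (real k)\<^sup>2 * (2 * real n / real (len (a, b)))"
    by (rule mult_left_mono[OF L]) simp
  finally have 1: "(\<Sum>q\<in>?L. real (f (fst q) * f (snd q))) \<le> (real k)\<^sup>2 * real n * (2 / real (len (a, b)))"
    by (simp add: mult_ac)
  have "2 * real n / real (len (a, b)) \<le> 2 * real n / 1"
    using len_pos[OF d] by (intro divide_left_mono) auto
  then have L2: "real (card ?L) \<le> 2 * real n" using L by simp
  have "(\<Sum>q\<in>?L. real (f (fst q) * f (snd q))) \<le> (3 * real k / 10 ^ 8)\<^sup>2 * real (card ?L)
      + 2 * (real k)\<^sup>2 * real (card {y\<in>{1..int n}. 3 * real k / 10 ^ 8 < real (f y)})"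
    by (rule line_weight_le[OF ob fk]) auto
  also have "\<dots> \<le> (3 * real k / 10 ^ 8)\<^sup>2 * (2 * real n) + 2 * (real k)\<^sup>2 * (real n / 10 ^ 17)"
    by (intro add_mono mult_left_mono L2 f_exc) auto
  also have "\<dots> = (real k)\<^sup>2 * real n * (182 / 10 ^ 17)"
    by (simp add: power2_eq_square field_simps)
  also have "\<dots> \<le> (real k)\<^sup>2 * real n * (2 / 10 ^ 15)"
    by (rule mult_left_mono) auto
  finally have 2: "(\<Sum>q\<in>?L. real (f (fst q) * f (snd q))) \<le> (real k)\<^sup>2 * real n * (2 / 10 ^ 15)" .
  show ?thesis using w 1 2 by (auto simp: min_def)
qed

text \<open>The bracket is at most \<open>6 * 10 ^ 12\<close> times the minimum. Four of the
  \<open>t\<close> factors use the decay \<open>2 / len d\<close> and give a bounded sum, the others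
  are at most \<open>1 / 2\<close>; since \<open>t \<ge> 300\<close>, at least 296 halvings remain
  and outweigh all constants.\<close>

lemma sum_dirs_pow_le:
  "\<theta> * (real k * real n) * (\<Sum>d\<in>dirs n. (3 * \<theta> * ((real k)\<^sup>2 * real n * min (2 / real (len d)) (2 / 10 ^ 15)) / real t) ^ t) \<le> 1 / 8"
proof -
  let ?r = "\<lambda>d. 3 * \<theta> * ((real k)\<^sup>2 * real n * min (2 / real (len d)) (2 / 10 ^ 15)) / real t"
  have tp: "0 < real t" using t_ge by simp
  have r: "?r d \<le> 6 * 10 ^ 12 * min (2 / real (len d)) (2 / 10 ^ 15)" for d
  proof -
    let ?m = "min (2 / real (len d)) (2 / 10 ^ 15)"
    have "?r d = 504 * 10 ^ 8 * (real k / real t) * ?m"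
      using k_pos n_pos tp by (simp add: power2_eq_square field_simps)
    also have "\<dots> \<le> 504 * 10 ^ 8 * 101 * ?m"
      using t_ge(2) tp by (intro mult_right_mono mult_left_mono) (auto simp: field_simps)
    also have "\<dots> \<le> 6 * 10 ^ 12 * ?m" by (intro mult_right_mono) auto
    finally show ?thesis .
  qed
  have r0: "0 \<le> ?r d" for d by simp
  have rt: "?r d ^ t \<le> (1 / 2) ^ (t - 4) * (2 * 10 ^ 13) ^ 4 * (1 / real (len d) ^ 4)" for d
  proof -
    have "6 * 10 ^ 12 * min (2 / real (len d)) (2 / 10 ^ 15) \<le> 6 * 10 ^ 12 * (2 / 10 ^ 15)"
      by (intro mult_left_mono) auto
    then have r1: "?r d \<le> 1 / 2" using r[of d] by simp
    have "6 * 10 ^ 12 * min (2 / real (len d)) (2 / 10 ^ 15) \<le> 6 * 10 ^ 12 * (2 / real (len d))"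
      by (intro mult_left_mono) auto
    also have "\<dots> \<le> 2 * 10 ^ 13 / real (len d)" by (simp add: divide_right_mono)
    finally have r2: "?r d \<le> 2 * 10 ^ 13 / real (len d)" using r[of d] by linarith
    have "?r d ^ t = ?r d ^ (t - 4) * ?r d ^ 4" using t_ge(1) by (simp flip: power_add)
    also have "\<dots> \<le> (1 / 2) ^ (t - 4) * (2 * 10 ^ 13 / real (len d)) ^ 4"
      by (intro mult_mono power_mono r1 r2 r0) (use r0 in auto)
    finally show ?thesis by (simp add: power_divide)
  qed
  have "(\<Sum>d\<in>dirs n. ?r d ^ t) \<le> (\<Sum>d\<in>dirs n. (1 / 2) ^ (t - 4) * (2 * 10 ^ 13) ^ 4 * (1 / real (len d) ^ 4))"
    by (rule sum_mono[OF rt])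
  also have "\<dots> = (1 / 2) ^ (t - 4) * (2 * 10 ^ 13) ^ 4 * (\<Sum>d\<in>dirs n. 1 / real (len d) ^ 4)"
    by (rule sum_distrib_left[symmetric])
  also have "\<dots> \<le> (1 / 2) ^ 296 * (2 * 10 ^ 13) ^ 4 * 16"
    by (intro mult_mono mult_right_mono sum_len_inverse_pow4_le power_decreasing)
      (use t_ge in \<open>auto intro: sum_nonneg\<close>)
  finally have "168 * 10 ^ 8 * (\<Sum>d\<in>dirs n. ?r d ^ t) \<le> 168 * 10 ^ 8 * ((1 / 2) ^ 296 * (2 * 10 ^ 13) ^ 4 * 16)"
    by (intro mult_left_mono) auto
  also have "\<dots> \<le> 1 / 8" by (simp add: power_divide)
  finally show ?thesis using k_pos n_pos by simp
qed

lemma sum_squares_le: "(\<Sum>y\<in>{1..int n}. (real (f y))\<^sup>2) \<le> (real k)\<^sup>2 * real n * (91 / 10 ^ 17)"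
proof -
  let ?E = "{y\<in>{1..int n}. 3 * real k / 10 ^ 8 < real (f y)}"
  have "(\<Sum>y\<in>{1..int n}. (real (f y))\<^sup>2) \<le> (\<Sum>y\<in>{1..int n}. (3 * real k / 10 ^ 8)\<^sup>2 + (real k)\<^sup>2 * of_bool (y \<in> ?E))"
  proof (rule sum_mono)
    fix y assume y: "y \<in> {1..int n}"
    show "(real (f y))\<^sup>2 \<le> (3 * real k / 10 ^ 8)\<^sup>2 + (real k)\<^sup>2 * of_bool (y \<in> ?E)"
    proof (cases "y \<in> ?E")
      case True
      have "(real (f y))\<^sup>2 \<le> (real k)\<^sup>2" using f_k[OF y] by (intro power_mono) auto
      then show ?thesis using True by (simp add: add_increasing)
    next
      case False
      then have "(real (f y))\<^sup>2 \<le> (3 * real k / 10 ^ 8)\<^sup>2" using y by (intro power_mono) auto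
      then show ?thesis by (simp add: add_increasing2)
    qed
  qed
  also have "\<dots> = real n * (3 * real k / 10 ^ 8)\<^sup>2 + (real k)\<^sup>2 * (\<Sum>y\<in>{1..int n}. of_bool (y \<in> ?E))"
    by (simp only: sum.distrib sum_distrib_left[symmetric]) simp
  also have "(\<Sum>y\<in>{1..int n}. of_bool (y \<in> ?E)) = real (card ?E)"
    by (simp add: sum.If_cases of_bool_def Int_def)
  also have "real n * (3 * real k / 10 ^ 8)\<^sup>2 + (real k)\<^sup>2 * real (card ?E)
      \<le> real n * (3 * real k / 10 ^ 8)\<^sup>2 + (real k)\<^sup>2 * (real n / 10 ^ 17)"
    by (intro add_left_mono mult_left_mono f_exc) auto
  also have "\<dots> = (real k)\<^sup>2 * real n * (91 / 10 ^ 17)" by (simp add: power2_eq_square field_simps)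
  finally show ?thesis .
qed

text \<open>A row with more half-edges than admissible cells would force repeated cells, so the
  deficit of the single row \<open>fst h\<close> must be small against \<open>n\<close>; this is the
  purpose of \<open>f_n\<close>. The sum over the other end is an average and only needs the second
  moment of \<open>f\<close>.\<close>

lemma sum_double_le:
  assumes h: "h \<in> half_edges n f"
  shows "(\<Sum>h'\<in>half_edges n f. \<theta>\<^sup>2 * real (f (fst h) * f (fst h'))) \<le> 1 / 8"
proof -
  have "fst h \<in> {1..int n}" using h by (auto simp: half_edges_def)
  from of_nat_mono[OF f_n[OF this], where 'a = real] have fh: "real (f (fst h)) \<le> real n / 10 ^ 7" by simp
  have "(\<Sum>h'\<in>half_edges n f. \<theta>\<^sup>2 * real (f (fst h) * f (fst h')))
      = \<theta>\<^sup>2 * real (f (fst h)) * (\<Sum>h'\<in>half_edges n f. real (f (fst h')))"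
    by (simp add: sum_distrib_left mult.assoc)
  also have "(\<Sum>h'\<in>half_edges n f. real (f (fst h'))) = (\<Sum>y\<in>{1..int n}. (real (f y))\<^sup>2)"
    by (subst sum_half_edges) (simp add: power2_eq_square)
  also have "\<theta>\<^sup>2 * real (f (fst h)) * (\<Sum>y\<in>{1..int n}. (real (f y))\<^sup>2)
      \<le> \<theta>\<^sup>2 * (real n / 10 ^ 7) * ((real k)\<^sup>2 * real n * (91 / 10 ^ 17))"
    by (intro mult_mono mult_left_mono fh sum_squares_le) (auto intro: sum_nonneg)
  also have "\<dots> = (168 * 10 ^ 8)\<^sup>2 * 91 / 10 ^ 24"
    using k_pos n_pos by (simp add: power2_eq_square field_simps)
  also have "\<dots> \<le> 1 / 8" by simp
  finally show ?thesis .
qed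

text \<open>The budget \<open>1 / 4\<close> of the local lemma at each half-edge is shared equally:
  \<open>1 / 8\<close> for repeated cells and \<open>1 / 8\<close> for collinear events of
  \<open>t + 1\<close> pairs.\<close>

lemma exists_completion:
  "\<exists>R \<subseteq> square n. (\<forall>p\<in>R. fst p mod 20 = snd p mod 20) \<and>
    (\<forall>x\<in>{1..int n}. card {p\<in>R. fst p = x} = f x) \<and>
    (\<forall>y\<in>{1..int n}. card {p\<in>R. snd p = y} = f y) \<and>
    (\<forall>a b c. oblique a b \<longrightarrow> card (R \<inter> lat_line a b c) \<le> t)"
proof -
  let ?H = "half_edges n f"
  let ?C = "collinear_matchings n (Suc t) ?H" and ?D = "double_matchings ?H"
  let ?I = "?C \<union> ?D"
  obtain N where N: "0 < N" "4 / real N \<le> \<theta>"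
    "\<And>h. h \<in> ?H \<Longrightarrow> N + (t + 1) \<le> card {z\<in>?H. fst z mod 20 = fst h mod 20}"
    by (rule exists_half_edge_count[OF that])
  have Dprop: "M \<subseteq> ?H \<times> ?H" "inj_on fst M" "inj_on snd M" "card M = 2"
      "\<forall>p\<in>M. fst (fst p) mod 20 = fst (snd p) mod 20" if M: "M \<in> ?D" for M
  proof -
    obtain h h' u u' where *: "M = {(h, h'), (u, u')}" "h \<in> ?H" "h' \<in> ?H" "u \<in> ?H" "u' \<in> ?H"
      "h \<noteq> u" "h' \<noteq> u'" "fst h = fst u" "fst h' = fst u'" "fst h mod 20 = fst h' mod 20"
      using M unfolding double_matchings_def by blast
    show "M \<subseteq> ?H \<times> ?H" "inj_on fst M" "inj_on snd M" "card M = 2"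
      "\<forall>p\<in>M. fst (fst p) mod 20 = fst (snd p) mod 20"
      using * by auto
  qed
  have finD: "finite ?D"
    by (rule finite_subset[of _ "Pow (?H \<times> ?H)"]) (use Dprop(1) in auto)
  have finC: "finite ?C"
    by (rule finite_subset[of _ "Pow (?H \<times> ?H)"]) (auto simp: collinear_matchings_def)
  have pair: "(\<Sum>M | M \<in> ?I \<and> (h, h') \<in> M. (4 / real N) ^ card M)
      \<le> \<theta>\<^sup>2 * real (f (fst h) * f (fst h'))
        + \<theta> * (\<Sum>d\<in>dirs n. (3 * \<theta> * ((real k)\<^sup>2 * real n * min (2 / real (len d)) (2 / 10 ^ 15)) / real t) ^ t)"
    if hh: "h \<in> ?H" "h' \<in> ?H" for h h'
  proof -
    let ?CC = "{M\<in>?C. (h, h') \<in> M}" and ?DD = "{M\<in>?D. (h, h') \<in> M}"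
    let ?S = "\<Sum>d\<in>dirs n. (3 * ((real k)\<^sup>2 * real n * min (2 / real (len d)) (2 / 10 ^ 15)) / real t) ^ t"
    have "{M. M \<in> ?I \<and> (h, h') \<in> M} = ?DD \<union> ?CC" by auto
    then have "(\<Sum>M | M \<in> ?I \<and> (h, h') \<in> M. (4 / real N) ^ card M)
        = sum (\<lambda>M. (4 / real N) ^ card M) (?DD \<union> ?CC)" by simp
    also have "\<dots> \<le> (\<Sum>M\<in>?DD. (4 / real N) ^ card M) + (\<Sum>M\<in>?CC. (4 / real N) ^ card M)"
      by (subst sum_Un) (use finC finD in \<open>auto intro!: sum_nonneg\<close>)
    also have "\<dots> \<le> (\<Sum>M\<in>?DD. \<theta> ^ card M) + (\<Sum>M\<in>?CC. \<theta> ^ card M)"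
      by (intro add_mono sum_mono power_mono N) auto
    also have "(\<Sum>M\<in>?DD. \<theta> ^ card M) = (\<Sum>M\<in>?DD. \<theta>\<^sup>2)"
      by (rule sum.cong) (use Dprop(4) in auto)
    also have "(\<Sum>M\<in>?CC. \<theta> ^ card M) = (\<Sum>M\<in>?CC. \<theta> ^ Suc t)"
      by (rule sum.cong) (auto simp: collinear_matchings_def)
    also have "(\<Sum>M\<in>?DD. \<theta>\<^sup>2) + (\<Sum>M\<in>?CC. \<theta> ^ Suc t) = \<theta>\<^sup>2 * real (card ?DD) + \<theta> ^ Suc t * real (card ?CC)"
      by (simp only: sum_constant mult.commute)
    also have "\<dots> \<le> \<theta>\<^sup>2 * real (f (fst h) * f (fst h')) + \<theta> ^ Suc t * ?S"
    proof (intro add_mono mult_left_mono)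
      show "real (card ?DD) \<le> real (f (fst h) * f (fst h'))"
        by (rule of_nat_mono[OF card_double_matchings_le[OF hh]])
      show "real (card ?CC) \<le> ?S"
        by (rule card_collinear_matchings_le) (use line_pairs_le t_ge in auto)
    qed auto
    also have "\<theta> ^ Suc t * ?S = \<theta> * (\<Sum>d\<in>dirs n. (3 * \<theta> * ((real k)\<^sup>2 * real n * min (2 / real (len d)) (2 / 10 ^ 15)) / real t) ^ t)"
      by (rule scale_sum_pow)
    finally show ?thesis .
  qed
  let ?S = "\<Sum>d\<in>dirs n. (3 * \<theta> * ((real k)\<^sup>2 * real n * min (2 / real (len d)) (2 / 10 ^ 15)) / real t) ^ t"
  have S0: "0 \<le> ?S" by (intro sum_nonneg zero_le_power) auto
  have cardH: "real (card ?H) \<le> real k * real n"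
  proof -
    have "real (card ?H) = (\<Sum>y\<in>{1..int n}. real (f y) * 1)" using sum_half_edges[of "\<lambda>_. 1" n f] by simp
    also have "\<dots> \<le> (\<Sum>y\<in>{1..int n}. real k)" by (rule sum_mono) (use f_k in auto)
    finally show ?thesis by (simp add: mult.commute)
  qed
  have lines: "(\<Sum>h'\<in>?H. \<theta> * ?S) \<le> 1 / 8"
  proof -
    have "(\<Sum>h'\<in>?H. \<theta> * ?S) = real (card ?H) * (\<theta> * ?S)" by simp
    also have "\<dots> \<le> (real k * real n) * (\<theta> * ?S)"
      by (rule mult_right_mono[OF cardH]) (use S0 in \<open>auto intro!: divide_nonneg_nonneg mult_nonneg_nonneg\<close>)
    also have "\<dots> = \<theta> * (real k * real n) * ?S" by (simp only: mult_ac)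
    also have "\<dots> \<le> 1 / 8" by (rule sum_dirs_pow_le)
    finally show ?thesis .
  qed
  have "\<exists>\<pi>\<in>class_perms ?H (\<lambda>h. fst h mod 20). \<forall>M\<in>?I. \<not> extends \<pi> M"
  proof (rule exists_class_perm_avoiding[OF _ N(1), where t = "t + 1"])
    show "finite ?H" by simp
    show "\<And>h. h \<in> ?H \<Longrightarrow> N + (t + 1) \<le> card {z \<in> ?H. fst z mod 20 = fst h mod 20}" by (rule N(3))
    fix M assume "M \<in> ?I"
    then have "card M \<noteq> 0 \<and> M \<subseteq> ?H \<times> ?H \<and> inj_on fst M \<and> inj_on snd M \<and> card M \<le> t + 1
      \<and> (\<forall>p\<in>M. fst (fst p) mod 20 = fst (snd p) mod 20)"
    proof
      assume "M \<in> ?C"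
      then show ?thesis by (auto simp: collinear_matchings_def)
    next
      assume "M \<in> ?D"
      from Dprop[OF this] t_ge(1) show ?thesis by simp
    qed
    then show "M \<noteq> {}" "M \<subseteq> ?H \<times> ?H" "inj_on fst M" "inj_on snd M" "card M \<le> t + 1"
      "\<And>p. p \<in> M \<Longrightarrow> fst (fst p) mod 20 = fst (snd p) mod 20"
      by auto
  next
    fix h assume h: "h \<in> ?H"
    have "(\<Sum>h'\<in>?H. \<Sum>M | M \<in> ?I \<and> (h, h') \<in> M. (4 / real N) ^ card M)
        \<le> (\<Sum>h'\<in>?H. \<theta>\<^sup>2 * real (f (fst h) * f (fst h')) + \<theta> * ?S)"
      by (rule sum_mono, rule pair[OF h])
    also have "\<dots> \<le> 1 / 8 + 1 / 8"
      unfolding sum.distrib by (rule add_mono[OF sum_double_le[OF h] lines])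
    finally show "(\<Sum>h'\<in>?H. \<Sum>M | M \<in> ?I \<and> (h, h') \<in> M. (4 / real N) ^ card M) \<le> 1 / 4" by simp
    \<comment> \<open>Rows and columns have the same deficits and the estimate \<open>pair\<close>
      is symmetric in its two ends, so the right ends obey the same bound.\<close>
    have "(\<Sum>h'\<in>?H. \<Sum>M | M \<in> ?I \<and> (h', h) \<in> M. (4 / real N) ^ card M)
        \<le> (\<Sum>h'\<in>?H. \<theta>\<^sup>2 * real (f (fst h') * f (fst h)) + \<theta> * ?S)"
      by (rule sum_mono, rule pair[OF _ h])
    also have "\<dots> = (\<Sum>h'\<in>?H. \<theta>\<^sup>2 * real (f (fst h) * f (fst h')) + \<theta> * ?S)"
      by (simp only: mult.commute[of "f (fst h)"])
    also have "\<dots> \<le> 1 / 8 + 1 / 8"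
      unfolding sum.distrib by (rule add_mono[OF sum_double_le[OF h] lines])
    finally show "(\<Sum>h'\<in>?H. \<Sum>M | M \<in> ?I \<and> (h', h) \<in> M. (4 / real N) ^ card M) \<le> 1 / 4" by simp
  qed
  then obtain \<pi> where \<pi>: "\<pi> \<in> class_perms ?H (\<lambda>h. fst h mod 20)"
    and av: "\<And>M. M \<in> ?C \<Longrightarrow> \<not> extends \<pi> M" "\<And>M. M \<in> ?D \<Longrightarrow> \<not> extends \<pi> M" by blast
  have perm: "\<pi> permutes ?H" and cls: "\<And>h. h \<in> ?H \<Longrightarrow> fst (\<pi> h) mod 20 = fst h mod 20"
    using \<pi> by (auto simp: class_perms_def)
  have piH: "\<pi> h \<in> ?H" if "h \<in> ?H" for h using permutes_in_image[OF perm] that by simp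
  have inj_pi: "inj \<pi>" using perm by (rule permutes_inj)
  define g where "g h = cell (h, \<pi> h)" for h
  have g: "fst (g h) = fst (\<pi> h)" "snd (g h) = fst h" for h by (simp_all add: g_def cell_def)
  have inj: "inj_on g ?H"
  proof (rule inj_onI, rule ccontr)
    fix h u assume A: "h \<in> ?H" "u \<in> ?H" "g h = g u" "h \<noteq> u"
    have "\<pi> h \<noteq> \<pi> u" using A(4) inj_pi by (auto dest: injD)
    moreover have "fst (\<pi> h) = fst (\<pi> u)" "fst h = fst u" using A(3) g by metis+
    moreover note piH[OF A(1)] piH[OF A(2)] cls[OF A(1)]
    ultimately have "{(h, \<pi> h), (u, \<pi> u)} \<in> ?D"
      unfolding double_matchings_def using A by (intro CollectI exI[of _ h] exI[of _ "\<pi> h"] exI[of _ u] exI[of _ "\<pi> u"]) auto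
    from av(2)[OF this] show False by (simp add: extends_def)
  qed
  show ?thesis
  proof (intro exI[of _ "g ` ?H"] conjI ballI allI impI)
    have H: "fst h \<in> {1..int n}" if "h \<in> ?H" for h using that by (auto simp: half_edges_def)
    show sq: "g ` ?H \<subseteq> square n"
    proof (rule image_subsetI)
      fix h assume "h \<in> ?H"
      then show "g h \<in> square n"
        using H[of h] H[of "\<pi> h"] piH[of h] g[of h] by (simp add: square_def mem_Times_iff)
    qed
    show "fst p mod 20 = snd p mod 20" if "p \<in> g ` ?H" for p using that cls g by auto
    show "card {p\<in>g ` ?H. fst p = x} = f x" if x: "x \<in> {1..int n}" for x
    proof -
      have "{p\<in>g ` ?H. fst p = x} = g ` {h\<in>?H. fst (\<pi> h) = x}" using g by auto
      then have "card {p\<in>g ` ?H. fst p = x} = card {h\<in>?H. fst (\<pi> h) = x}"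
        using inj by (simp add: card_image inj_on_def)
      also have "\<dots> = card (\<pi> ` {h\<in>?H. fst (\<pi> h) = x})"
        by (rule card_image[symmetric]) (use inj_pi in \<open>auto simp: inj_on_def inj_def\<close>)
      also have "\<pi> ` {h\<in>?H. fst (\<pi> h) = x} = {h\<in>?H. fst h = x}"
      proof (intro equalityI subsetI)
        fix u assume u: "u \<in> {h\<in>?H. fst h = x}"
        then obtain h where "h \<in> ?H" "u = \<pi> h" using permutes_image[OF perm] by blast
        then show "u \<in> \<pi> ` {h\<in>?H. fst (\<pi> h) = x}" using u by blast
      qed (use piH in auto)
      also have "card \<dots> = f x" by (rule card_half_edges_row[OF x])
      finally show ?thesis .
    qed
    show "card {p\<in>g ` ?H. snd p = y} = f y" if y: "y \<in> {1..int n}" for y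
    proof -
      have "{p\<in>g ` ?H. snd p = y} = g ` {h\<in>?H. fst h = y}" using g by auto
      then have "card {p\<in>g ` ?H. snd p = y} = card {h\<in>?H. fst h = y}"
        using inj by (simp add: card_image inj_on_def)
      also have "\<dots> = f y" by (rule card_half_edges_row[OF y])
      finally show ?thesis .
    qed
    fix a b c assume ob: "oblique a b"
    show "card (g ` ?H \<inter> lat_line a b c) \<le> t"
    proof (rule ccontr)
      let ?A = "{h\<in>?H. g h \<in> lat_line a b c}"
      assume "\<not> card (g ` ?H \<inter> lat_line a b c) \<le> t"
      moreover have "g ` ?H \<inter> lat_line a b c = g ` ?A" by auto
      moreover have "card (g ` ?A) = card ?A" using inj by (simp add: card_image inj_on_def)
      ultimately have "Suc t \<le> card ?A" by simp
      then obtain B where B: "B \<subseteq> ?A" "card B = Suc t" "finite B"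
        by (rule obtain_subset_with_card_n)
      \<comment> \<open>\<open>collinear_matchings\<close> only ranges over \<open>dirs n\<close>;
        two distinct cells on the line place its direction there.\<close>
      have dir: "(a, b) \<in> dirs n"
      proof -
        have "\<not> card B \<le> Suc 0" using B t_ge(1) by simp
        then obtain h u where hu: "h \<in> B" "u \<in> B" "h \<noteq> u" using card_le_Suc0_iff_eq[OF B(3)] by auto
        then have "g h \<noteq> g u" using inj B by (auto simp: inj_on_def)
        then show ?thesis using dirs_if_two_points[OF ob, of "g h" n c "g u"] hu B sq by blast
      qed
      have "(\<lambda>h. (h, \<pi> h)) ` B \<in> ?C"
        unfolding collinear_matchings_def
      proof (intro CollectI conjI bexI[OF _ dir] ballI)
        show "(\<lambda>h. (h, \<pi> h)) ` B \<subseteq> ?H \<times> ?H" using B piH by auto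
        show "inj_on fst ((\<lambda>h. (h, \<pi> h)) ` B)" "inj_on snd ((\<lambda>h. (h, \<pi> h)) ` B)"
          using inj_pi by (auto simp: inj_on_def inj_def)
        show "card ((\<lambda>h. (h, \<pi> h)) ` B) = Suc t" using B by (simp add: card_image inj_on_def)
        show "fst (fst p) mod 20 = fst (snd p) mod 20" if "p \<in> (\<lambda>h. (h, \<pi> h)) ` B" for p
          using that B cls by auto
        show "case (a, b) of (a, b) \<Rightarrow> \<exists>c. cell ` (\<lambda>h. (h, \<pi> h)) ` B \<subseteq> lat_line a b c"
          using B by (auto simp: g_def)
      qed
      from av(1)[OF this] show False by (simp add: extends_def)
    qed
  qed
qed

end

section \<open>Random symmetric sets\<close>

definition bweight :: "('a \<Rightarrow> real) \<Rightarrow> 'a set \<Rightarrow> 'a set \<Rightarrow> real" where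
  "bweight p V A = (\<Prod>v\<in>A. p v) * (\<Prod>v\<in>V - A. 1 - p v)"

lemma bweight_nonneg:
  assumes "\<And>v. v \<in> V \<Longrightarrow> 0 \<le> p v \<and> p v \<le> 1" "A \<subseteq> V"
  shows "0 \<le> bweight p V A"
  unfolding bweight_def by (intro mult_nonneg_nonneg prod_nonneg) (use assms in auto)

text \<open>\<open>bweight p V\<close> is the law of a random subset containing each
  \<open>v\<close> independently with probability \<open>p v\<close>, and the expectation of a
  product factorises. Letting \<open>b\<close> vanish at one element encodes that this element is
  chosen.\<close>

lemma sum_bweight_prod:
  fixes p a b :: "'a \<Rightarrow> real"
  assumes "finite V"
  shows "(\<Sum>A\<in>Pow V. bweight p V A * ((\<Prod>v\<in>A. a v) * (\<Prod>v\<in>V - A. b v)))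
    = (\<Prod>v\<in>V. p v * a v + (1 - p v) * b v)"
  unfolding bweight_def prod_add[OF assms]
  by (intro sum.cong refl) (simp add: prod.distrib mult_ac)

lemma sum_bweight: "finite V \<Longrightarrow> (\<Sum>A\<in>Pow V. bweight p V A) = 1"
  using sum_bweight_prod[of V p "\<lambda>_. 1" "\<lambda>_. 1"] by simp

text \<open>Convexity of \<open>exp\<close> on the values 0, 1, 2: for \<open>c = 1\<close> it
  amounts to \<open>(exp (s / 2) - 1)^2 \<ge> 0\<close>. The factor one half appears because a
  chosen cell and its mirror image may both lie on the same line.\<close>

lemma exp_half_le:
  fixes s :: real
  assumes "c \<le> (2::nat)"
  shows "exp (s / 2 * real c) - 1 \<le> (exp s - 1) / 2 * real c"
proof -
  consider "c = 0" | "c = 1" | "c = 2" using assms by linarith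
  then show ?thesis
  proof cases
    case 2
    have "exp s = exp (s / 2) * exp (s / 2)" by (simp flip: exp_add)
    moreover have "0 \<le> (exp (s / 2) - 1) * (exp (s / 2) - 1)" by simp
    ultimately show ?thesis using 2 by (simp add: field_simps)
  qed auto
qed

section \<open>Chernoff bounds for weights 0, 1 and 2\<close>

context
  fixes V :: "'a set" and p :: "'a \<Rightarrow> real" and c :: "'a \<Rightarrow> nat"
  assumes V: "finite V" and p: "\<And>v. v \<in> V \<Longrightarrow> 0 \<le> p v \<and> p v \<le> 1"
    and c: "\<And>v. v \<in> V \<Longrightarrow> c v \<le> 2"
begin

lemma weight_nonneg: "A \<in> Pow V \<Longrightarrow> 0 \<le> bweight p V A"
  by (rule bweight_nonneg) (use p in auto)

lemma factor_le:
  assumes "v \<in> V"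
  shows "p v * exp (s / 2 * real (c v)) + (1 - p v) * 1 \<le> exp ((exp s - 1) / 2 * (p v * real (c v)))"
proof -
  have "p v * exp (s / 2 * real (c v)) + (1 - p v) * 1 = 1 + p v * (exp (s / 2 * real (c v)) - 1)"
    by (simp add: algebra_simps)
  also have "\<dots> \<le> 1 + p v * ((exp s - 1) / 2 * real (c v))"
    by (intro add_left_mono mult_left_mono exp_half_le) (use assms p c in auto)
  also have "\<dots> \<le> exp (p v * ((exp s - 1) / 2 * real (c v)))" by (rule exp_ge_add_one_self)
  finally show ?thesis by (simp add: mult_ac)
qed

lemma factor_nonneg:
  assumes "v \<in> V"
  shows "0 \<le> p v * exp (s / 2 * real (c v)) + (1 - p v) * 1"
  using p[OF assms] by simp

lemma exp_moment_le:
  "(\<Sum>A\<in>Pow V. bweight p V A * exp (s / 2 * real (\<Sum>v\<in>A. c v)))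
    \<le> exp ((exp s - 1) / 2 * (\<Sum>v\<in>V. p v * real (c v)))"
proof -
  have "(\<Sum>A\<in>Pow V. bweight p V A * exp (s / 2 * real (\<Sum>v\<in>A. c v)))
      = (\<Sum>A\<in>Pow V. bweight p V A * ((\<Prod>v\<in>A. exp (s / 2 * real (c v))) * (\<Prod>v\<in>V - A. 1)))"
  proof (rule sum.cong[OF refl])
    fix A assume "A \<in> Pow V"
    then have "finite A" using V finite_subset by auto
    then show "bweight p V A * exp (s / 2 * real (\<Sum>v\<in>A. c v))
        = bweight p V A * ((\<Prod>v\<in>A. exp (s / 2 * real (c v))) * (\<Prod>v\<in>V - A. 1))"
      by (simp add: exp_sum sum_distrib_left)
  qed
  also have "\<dots> = (\<Prod>v\<in>V. p v * exp (s / 2 * real (c v)) + (1 - p v) * 1)"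
    by (rule sum_bweight_prod[OF V])
  also have "\<dots> \<le> (\<Prod>v\<in>V. exp ((exp s - 1) / 2 * (p v * real (c v))))"
    by (intro prod_mono conjI factor_nonneg factor_le)
  also have "\<dots> = exp ((exp s - 1) / 2 * (\<Sum>v\<in>V. p v * real (c v)))"
    using V by (simp add: exp_sum sum_distrib_left)
  finally show ?thesis .
qed

text \<open>Including the event \<open>v0 \<in> A\<close> gains the factor \<open>p v0\<close> at
  the price \<open>exp s\<close>. Thus the expected number of deleted points is measured against the
  order of \<open>k n\<close> chosen cells and not against all \<open>n ^ 2\<close> cells.\<close>

lemma exp_moment_member_le:
  assumes v0: "v0 \<in> V" and s: "0 \<le> s"
  shows "(\<Sum>A\<in>Pow V. bweight p V A * (of_bool (v0 \<in> A) * exp (s / 2 * real (\<Sum>v\<in>A. c v))))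
    \<le> p v0 * exp s * exp ((exp s - 1) / 2 * (\<Sum>v\<in>V. p v * real (c v)))"
proof -
  let ?b = "\<lambda>v. if v = v0 then 0 else 1 :: real"
  have "(\<Sum>A\<in>Pow V. bweight p V A * (of_bool (v0 \<in> A) * exp (s / 2 * real (\<Sum>v\<in>A. c v))))
      = (\<Sum>A\<in>Pow V. bweight p V A * ((\<Prod>v\<in>A. exp (s / 2 * real (c v))) * (\<Prod>v\<in>V - A. ?b v)))"
  proof (rule sum.cong[OF refl])
    fix A assume A: "A \<in> Pow V"
    then have "finite A" using V finite_subset by auto
    moreover have "(\<Prod>v\<in>V - A. ?b v) = of_bool (v0 \<in> A)"
      using V v0 A by (auto intro!: prod_zero prod.neutral)
    ultimately show "bweight p V A * (of_bool (v0 \<in> A) * exp (s / 2 * real (\<Sum>v\<in>A. c v)))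
        = bweight p V A * ((\<Prod>v\<in>A. exp (s / 2 * real (c v))) * (\<Prod>v\<in>V - A. ?b v))"
      by (simp add: exp_sum sum_distrib_left)
  qed
  also have "\<dots> = (\<Prod>v\<in>V. p v * exp (s / 2 * real (c v)) + (1 - p v) * ?b v)"
    by (rule sum_bweight_prod[OF V])
  also have "\<dots> = p v0 * exp (s / 2 * real (c v0)) * (\<Prod>v\<in>V - {v0}. p v * exp (s / 2 * real (c v)) + (1 - p v) * ?b v)"
    by (subst prod.remove[OF V v0]) simp
  also have "(\<Prod>v\<in>V - {v0}. p v * exp (s / 2 * real (c v)) + (1 - p v) * ?b v)
      = (\<Prod>v\<in>V - {v0}. p v * exp (s / 2 * real (c v)) + (1 - p v) * 1)"
    by (rule prod.cong) auto
  also have "p v0 * exp (s / 2 * real (c v0)) * \<dots>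
      \<le> p v0 * exp s * (\<Prod>v\<in>V - {v0}. exp ((exp s - 1) / 2 * (p v * real (c v))))"
  proof (intro mult_mono mult_left_mono prod_mono conjI)
    show "exp (s / 2 * real (c v0)) \<le> exp s"
    proof -
      have "s / 2 * real (c v0) \<le> s / 2 * 2" by (intro mult_left_mono) (use c[OF v0] s in auto)
      then show ?thesis by simp
    qed
  qed (use p v0 factor_nonneg factor_le in \<open>auto intro!: prod_nonneg mult_nonneg_nonneg\<close>)
  also have "(\<Prod>v\<in>V - {v0}. exp ((exp s - 1) / 2 * (p v * real (c v))))
      = exp ((exp s - 1) / 2 * (\<Sum>v\<in>V - {v0}. p v * real (c v)))"
    using V by (simp add: exp_sum sum_distrib_left)
  also have "p v0 * exp s * \<dots> \<le> p v0 * exp s * exp ((exp s - 1) / 2 * (\<Sum>v\<in>V. p v * real (c v)))"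
  proof (rule mult_left_mono)
    have "(\<Sum>v\<in>V - {v0}. p v * real (c v)) \<le> (\<Sum>v\<in>V. p v * real (c v))"
      by (rule sum_mono2) (use V p in auto)
    then show "exp ((exp s - 1) / 2 * (\<Sum>v\<in>V - {v0}. p v * real (c v)))
        \<le> exp ((exp s - 1) / 2 * (\<Sum>v\<in>V. p v * real (c v)))"
      using s by (auto intro!: mult_left_mono)
  qed (use p v0 in auto)
  finally show ?thesis .
qed

lemma upper_tail_member_le:
  assumes v0: "v0 \<in> V" and s: "0 \<le> s" and \<mu>: "(\<Sum>v\<in>V. p v * real (c v)) \<le> \<mu>"
  shows "(\<Sum>A\<in>Pow V. bweight p V A * of_bool (v0 \<in> A \<and> h \<le> real (\<Sum>v\<in>A. c v)))
    \<le> p v0 * exp (s + (exp s - 1) / 2 * \<mu> - s / 2 * h)"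
proof -
  have "(\<Sum>A\<in>Pow V. bweight p V A * of_bool (v0 \<in> A \<and> h \<le> real (\<Sum>v\<in>A. c v)))
      \<le> (\<Sum>A\<in>Pow V. bweight p V A * (of_bool (v0 \<in> A) * exp (s / 2 * real (\<Sum>v\<in>A. c v))) * exp (- (s / 2 * h)))"
  proof (rule sum_mono)
    fix A assume A: "A \<in> Pow V"
    have "of_bool (v0 \<in> A \<and> h \<le> real (\<Sum>v\<in>A. c v))
        \<le> of_bool (v0 \<in> A) * exp (s / 2 * real (\<Sum>v\<in>A. c v)) * exp (- (s / 2 * h))"
    proof (cases "v0 \<in> A \<and> h \<le> real (\<Sum>v\<in>A. c v)")
      case True
      then have "s / 2 * h \<le> s / 2 * real (\<Sum>v\<in>A. c v)" using s by (intro mult_left_mono) auto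
      then have "1 \<le> exp (s / 2 * real (\<Sum>v\<in>A. c v) - s / 2 * h)" by simp
      also have "\<dots> = exp (s / 2 * real (\<Sum>v\<in>A. c v)) * exp (- (s / 2 * h))"
        by (simp only: exp_add[symmetric] diff_conv_add_uminus)
      finally show ?thesis using True by simp
    qed auto
    from mult_left_mono[OF this weight_nonneg[OF A]]
    show "bweight p V A * of_bool (v0 \<in> A \<and> h \<le> real (\<Sum>v\<in>A. c v))
        \<le> bweight p V A * (of_bool (v0 \<in> A) * exp (s / 2 * real (\<Sum>v\<in>A. c v))) * exp (- (s / 2 * h))"
      by (simp only: mult.assoc)
  qed
  also have "\<dots> \<le> p v0 * exp s * exp ((exp s - 1) / 2 * (\<Sum>v\<in>V. p v * real (c v))) * exp (- (s / 2 * h))"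
    unfolding sum_distrib_right[symmetric]
    by (rule mult_right_mono[OF exp_moment_member_le[OF v0 s]]) simp
  also have "\<dots> \<le> p v0 * exp s * exp ((exp s - 1) / 2 * \<mu>) * exp (- (s / 2 * h))"
    using s p[OF v0] \<mu> by (intro mult_right_mono mult_left_mono) (auto intro!: mult_left_mono)
  also have "\<dots> = p v0 * exp (s + (exp s - 1) / 2 * \<mu> - s / 2 * h)"
    by (simp only: exp_add diff_conv_add_uminus mult.assoc)
  finally show ?thesis .
qed

lemma lower_tail_le:
  assumes s: "0 \<le> s" and \<mu>: "\<mu> \<le> (\<Sum>v\<in>V. p v * real (c v))"
  shows "(\<Sum>A\<in>Pow V. bweight p V A * of_bool (real (\<Sum>v\<in>A. c v) \<le> h))
    \<le> exp ((exp (- s) - 1) / 2 * \<mu> + s / 2 * h)"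
proof -
  have "(\<Sum>A\<in>Pow V. bweight p V A * of_bool (real (\<Sum>v\<in>A. c v) \<le> h))
      \<le> (\<Sum>A\<in>Pow V. bweight p V A * exp (- s / 2 * real (\<Sum>v\<in>A. c v)) * exp (s / 2 * h))"
  proof (rule sum_mono)
    fix A assume A: "A \<in> Pow V"
    have "of_bool (real (\<Sum>v\<in>A. c v) \<le> h) \<le> exp (- s / 2 * real (\<Sum>v\<in>A. c v)) * exp (s / 2 * h)"
    proof (cases "real (\<Sum>v\<in>A. c v) \<le> h")
      case True
      then have "s / 2 * real (\<Sum>v\<in>A. c v) \<le> s / 2 * h" using s by (intro mult_left_mono) auto
      then have "1 \<le> exp (- s / 2 * real (\<Sum>v\<in>A. c v) + s / 2 * h)" by simp
      then show ?thesis using True by (simp only: exp_add) simp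
    qed auto
    from mult_left_mono[OF this weight_nonneg[OF A]]
    show "bweight p V A * of_bool (real (\<Sum>v\<in>A. c v) \<le> h)
        \<le> bweight p V A * exp (- s / 2 * real (\<Sum>v\<in>A. c v)) * exp (s / 2 * h)"
      by (simp only: mult.assoc)
  qed
  also have "\<dots> \<le> exp ((exp (- s) - 1) / 2 * (\<Sum>v\<in>V. p v * real (c v))) * exp (s / 2 * h)"
    unfolding sum_distrib_right[symmetric]
    by (rule mult_right_mono[OF exp_moment_le]) simp
  also have "\<dots> \<le> exp ((exp (- s) - 1) / 2 * \<mu>) * exp (s / 2 * h)"
  proof (rule mult_right_mono)
    have "(exp (- s) - 1) / 2 * (\<Sum>v\<in>V. p v * real (c v)) \<le> (exp (- s) - 1) / 2 * \<mu>"
      by (rule mult_left_mono_neg[OF \<mu>]) (use s in simp)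
    then show "exp ((exp (- s) - 1) / 2 * (\<Sum>v\<in>V. p v * real (c v))) \<le> exp ((exp (- s) - 1) / 2 * \<mu>)" by simp
  qed simp
  also have "\<dots> = exp ((exp (- s) - 1) / 2 * \<mu> + s / 2 * h)" by (simp only: exp_add)
  finally show ?thesis .
qed

end

section \<open>The tilted density along rows and diagonals\<close>

text \<open>The density is \<open>4/5\<close> where \<open>phi x = phi y\<close> and \<open>6/5\<close> elsewhere.  Since \<open>phi\<close> is balanced, the rows
  keep mean about \<open>1\<close>.  On the main diagonals the signs always agree; a parallel at offset \<open>d\<close> has
  \<open>\<bar>d\<bar>\<close> fewer cells and at most \<open>2 * \<bar>d\<bar>\<close> disagreements, so its total density is still at most
  \<open>4/5 * n\<close>.\<close>

definition phi :: "nat \<Rightarrow> int \<Rightarrow> real" where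
  "phi n x = (if x \<le> int (n div 4) \<or> int n - int (n div 4) < x then 1 else - 1)"

definition dens :: "nat \<Rightarrow> int \<times> int \<Rightarrow> real" where
  "dens n q = 1 - phi n (fst q) * phi n (snd q) / 5"

lemma phi_cases: "phi n x = 1 \<or> phi n x = - 1"
  by (simp add: phi_def)

lemma phi_reflect: "phi n (int n + 1 - x) = phi n x"
  by (auto simp: phi_def)

lemma dens_bounds: "4 / 5 \<le> dens n q" "dens n q \<le> 6 / 5"
  using phi_cases[of n "fst q"] phi_cases[of n "snd q"] by (auto simp: dens_def)

lemma dens_swap: "dens n (prod.swap q) = dens n q"
  by (simp add: dens_def mult.commute)

text \<open>The counts over the initial segments of length \<open>q\<close>, \<open>n - q\<close>
  and \<open>n\<close> are each off by at most 1. Weighted by 2, 2 and 1, and together with the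
  rounding of \<open>n / 4\<close>, they change the sum of \<open>phi\<close> by at most 8, so the
  total error is at most \<open>1 + 8 / 5\<close>.\<close>

lemma sum_dens_row:
  "\<bar>(\<Sum>x\<in>{x\<in>{1..int n}. x mod 20 \<noteq> y mod 20}. dens n (x, y)) - 19 / 20 * real n\<bar> \<le> 3"
proof -
  define q where "q = n div 4"
  have q: "4 * q \<le> n" "n \<le> 4 * q + 3" by (auto simp: q_def)
  define C where "C v = {x\<in>{1..int v}. x mod 20 \<noteq> y mod 20}" for v
  have finC: "finite (C v)" for v by (rule finite_subset[of _ "{1..int v}"]) (auto simp: C_def)
  have C: "\<bar>real (card (C v)) - 19 / 20 * real v\<bar> \<le> 1" for v
  proof -
    let ?B = "{x\<in>{1..int v}. x mod 20 = y mod 20}"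
    have finB: "finite ?B" by (rule finite_subset[of _ "{1..int v}"]) auto
    have "C v = {1..int v} - ?B" by (auto simp: C_def)
    moreover have "card ({1..int v} - ?B) = card {1..int v} - card ?B"
      by (rule card_Diff_subset[OF finB]) auto
    moreover have "card ?B \<le> card {1..int v}" by (rule card_mono) auto
    ultimately have "real (card (C v)) = real v - real (card ?B)" by (simp add: of_nat_diff)
    then show ?thesis using card_residue_class[of v y] by linarith
  qed
  have sub: "C q \<subseteq> C n" "C (n - q) \<subseteq> C n" using q by (auto simp: C_def)
  have "(\<Sum>x\<in>C n. phi n x) = (\<Sum>x\<in>C n. 2 * of_bool (x \<in> C q) - 2 * of_bool (x \<in> C (n - q)) + 1)"
    by (rule sum.cong) (use q in \<open>auto simp: phi_def C_def q_def[symmetric] of_nat_diff\<close>)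
  also have "\<dots> = 2 * (\<Sum>x\<in>C n. of_bool (x \<in> C q)) - 2 * (\<Sum>x\<in>C n. of_bool (x \<in> C (n - q))) + real (card (C n))"
    by (simp only: sum.distrib sum_subtractf sum_distrib_left[symmetric]) simp
  also have "(\<Sum>x\<in>C n. of_bool (x \<in> C q)) = real (card (C q))"
    using sub finC by (simp add: sum.If_cases of_bool_def Int_absorb1)
  also have "(\<Sum>x\<in>C n. of_bool (x \<in> C (n - q))) = real (card (C (n - q)))"
    using sub finC by (simp add: sum.If_cases of_bool_def Int_absorb1)
  finally have S: "(\<Sum>x\<in>C n. phi n x) = 2 * real (card (C q)) - 2 * real (card (C (n - q))) + real (card (C n))" .
  have "real (n - q) = real n - real q" "4 * real q \<le> real n" "real n \<le> 4 * real q + 3"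
    using q by (auto simp: of_nat_diff)
  then have S8: "\<bar>\<Sum>x\<in>C n. phi n x\<bar> \<le> 8"
    unfolding S using C[of q] C[of "n - q"] C[of n] by (intro abs_leI; argo)
  have "(\<Sum>x\<in>C n. dens n (x, y)) = real (card (C n)) - phi n y / 5 * (\<Sum>x\<in>C n. phi n x)"
    by (simp add: dens_def sum_subtractf sum_distrib_left mult_ac)
  moreover have "\<bar>phi n y / 5 * (\<Sum>x\<in>C n. phi n x)\<bar> \<le> 8 / 5"
    using phi_cases[of n y] S8 by (auto simp: abs_mult)
  ultimately show ?thesis using C[of n] unfolding C_def by linarith
qed

text \<open>\<open>phi\<close> jumps at two places only, and a given jump lies between
  \<open>x - d\<close> and \<open>x\<close> for \<open>|d|\<close> values of
  \<open>x\<close>.\<close>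

lemma card_phi_changes_le:
  "card {x\<in>I. phi n x \<noteq> phi n (x - d)} \<le> 2 * nat \<bar>d\<bar>"
proof -
  define q where "q = int (n div 4)"
  let ?J = "\<lambda>r. if 0 \<le> d then {r + 1..r + d} else {r + d + 1..r}"
  have "{x\<in>I. phi n x \<noteq> phi n (x - d)} \<subseteq> ?J q \<union> ?J (int n - q)"
    by (auto simp: phi_def q_def[symmetric] split: if_splits)
  then have "card {x\<in>I. phi n x \<noteq> phi n (x - d)} \<le> card (?J q \<union> ?J (int n - q))"
    by (rule card_mono[rotated]) auto
  also have "\<dots> \<le> card (?J q) + card (?J (int n - q))" by (rule card_Un_le)
  also have "\<dots> = 2 * nat \<bar>d\<bar>" by auto
  finally show ?thesis .
qed

text \<open>Each of the \<open>|d|\<close> missing cells saves \<open>4 / 5\<close> and each of the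
  at most \<open>2 |d|\<close> disagreements costs \<open>2 / 5\<close>, so even in the worst case
  the two effects just balance.\<close>

lemma sum_phi_shift_le:
  fixes d :: int
  assumes I: "I = {max 1 (1 + d)..min (int n) (int n + d)}"
  shows "(\<Sum>x\<in>I. 1 - phi n x * phi n (x - d) / 5) \<le> 4 / 5 * real n"
proof (cases "\<bar>d\<bar> \<le> int n")
  case True
  have cI: "real (card I) = real n - real_of_int \<bar>d\<bar>"
    using card_overlap[of 0 d n] True unfolding I by (simp add: of_nat_diff nat_le_iff)
  have "(\<Sum>x\<in>I. 1 - phi n x * phi n (x - d) / 5) = (\<Sum>x\<in>I. 4 / 5 + 2 / 5 * of_bool (phi n x \<noteq> phi n (x - d)))"
  proof (rule sum.cong[OF refl])
    fix x
    show "1 - phi n x * phi n (x - d) / 5 = 4 / 5 + 2 / 5 * of_bool (phi n x \<noteq> phi n (x - d))"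
      using phi_cases[of n x] phi_cases[of n "x - d"] by auto
  qed
  also have "\<dots> = 4 / 5 * real (card I) + 2 / 5 * (\<Sum>x\<in>I. of_bool (phi n x \<noteq> phi n (x - d)))"
    by (simp only: sum.distrib sum_distrib_left[symmetric]) simp
  also have "(\<Sum>x\<in>I. of_bool (phi n x \<noteq> phi n (x - d))) = real (card {x\<in>I. phi n x \<noteq> phi n (x - d)})"
    by (simp add: I sum.If_cases of_bool_def Int_def)
  finally have "(\<Sum>x\<in>I. 1 - phi n x * phi n (x - d) / 5)
      = 4 / 5 * real (card I) + 2 / 5 * real (card {x\<in>I. phi n x \<noteq> phi n (x - d)})" .
  moreover have "real (card {x\<in>I. phi n x \<noteq> phi n (x - d)}) \<le> real (2 * nat \<bar>d\<bar>)"
    by (rule of_nat_mono[OF card_phi_changes_le])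
  moreover have "real (2 * nat \<bar>d\<bar>) = 2 * real_of_int \<bar>d\<bar>" by simp
  moreover have "S \<le> 4 / 5 * N" if "S = 4 / 5 * (N - D) + 2 / 5 * c" "c \<le> e" "e = 2 * D" for S N D c e :: real
    using that by argo
  ultimately show ?thesis unfolding cI by blast
next
  case False
  then have "I = {}" unfolding I by auto
  then show ?thesis by simp
qed

text \<open>\<open>phi\<close> is symmetric about the middle, so reflecting the second coordinate
  turns slope -1 into slope 1.\<close>

lemma sum_dens_diagonal_le:
  assumes ob: "oblique a b" and len: "len (a, b) = 1"
  shows "(\<Sum>q\<in>square n \<inter> lat_line a b c. dens n q) \<le> 4 / 5 * real n"
proof -
  have ab: "\<bar>a\<bar> = 1" "\<bar>b\<bar> = 1" using ob len by (auto simp: len_def oblique_def)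
  show ?thesis
  proof (cases "a = b")
    case True
    define d where "d = b * c"
    let ?I = "{max 1 (1 + d)..min (int n) (int n + d)}"
    have "square n \<inter> lat_line a b c = (\<lambda>x. (x, x - d)) ` ?I"
      using ab True by (auto simp: lat_line_def abs_if d_def square_def image_iff split: if_splits)
    then have "(\<Sum>q\<in>square n \<inter> lat_line a b c. dens n q) = (\<Sum>x\<in>?I. 1 - phi n x * phi n (x - d) / 5)"
      by (simp add: sum.reindex inj_on_def dens_def)
    then show ?thesis using sum_phi_shift_le[OF refl, of n d] by simp
  next
    case False
    define d where "d = b * c - int n - 1"
    let ?I = "{max 1 (1 + d)..min (int n) (int n + d)}"
    have "square n \<inter> lat_line a b c = (\<lambda>x. (x, int n + 1 - (x - d))) ` ?I"
      using ab False by (auto simp: lat_line_def abs_if d_def square_def image_iff split: if_splits)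
    then have "(\<Sum>q\<in>square n \<inter> lat_line a b c. dens n q)
        = (\<Sum>x\<in>?I. 1 - phi n x * phi n (int n + 1 - (x - d)) / 5)"
      by (simp only: sum.reindex inj_on_def dens_def) (simp add: sum.reindex inj_on_def dens_def)
    then show ?thesis using sum_phi_shift_le[OF refl, of n d] by (simp only: phi_reflect)
  qed
qed

lemma sum_dens_line_le:
  "(\<Sum>q\<in>square n \<inter> L. dens n q) \<le> 6 / 5 * real (card (square n \<inter> L))"
  using sum_bounded_above[of "square n \<inter> L" "dens n" "6 / 5"] dens_bounds by (simp add: mult.commute)

lemma exists_le_weighted_mean:
  fixes w Z :: "'a \<Rightarrow> real"
  assumes "finite S" "sum w S = 1" "\<And>a. a \<in> S \<Longrightarrow> 0 \<le> w a" "(\<Sum>a\<in>S. w a * Z a) \<le> B"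
  shows "\<exists>a\<in>S. Z a \<le> B"
proof (rule ccontr)
  assume "\<not> ?thesis"
  then have gt: "B < Z a" if "a \<in> S" for a using that by auto
  have "\<exists>a\<in>S. 0 < w a"
  proof (rule ccontr)
    assume "\<not> (\<exists>a\<in>S. 0 < w a)"
    then have "sum w S \<le> 0" by (intro sum_nonpos) (auto simp: not_less)
    then show False using assms(2) by simp
  qed
  then obtain a where a: "a \<in> S" "0 < w a" by blast
  have "(\<Sum>a\<in>S. w a * B) < (\<Sum>a\<in>S. w a * Z a)"
  proof (rule sum_strict_mono_ex1[OF assms(1)])
    show "\<forall>x\<in>S. w x * B \<le> w x * Z x"
      using gt assms(3) by (auto intro!: mult_left_mono simp: less_imp_le)
    show "\<exists>x\<in>S. w x * B < w x * Z x"
      using a gt by (intro bexI[of _ a] mult_strict_left_mono)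
  qed
  then show False using assms(2,4) by (simp flip: sum_distrib_right)
qed

section \<open>Symmetrisation of sets of cells above the diagonal\<close>

definition sym_closure :: "(int \<times> int) set \<Rightarrow> (int \<times> int) set" where
  "sym_closure A = A \<union> prod.swap ` A"

text \<open>The number of points that \<open>v\<close> and its mirror image put on \<open>L\<close>.
  Choosing only cells above the diagonal keeps the choices independent although the resulting set is
  symmetric.\<close>

definition hits :: "(int \<times> int) set \<Rightarrow> int \<times> int \<Rightarrow> nat" where
  "hits L v = of_bool (v \<in> L) + of_bool (prod.swap v \<in> L)"

definition upper_cells :: "nat \<Rightarrow> (int \<times> int) set" where
  "upper_cells n = {q\<in>square n. fst q < snd q \<and> fst q mod 20 \<noteq> snd q mod 20}"

lemma finite_upper_cells [simp]: "finite (upper_cells n)"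
  by (simp add: upper_cells_def)

lemma sym_closure_subset:
  assumes "A \<subseteq> upper_cells n"
  shows "sym_closure A \<subseteq> {q\<in>square n. fst q mod 20 \<noteq> snd q mod 20}"
  using assms by (auto simp: sym_closure_def upper_cells_def square_def)

lemma sym_closure_upper_cells: "sym_closure (upper_cells n) = {q\<in>square n. fst q mod 20 \<noteq> snd q mod 20}"
proof (intro equalityI subsetI)
  fix q assume q: "q \<in> {q\<in>square n. fst q mod 20 \<noteq> snd q mod 20}"
  then have "fst q < snd q \<or> snd q < fst q" by (metis (mono_tags, lifting) linorder_neqE mem_Collect_eq)
  then show "q \<in> sym_closure (upper_cells n)"
  proof
    assume "snd q < fst q"
    then have "prod.swap q \<in> upper_cells n" using q by (auto simp: upper_cells_def square_def)
    then show ?thesis unfolding sym_closure_def by (metis UnI2 image_eqI swap_swap)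
  qed (use q in \<open>auto simp: sym_closure_def upper_cells_def\<close>)
qed (use sym_closure_subset[of "upper_cells n" n] in auto)

lemma sum_sym_closure:
  fixes g :: "int \<times> int \<Rightarrow> 'b::comm_semiring_1"
  assumes A: "A \<subseteq> upper_cells n" and g: "\<And>q. g (prod.swap q) = g q"
  shows "(\<Sum>q\<in>sym_closure A \<inter> L. g q) = (\<Sum>v\<in>A. g v * of_nat (hits L v))"
proof -
  have fin: "finite A" by (rule finite_subset[OF A finite_upper_cells])
  have lt: "fst q < snd q" if "q \<in> A" for q using A that by (auto simp: upper_cells_def)
  have disj: "A \<inter> prod.swap ` A = {}"
  proof (rule equals0I)
    fix q assume "q \<in> A \<inter> prod.swap ` A"
    then obtain v where "q \<in> A" "v \<in> A" "q = prod.swap v" by blast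
    then show False using lt[of q] lt[of v] by simp
  qed
  have "(\<Sum>q\<in>sym_closure A \<inter> L. g q) = (\<Sum>q\<in>sym_closure A. g q * of_bool (q \<in> L))"
    by (simp add: sym_closure_def fin sum.inter_restrict of_bool_def if_distrib cong: if_cong)
  also have "\<dots> = (\<Sum>q\<in>A. g q * of_bool (q \<in> L)) + (\<Sum>q\<in>prod.swap ` A. g q * of_bool (q \<in> L))"
    unfolding sym_closure_def by (rule sum.union_disjoint) (use fin disj in auto)
  also have "(\<Sum>q\<in>prod.swap ` A. g q * of_bool (q \<in> L)) = (\<Sum>q\<in>A. g q * of_bool (prod.swap q \<in> L))"
    by (subst sum.reindex) (auto simp: g)
  finally show ?thesis by (simp add: hits_def sum.distrib[symmetric] distrib_left)
qed

lemma card_sym_closure: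
  assumes "A \<subseteq> upper_cells n"
  shows "card (sym_closure A \<inter> L) = (\<Sum>v\<in>A. hits L v)"
  using sum_sym_closure[OF assms, of "\<lambda>_. 1 :: nat" L] by simp

lemma hits_le: "hits L v \<le> 2"
  by (simp add: hits_def)

lemma swap_lat_line: "prod.swap ` lat_line a b c = lat_line b a (- c)"
proof (intro equalityI subsetI)
  fix q assume "q \<in> lat_line b a (- c)"
  then have "prod.swap q \<in> lat_line a b c" by (auto simp: lat_line_def)
  then show "q \<in> prod.swap ` lat_line a b c" by (metis image_eqI swap_swap)
qed (auto simp: lat_line_def)

lemma swap_sym_closure: "prod.swap ` sym_closure A = sym_closure A"
  by (auto simp: sym_closure_def image_Un image_image)

text \<open>A line through a mirror image is the mirror image of a line through the cell itself, so
  it suffices to test the lines through cells above the diagonal.\<close>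

lemma card_sym_closure_swap:
  "card (sym_closure A \<inter> lat_line b a (- c)) = card (sym_closure A \<inter> lat_line a b c)"
proof -
  have "sym_closure A \<inter> lat_line b a (- c) = prod.swap ` (sym_closure A \<inter> lat_line a b c)"
    by (simp add: image_Int swap_lat_line swap_sym_closure)
  then show ?thesis by (simp add: card_image)
qed

section \<open>The random set: means and tails\<close>

context
  fixes n k t :: nat
  assumes k: "10 ^ 37 \<le> k" "2 * k \<le> n" and t: "t = k div 100"
begin

text \<open>A row has about \<open>19 n / 20\<close> admissible cells of average density 1, so its
  sum has mean about \<open>k - 2 k / 10 ^ 8\<close>, the centre of the window from
  \<open>k - 3 k / 10 ^ 8\<close> to \<open>k - k / 10 ^ 8\<close>. The upper end leaves every row a
  deficit to be repaired, the lower end limits it.\<close>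

definition base_density :: real where "base_density = (real k - 2 * real k / 10 ^ 8) / real n * (20 / 19)"

definition cell_prob :: "int \<times> int \<Rightarrow> real" where "cell_prob q = base_density * dens n q"

lemma kn_bounds: "0 < real k" "0 < real n" "10 ^ 37 \<le> real k" "2 * real k \<le> real n"
proof -
  have "real (10 ^ 37) \<le> real k" using k(1) by (rule of_nat_mono)
  then show 1: "10 ^ 37 \<le> real k" by simp
  have "real (2 * k) \<le> real n" using k(2) by (rule of_nat_mono)
  then show 2: "2 * real k \<le> real n" by simp
  show "0 < real k" using 1 by simp
  then show "0 < real n" using 2 by simp
qed

lemma base_density_bounds: "0 \<le> base_density" "base_density \<le> real k / real n * (20 / 19)" "base_density \<le> 10 / 19"
proof -
  show "0 \<le> base_density" unfolding base_density_def using kn_bounds by simp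
  show 1: "base_density \<le> real k / real n * (20 / 19)"
    unfolding base_density_def by (intro mult_right_mono divide_right_mono) auto
  have "real k / real n \<le> 1 / 2" using kn_bounds by (simp add: field_simps)
  then have "real k / real n * (20 / 19) \<le> 1 / 2 * (20 / 19)" by (rule mult_right_mono) simp
  then show "base_density \<le> 10 / 19" using 1 by simp
qed

lemma base_density_n: "base_density * (19 / 20 * real n) = real k - 2 * real k / 10 ^ 8"
  using kn_bounds by (simp add: base_density_def)

lemma cell_prob_bounds: "0 \<le> cell_prob q" "cell_prob q \<le> 1" "cell_prob q \<le> 2 * real k / real n"
proof -
  have d: "0 \<le> dens n q" using dens_bounds(1)[of n q] by linarith
  show "0 \<le> cell_prob q" using base_density_bounds d by (simp add: cell_prob_def)
  have "cell_prob q \<le> (10 / 19) * (6 / 5)" unfolding cell_prob_def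
    by (rule mult_mono[OF base_density_bounds(3) dens_bounds(2)]) (use d in auto)
  then show "cell_prob q \<le> 1" by simp
  have "cell_prob q \<le> (real k / real n * (20 / 19)) * (6 / 5)" unfolding cell_prob_def
    by (rule mult_mono[OF base_density_bounds(2) dens_bounds(2)]) (use d in auto)
  also have "\<dots> = 24 / 19 * (real k / real n)" by simp
  also have "\<dots> \<le> 2 * (real k / real n)" by (rule mult_right_mono) auto
  finally show "cell_prob q \<le> 2 * real k / real n" by simp
qed

lemma mean_eq:
  "(\<Sum>v\<in>upper_cells n. cell_prob v * real (hits L v)) = base_density * (\<Sum>q\<in>{q\<in>square n. fst q mod 20 \<noteq> snd q mod 20} \<inter> L. dens n q)"
  using sum_sym_closure[of "upper_cells n" n "cell_prob" L]
  by (simp add: sym_closure_upper_cells cell_prob_def dens_swap sum_distrib_left mult.assoc)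

lemma mean_le:
  "(\<Sum>v\<in>upper_cells n. cell_prob v * real (hits L v)) \<le> base_density * (\<Sum>q\<in>square n \<inter> L. dens n q)"
  unfolding mean_eq
proof (rule mult_left_mono[OF sum_mono2 base_density_bounds(1)])
  show "0 \<le> dens n b" for b using dens_bounds(1)[of n b] by linarith
qed auto

lemma mean_row:
  assumes "y \<in> {1..int n}"
  shows "\<bar>(\<Sum>v\<in>upper_cells n. cell_prob v * real (hits {q. snd q = y} v)) - (real k - 2 * real k / 10 ^ 8)\<bar> \<le> 2"
proof -
  let ?X = "{x\<in>{1..int n}. x mod 20 \<noteq> y mod 20}"
  have "{q\<in>square n. fst q mod 20 \<noteq> snd q mod 20} \<inter> {q. snd q = y} = (\<lambda>x. (x, y)) ` ?X"
    using assms by (auto simp: square_def)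
  then have eq: "(\<Sum>v\<in>upper_cells n. cell_prob v * real (hits {q. snd q = y} v)) = base_density * (\<Sum>x\<in>?X. dens n (x, y))"
    unfolding mean_eq by (simp add: sum.reindex inj_on_def)
  have "\<bar>base_density * (\<Sum>x\<in>?X. dens n (x, y)) - base_density * (19 / 20 * real n)\<bar>
      = base_density * \<bar>(\<Sum>x\<in>?X. dens n (x, y)) - 19 / 20 * real n\<bar>"
    using base_density_bounds(1) by (simp only: right_diff_distrib[symmetric] abs_mult abs_of_nonneg)
  also have "\<dots> \<le> 10 / 19 * 3"
    by (rule mult_mono[OF base_density_bounds(3) sum_dens_row]) auto
  finally show ?thesis unfolding eq base_density_n by simp
qed

lemma t_bounds: "real t \<le> real k / 100" "300 \<le> t" "t < k"
proof -
  have *: "100 * t \<le> k" by (simp add: t)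
  then show "real t \<le> real k / 100" by linarith
  have "(30000::nat) \<le> k" using kn_bounds(3) by simp
  then have "30000 div 100 \<le> k div 100" by (rule div_le_mono)
  then show "300 \<le> t" by (simp add: t)
  show "t < k" using * kn_bounds(1) by simp
qed

text \<open>Exponential tilting with \<open>exp s = 1 + m / 20\<close>, so that \<open>s\<close>
  grows like \<open>ln m\<close>. The moment term is proportional to \<open>m * \<mu>\<close>, which
  stays of order \<open>k\<close>, and the threshold contributes about \<open>- s k / 2\<close>. A
  surplus of \<open>s k / 20\<close> remains; it yields both the fourth-power decay in
  \<open>m\<close>, needed for the sum over directions, and \<open>exp (- k / 500)\<close>.\<close>

lemma line_tail:
  assumes d: "(a, b) \<in> dirs n" and v: "v \<in> upper_cells n"
  shows "(\<Sum>A\<in>Pow (upper_cells n). bweight cell_prob (upper_cells n) A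
      * of_bool (v \<in> A \<and> real k - real t + 1 \<le> real (\<Sum>w\<in>A. hits (lat_line a b c) w)))
    \<le> cell_prob v * ((20 / real (len (a, b))) ^ 4 * exp (- real k / 500))"
proof (cases "real (card (square n \<inter> lat_line a b c)) < real k - real t + 1")
  case True
  have "(\<Sum>A\<in>Pow (upper_cells n). bweight cell_prob (upper_cells n) A
      * of_bool (v \<in> A \<and> real k - real t + 1 \<le> real (\<Sum>w\<in>A. hits (lat_line a b c) w))) = 0"
  proof (rule sum.neutral, rule ballI)
    fix A assume "A \<in> Pow (upper_cells n)"
    then have A: "A \<subseteq> upper_cells n" by simp
    have "card (sym_closure A \<inter> lat_line a b c) \<le> card (square n \<inter> lat_line a b c)"
      by (rule card_mono) (use sym_closure_subset[OF A] in auto)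
    then have "\<not> real k - real t + 1 \<le> real (\<Sum>w\<in>A. hits (lat_line a b c) w)"
      using True card_sym_closure[OF A] by (metis less_le_not_le of_nat_le_iff order_trans)
    then show "bweight cell_prob (upper_cells n) A
      * of_bool (v \<in> A \<and> real k - real t + 1 \<le> real (\<Sum>w\<in>A. hits (lat_line a b c) w)) = 0" by simp
  qed
  then show ?thesis using cell_prob_bounds(1) by simp
next
  case False
  let ?m = "len (a, b)" and ?L = "lat_line a b c"
  define m where "m = real ?m"
  define s where "s = ln (1 + m / 20)"
  define \<mu> where "\<mu> = base_density * (\<Sum>q\<in>square n \<inter> ?L. dens n q)"
  have ob: "oblique a b" using d by (auto simp: dirs_def)
  have m1: "1 \<le> m" using len_pos[OF d] by (simp add: m_def)
  have es: "exp s = 1 + m / 20" using m1 by (simp add: s_def)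
  have ln105: "19 / 400 \<le> ln (1 + 1 / 20 :: real)"
    using ln_one_plus_pos_lower_bound[of "1 / 20"] by (simp add: power2_eq_square)
  have s_ge: "19 / 400 \<le> s"
  proof -
    have "ln (1 + 1 / 20) \<le> s" unfolding s_def using m1 by simp
    then show ?thesis using ln105 by linarith
  qed
  have main: "m / 20 * \<mu> \<le> 89 / 100 * real k * s"
  proof (cases "?m = 1")
    case True
    have "\<mu> \<le> base_density * (4 / 5 * real n)"
      unfolding \<mu>_def by (rule mult_left_mono[OF sum_dens_diagonal_le[OF ob True] base_density_bounds(1)])
    \<comment> \<open>\<open>16 / 19 = 4 / 5 * 20 / 19\<close>: a diagonal may avoid all cells
      excluded mod 20 and then feels the compensating factor \<open>20 / 19\<close> in full.\<close>
    also have "\<dots> = 16 / 19 * (base_density * (19 / 20 * real n))" by simp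
    also have "\<dots> \<le> 16 / 19 * real k" unfolding base_density_n using kn_bounds by simp
    finally have "m / 20 * \<mu> \<le> 1 / 20 * (16 / 19 * real k)" using True by (simp add: m_def)
    \<comment> \<open>The tightest inequality of the estimate, about \<open>0.0421 k\<close> against
      \<open>0.0423 k\<close>; there is hardly any room for a denser diagonal.\<close>
    also have "\<dots> \<le> 89 / 100 * real k * (19 / 400)" using kn_bounds(1) by simp
    also have "\<dots> \<le> 89 / 100 * real k * s" by (rule mult_left_mono[OF s_ge]) simp
    finally show ?thesis .
  next
    case False
    then have m2: "2 \<le> m" using len_pos[OF d] by (simp add: m_def)
    let ?c = "real (card (square n \<inter> ?L))"
    have "card (square n \<inter> ?L) \<le> (n - 1) div ?m + 1"
      by (rule card_lat_line_le[OF ob]) (simp add: len_def)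
    then have "?c \<le> real ((n - 1) div ?m) + 1" by linarith
    also have "real ((n - 1) div ?m) \<le> real (n - 1) / real ?m" by (rule of_nat_div_le_of_nat)
    also have "\<dots> \<le> real n / m" unfolding m_def by (rule divide_right_mono) auto
    finally have c: "?c \<le> real n / m + 1" by simp
    \<comment> \<open>Lines with too few cells are already excluded, so the direction is short
      compared with \<open>n\<close> and the rounding term \<open>+ 1\<close> in the cell count
      costs at most a quarter.\<close>
    have "5 \<le> ?c" using \<open>\<not> ?c < real k - real t + 1\<close> t_bounds kn_bounds by linarith
    then have "4 \<le> real n / m" using c by linarith
    then have mn: "m \<le> real n / 4" using m1 by (simp add: field_simps)
    have mc: "m * ?c \<le> 5 / 4 * real n"
    proof -
      have "m * ?c \<le> m * (real n / m + 1)" by (rule mult_left_mono[OF c]) (use m1 in simp)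
      also have "\<dots> = real n + m" using m1 by (simp add: field_simps)
      finally show ?thesis using mn by simp
    qed
    have "\<mu> \<le> base_density * (6 / 5 * ?c)"
      unfolding \<mu>_def by (rule mult_left_mono[OF sum_dens_line_le base_density_bounds(1)])
    then have "m / 20 * \<mu> \<le> m / 20 * (base_density * (6 / 5 * ?c))" by (rule mult_left_mono) (use m1 in simp)
    also have "\<dots> = 3 / 50 * base_density * (m * ?c)" by simp
    also have "\<dots> \<le> 3 / 50 * base_density * (5 / 4 * real n)"
      by (rule mult_left_mono[OF mc]) (use base_density_bounds in simp)
    also have "\<dots> = 3 / 38 * (base_density * (19 / 20 * real n))" by simp
    also have "\<dots> \<le> 3 / 38 * real k" unfolding base_density_n using kn_bounds by simp
    also have "\<dots> \<le> 89 / 100 * real k * (9 / 100)" using kn_bounds(1) by simp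
    also have "\<dots> \<le> 89 / 100 * real k * s"
    proof (rule mult_left_mono)
      have "9 / 100 \<le> ln (1 + 1 / 10 :: real)"
        using ln_one_plus_pos_lower_bound[of "1 / 10"] by (simp add: power2_eq_square)
      also have "\<dots> \<le> s" unfolding s_def using m2 by simp
      finally show "9 / 100 \<le> s" .
    qed simp
    finally show ?thesis .
  qed
  have "(\<Sum>A\<in>Pow (upper_cells n). bweight cell_prob (upper_cells n) A
      * of_bool (v \<in> A \<and> real k - real t + 1 \<le> real (\<Sum>w\<in>A. hits ?L w)))
      \<le> cell_prob v * exp (s + (exp s - 1) / 2 * \<mu> - s / 2 * (real k - real t + 1))"
    by (rule upper_tail_member_le)
      (use v cell_prob_bounds hits_le mean_le s_ge in \<open>auto simp: \<mu>_def\<close>)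
  also have "\<dots> \<le> cell_prob v * ((20 / m) ^ 4 * exp (- real k / 500))"
  proof (rule mult_left_mono[OF _ cell_prob_bounds(1)])
    have "s + (exp s - 1) / 2 * \<mu> - s / 2 * (real k - real t + 1)
        \<le> s + 89 / 200 * real k * s - s / 2 * (99 / 100 * real k)"
    proof -
      have "(exp s - 1) / 2 * \<mu> \<le> 89 / 200 * real k * s" using main es by simp
      moreover have "s / 2 * (99 / 100 * real k) \<le> s / 2 * (real k - real t + 1)"
        by (rule mult_left_mono) (use t_bounds s_ge in auto)
      ultimately show ?thesis by linarith
    qed
    \<comment> \<open>Four units of \<open>s\<close> are set aside for the fourth power of
      \<open>20 / m\<close>.\<close>
    also have "\<dots> = - (4 * s) - (real k / 20 - 5) * s" by (simp add: algebra_simps)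
    also have "\<dots> \<le> - (4 * s) - (real k / 20 - 5) * (19 / 400)"
      using mult_left_mono[OF s_ge, of "real k / 20 - 5"] kn_bounds(3) by simp
    also have "\<dots> \<le> - (4 * s) + (- real k / 500)" using kn_bounds(3) by simp
    finally have "exp (s + (exp s - 1) / 2 * \<mu> - s / 2 * (real k - real t + 1))
        \<le> exp (- (4 * s)) * exp (- real k / 500)" by (simp only: exp_add[symmetric] exp_le_cancel_iff)
    also have "exp (- (4 * s)) = (1 / (1 + m / 20)) ^ 4"
    proof -
      have "exp (- (4 * s)) = inverse (exp (of_nat 4 * s))" by (simp add: exp_minus)
      also have "\<dots> = inverse (exp s ^ 4)" by (simp only: exp_of_nat_mult)
      finally show ?thesis by (simp add: es power_one_over inverse_eq_divide)
    qed
    also have "(1 / (1 + m / 20)) ^ 4 * exp (- real k / 500) \<le> (20 / m) ^ 4 * exp (- real k / 500)"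
    proof (rule mult_right_mono[OF power_mono])
      show "1 / (1 + m / 20) \<le> 20 / m" using m1 by (simp add: field_simps)
    qed (use m1 in auto)
    finally show "exp (s + (exp s - 1) / 2 * \<mu> - s / 2 * (real k - real t + 1))
      \<le> (20 / m) ^ 4 * exp (- real k / 500)" .
  qed
  finally show ?thesis by (simp add: m_def)
qed

text \<open>\<open>s = 1 / (2 * 10 ^ 8)\<close> minimises \<open>s^2 / 2 - s / (2 * 10 ^ 8)\<close>,
  to leading order the coefficient of \<open>k\<close> in the exponent. The minimum
  \<open>- 1.25 / 10 ^ 17\<close> explains the rate and leaves room for the rounding of the
  mean.\<close>

lemma row_upper_tail:
  assumes y: "y \<in> {1..int n}" and v: "v \<in> upper_cells n"
  shows "(\<Sum>A\<in>Pow (upper_cells n). bweight cell_prob (upper_cells n) A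
      * of_bool (v \<in> A \<and> real k - real k / 10 ^ 8 \<le> real (\<Sum>w\<in>A. hits {q. snd q = y} w)))
    \<le> cell_prob v * exp (- real k / 10 ^ 17)"
proof -
  define s :: real where "s = 1 / (2 * 10 ^ 8)"
  define \<mu> where "\<mu> = real k - 2 * real k / 10 ^ 8 + 2"
  have "(\<Sum>v\<in>upper_cells n. cell_prob v * real (hits {q. snd q = y} v)) \<le> \<mu>"
    using mean_row[OF y] unfolding \<mu>_def by linarith
  then have "(\<Sum>A\<in>Pow (upper_cells n). bweight cell_prob (upper_cells n) A
      * of_bool (v \<in> A \<and> real k - real k / 10 ^ 8 \<le> real (\<Sum>w\<in>A. hits {q. snd q = y} w)))
      \<le> cell_prob v * exp (s + (exp s - 1) / 2 * \<mu> - s / 2 * (real k - real k / 10 ^ 8))"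
    by (intro upper_tail_member_le) (use v cell_prob_bounds hits_le in \<open>auto simp: s_def\<close>)
  also have "\<dots> \<le> cell_prob v * exp (- real k / 10 ^ 17)"
  proof (rule mult_left_mono[OF _ cell_prob_bounds(1)])
    have "exp s - 1 \<le> s + s\<^sup>2" using exp_bound[of s] by (simp add: s_def)
    then have "(exp s - 1) / 2 * \<mu> \<le> (s + s\<^sup>2) / 2 * \<mu>"
      using kn_bounds by (intro mult_right_mono) (auto simp: \<mu>_def)
    then have "s + (exp s - 1) / 2 * \<mu> - s / 2 * (real k - real k / 10 ^ 8)
        \<le> s + (s + s\<^sup>2) / 2 * \<mu> - s / 2 * (real k - real k / 10 ^ 8)" by simp
    also have "\<dots> \<le> - real k / 10 ^ 17"
      using kn_bounds by (simp add: s_def \<mu>_def power2_eq_square field_simps)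
    finally show "exp (s + (exp s - 1) / 2 * \<mu> - s / 2 * (real k - real k / 10 ^ 8)) \<le> exp (- real k / 10 ^ 17)"
      by simp
  qed
  finally show ?thesis .
qed

text \<open>The deviation from the mean is again \<open>k / 10 ^ 8\<close>, so the same parameter is
  optimal, now with \<open>exp (- s) \<le> 1 - s + s^2\<close>.\<close>

lemma row_lower_tail:
  assumes y: "y \<in> {1..int n}"
  shows "(\<Sum>A\<in>Pow (upper_cells n). bweight cell_prob (upper_cells n) A
      * of_bool (real (\<Sum>w\<in>A. hits {q. snd q = y} w) \<le> real k - 3 * real k / 10 ^ 8))
    \<le> exp (- real k / 10 ^ 17)"
proof -
  define s :: real where "s = 1 / (2 * 10 ^ 8)"
  define \<mu> where "\<mu> = real k - 2 * real k / 10 ^ 8 - 2"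
  have "\<mu> \<le> (\<Sum>v\<in>upper_cells n. cell_prob v * real (hits {q. snd q = y} v))"
    using mean_row[OF y] unfolding \<mu>_def by linarith
  then have "(\<Sum>A\<in>Pow (upper_cells n). bweight cell_prob (upper_cells n) A
      * of_bool (real (\<Sum>w\<in>A. hits {q. snd q = y} w) \<le> real k - 3 * real k / 10 ^ 8))
      \<le> exp ((exp (- s) - 1) / 2 * \<mu> + s / 2 * (real k - 3 * real k / 10 ^ 8))"
    by (intro lower_tail_le) (use cell_prob_bounds hits_le in \<open>auto simp: s_def\<close>)
  also have "\<dots> \<le> exp (- real k / 10 ^ 17)"
  proof -
    have "1 + s \<le> exp s" by (rule exp_ge_add_one_self)
    moreover have "0 < 1 + s" by (simp add: s_def)
    ultimately have "1 / exp s \<le> 1 / (1 + s)" by (intro divide_left_mono) auto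
    then have "exp (- s) \<le> 1 / (1 + s)" by (simp only: exp_minus inverse_eq_divide)
    also have "\<dots> \<le> 1 - s + s\<^sup>2" by (simp add: s_def power2_eq_square field_simps)
    finally have "(exp (- s) - 1) / 2 * \<mu> \<le> (- s + s\<^sup>2) / 2 * \<mu>"
      using kn_bounds by (intro mult_right_mono) (auto simp: \<mu>_def)
    then have "(exp (- s) - 1) / 2 * \<mu> + s / 2 * (real k - 3 * real k / 10 ^ 8)
        \<le> (- s + s\<^sup>2) / 2 * \<mu> + s / 2 * (real k - 3 * real k / 10 ^ 8)" by simp
    also have "\<dots> \<le> - real k / 10 ^ 17"
      using kn_bounds by (simp add: s_def \<mu>_def power2_eq_square field_simps)
    finally show ?thesis by simp
  qed
  finally show ?thesis .
qed

lemmas size_bounds = kn_bounds cell_prob_bounds t_bounds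

section \<open>Deletion of bad cells\<close>

definition deg :: "(int \<times> int) set \<Rightarrow> int \<Rightarrow> nat" where
  "deg A y = card (sym_closure A \<inter> {q. snd q = y})"

text \<open>Through its mirror image a chosen cell contributes to row \<open>fst v\<close> as well
  as to row \<open>snd v\<close>, hence two degree conditions. All counts refer to the set before
  deletion, so they remain upper bounds afterwards.\<close>

definition bad :: "(int \<times> int) set \<Rightarrow> int \<times> int \<Rightarrow> bool" where
  "bad A v \<longleftrightarrow> (\<exists>d\<in>dirs n. k - t < card (sym_closure A \<inter> lat_line (fst d) (snd d) (snd d * fst v - fst d * snd v)))
    \<or> real k - real k / 10 ^ 8 \<le> real (deg A (fst v)) \<or> real k - real k / 10 ^ 8 \<le> real (deg A (snd v))"

text \<open>Union bound over the directions and two rows: \<open>2560002 = 16 * 20 ^ 4 + 2\<close>,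
  where 16 bounds the sum of \<open>1 / len d ^ 4\<close>. The factor \<open>cell_prob v\<close> is
  kept for the later summation over cells.\<close>

lemma expected_bad:
  assumes v: "v \<in> upper_cells n"
  shows "(\<Sum>A\<in>Pow (upper_cells n). bweight cell_prob (upper_cells n) A * of_bool (v \<in> A \<and> bad A v))
    \<le> cell_prob v * (2560002 * exp (- real k / 10 ^ 17))"
proof -
  let ?U = "upper_cells n"
  let ?w = "bweight cell_prob ?U"
  let ?X = "\<lambda>A d. real (\<Sum>w\<in>A. hits (lat_line (fst d) (snd d) (snd d * fst v - fst d * snd v)) w)"
  let ?Y = "\<lambda>A y. real (\<Sum>w\<in>A. hits {q. snd q = y} w)"
  let ?h = "real k - real k / 10 ^ 8"
  have vs: "fst v \<in> {1..int n}" "snd v \<in> {1..int n}" using v by (auto simp: upper_cells_def square_def)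
  have "(\<Sum>A\<in>Pow ?U. ?w A * of_bool (v \<in> A \<and> bad A v))
    \<le> (\<Sum>A\<in>Pow ?U. ?w A * ((\<Sum>d\<in>dirs n. of_bool (v \<in> A \<and> real k - real t + 1 \<le> ?X A d))
        + of_bool (v \<in> A \<and> ?h \<le> ?Y A (fst v)) + of_bool (v \<in> A \<and> ?h \<le> ?Y A (snd v))))"
  proof (rule sum_mono, rule mult_left_mono)
    fix A assume "A \<in> Pow ?U"
    then have A: "A \<subseteq> ?U" by simp
    show "0 \<le> ?w A" by (rule bweight_nonneg[OF _ A]) (use size_bounds in auto)
    have dg: "deg A y = (\<Sum>w\<in>A. hits {q. snd q = y} w)" for y
      by (simp only: deg_def card_sym_closure[OF A])
    have S0: "0 \<le> (\<Sum>d\<in>dirs n. of_bool (v \<in> A \<and> real k - real t + 1 \<le> ?X A d) :: real)"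
      by (rule sum_nonneg) simp
    show "of_bool (v \<in> A \<and> bad A v) \<le> (\<Sum>d\<in>dirs n. of_bool (v \<in> A \<and> real k - real t + 1 \<le> ?X A d))
        + of_bool (v \<in> A \<and> ?h \<le> ?Y A (fst v)) + (of_bool (v \<in> A \<and> ?h \<le> ?Y A (snd v)) :: real)"
    proof (cases "v \<in> A \<and> bad A v")
      case True
      then have "v \<in> A" and "bad A v" and one: "of_bool (v \<in> A \<and> bad A v) = (1::real)" by auto
      have nonneg: "(0::real) \<le> of_bool (v \<in> A \<and> ?h \<le> ?Y A (fst v))"
        "(0::real) \<le> of_bool (v \<in> A \<and> ?h \<le> ?Y A (snd v))" by (rule zero_less_eq_of_bool)+
      from \<open>bad A v\<close> consider
          d where "d \<in> dirs n" "k - t < card (sym_closure A \<inter> lat_line (fst d) (snd d) (snd d * fst v - fst d * snd v))"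
        | "?h \<le> real (deg A (fst v))" | "?h \<le> real (deg A (snd v))"
        unfolding bad_def by blast
      then show ?thesis
      proof cases
        case 1
        then have "k - t + 1 \<le> (\<Sum>w\<in>A. hits (lat_line (fst d) (snd d) (snd d * fst v - fst d * snd v)) w)"
          unfolding card_sym_closure[OF A] by linarith
        from of_nat_mono[OF this, where 'a = real] have "real k - real t + 1 \<le> ?X A d"
          using size_bounds(10) by (simp only: of_nat_add of_nat_diff[OF less_imp_le] of_nat_1)
        then have "(1::real) = of_bool (v \<in> A \<and> real k - real t + 1 \<le> ?X A d)" using \<open>v \<in> A\<close> by simp
        also have "\<dots> \<le> (\<Sum>d\<in>dirs n. of_bool (v \<in> A \<and> real k - real t + 1 \<le> ?X A d))"
          by (rule member_le_sum[of d]) (use 1 in auto)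
        finally show ?thesis using one nonneg by linarith
      next
        case 2
        then have "(1::real) = of_bool (v \<in> A \<and> ?h \<le> ?Y A (fst v))" using \<open>v \<in> A\<close> by (simp only: dg) simp
        then show ?thesis using S0 one nonneg by linarith
      next
        case 3
        then have "(1::real) = of_bool (v \<in> A \<and> ?h \<le> ?Y A (snd v))" using \<open>v \<in> A\<close> by (simp only: dg) simp
        then show ?thesis using S0 one nonneg by linarith
      qed
    qed (use S0 in auto)
  qed
  also have "\<dots> = (\<Sum>d\<in>dirs n. \<Sum>A\<in>Pow ?U. ?w A * of_bool (v \<in> A \<and> real k - real t + 1 \<le> ?X A d))
      + (\<Sum>A\<in>Pow ?U. ?w A * of_bool (v \<in> A \<and> ?h \<le> ?Y A (fst v)))
      + (\<Sum>A\<in>Pow ?U. ?w A * of_bool (v \<in> A \<and> ?h \<le> ?Y A (snd v)))"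
    unfolding distrib_left sum.distrib sum_distrib_left by (subst sum.swap) (rule refl)
  also have "\<dots> \<le> (\<Sum>d\<in>dirs n. cell_prob v * ((20 / real (len d)) ^ 4 * exp (- real k / 500)))
      + cell_prob v * exp (- real k / 10 ^ 17) + cell_prob v * exp (- real k / 10 ^ 17)"
  proof (intro add_mono sum_mono)
    show "(\<Sum>A\<in>Pow ?U. ?w A * of_bool (v \<in> A \<and> real k - real t + 1 \<le> ?X A d))
        \<le> cell_prob v * ((20 / real (len d)) ^ 4 * exp (- real k / 500))" if "d \<in> dirs n" for d
      using line_tail[OF _ v, of "fst d" "snd d"] that by simp
  qed (rule row_upper_tail[OF vs(1) v] row_upper_tail[OF vs(2) v])+
  also have "\<dots> = cell_prob v * ((\<Sum>d\<in>dirs n. 1 / real (len d) ^ 4) * (160000 * exp (- real k / 500)) + 2 * exp (- real k / 10 ^ 17))"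
    by (simp add: sum_distrib_left sum_distrib_right distrib_left power_divide mult_ac)
  also have "\<dots> \<le> cell_prob v * (16 * (160000 * exp (- real k / 10 ^ 17)) + 2 * exp (- real k / 10 ^ 17))"
  proof (intro mult_left_mono add_right_mono mult_mono sum_len_inverse_pow4_le)
    have "- real k / 500 \<le> - real k / 10 ^ 17" using size_bounds(1) by (simp add: field_simps)
    then show "exp (- real k / 500) \<le> exp (- real k / 10 ^ 17)" by (simp only: exp_le_cancel_iff)
  qed (use size_bounds in auto)
  finally show ?thesis by simp
qed

text \<open>First moment method. Bad cells count twice because deleting one together with its mirror
  image disturbs two rows.\<close>

lemma exists_good_subset:
  "\<exists>A\<subseteq>upper_cells n. real (card {y\<in>{1..int n}. real (deg A y) \<le> real k - 3 * real k / 10 ^ 8})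
    + 2 * real (card {v\<in>A. bad A v}) \<le> real n / (10 ^ 30 * real k)"
proof -
  let ?U = "upper_cells n"
  let ?w = "bweight cell_prob ?U"
  let ?e = "exp (- real k / 10 ^ 17)"
  let ?low = "\<lambda>A y. real (\<Sum>w\<in>A. hits {q. snd q = y} w) \<le> real k - 3 * real k / 10 ^ 8"
  have U: "real (card ?U) \<le> real n * real n"
  proof -
    have "card ?U \<le> card (square n)" by (rule card_mono) (auto simp: upper_cells_def)
    also have "\<dots> = n * n" by (simp add: square_def card_cartesian_product)
    finally show ?thesis by (metis of_nat_le_iff of_nat_mult)
  qed
  have "(\<Sum>A\<in>Pow ?U. ?w A * ((\<Sum>y\<in>{1..int n}. of_bool (?low A y)) + 2 * (\<Sum>v\<in>?U. of_bool (v \<in> A \<and> bad A v))))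
      = (\<Sum>y\<in>{1..int n}. \<Sum>A\<in>Pow ?U. ?w A * of_bool (?low A y))
        + 2 * (\<Sum>v\<in>?U. \<Sum>A\<in>Pow ?U. ?w A * of_bool (v \<in> A \<and> bad A v))"
    unfolding distrib_left sum.distrib mult.left_commute[of _ 2] sum_distrib_left[symmetric, of 2]
    unfolding sum_distrib_left
    by (subst sum.swap, subst (3) sum.swap) (rule refl)
  also have "\<dots> \<le> (\<Sum>y\<in>{1..int n}. ?e) + 2 * (\<Sum>v\<in>?U. cell_prob v * (2560002 * ?e))"
    by (intro add_mono sum_mono mult_left_mono row_lower_tail expected_bad) auto
  also have "\<dots> \<le> real n * ?e + 2 * (2 * real k * real n * (2560002 * ?e))"
  proof (intro add_mono mult_left_mono)
    have "(\<Sum>v\<in>?U. cell_prob v * (2560002 * ?e)) = (\<Sum>v\<in>?U. cell_prob v) * (2560002 * ?e)"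
      by (rule sum_distrib_right[symmetric])
    also have "\<dots> \<le> (real (card ?U) * (2 * real k / real n)) * (2560002 * ?e)"
      using sum_bounded_above[of ?U "cell_prob" "2 * real k / real n"] size_bounds by (intro mult_right_mono) auto
    also have "\<dots> \<le> (real n * real n * (2 * real k / real n)) * (2560002 * ?e)"
      using U size_bounds by (intro mult_right_mono) auto
    also have "real n * real n * (2 * real k / real n) = 2 * real k * real n" using size_bounds by simp
    finally show "(\<Sum>v\<in>?U. cell_prob v * (2560002 * ?e)) \<le> 2 * real k * real n * (2560002 * ?e)" .
  qed auto
  also have "\<dots> = real n * ?e * (1 + 10240008 * real k)" by (simp add: algebra_simps)
  also have "\<dots> \<le> real n * ?e * (2 * 10 ^ 7 * real k)"
    using size_bounds(3) by (intro mult_left_mono) auto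
  also have "\<dots> \<le> real n * (1 / (10 ^ 30 * real k))"
  proof -
    let ?x = "real k / 10 ^ 17"
    \<comment> \<open>Two of the six powers of \<open>k\<close> cancel the polynomial factors; by
      \<open>k \<ge> 10 ^ 37\<close> the other four contribute \<open>10 ^ 148\<close>, which
      exceeds \<open>720 * 10 ^ 102 * 2 * 10 ^ 37\<close>.\<close>
    have "?x ^ 6 \<le> exp ?x * fact 6" by (rule pow_le_exp_mult_fact) simp
    then have "?x ^ 6 * ?e \<le> exp ?x * fact 6 * ?e" by (rule mult_right_mono) simp
    also have "\<dots> = fact 6" by (simp add: exp_minus field_simps)
    finally have e: "real k ^ 6 * ?e \<le> 720 * 10 ^ 102" by (simp add: power_divide fact_numeral)
    have "(10 ^ 37) ^ 4 \<le> real k ^ 4" by (rule power_mono[OF size_bounds(3)]) simp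
    then have k4: "10 ^ 148 \<le> real k ^ 4" by simp
    have "10 ^ 148 * (real k ^ 2 * ?e) \<le> real k ^ 4 * (real k ^ 2 * ?e)"
      by (rule mult_right_mono[OF k4]) simp
    also have "\<dots> = real k ^ 6 * ?e" by (simp flip: power_add mult.assoc)
    finally have "10 ^ 148 * (real k ^ 2 * ?e) \<le> 720 * 10 ^ 102" using e by linarith
    then have "2 * 10 ^ 37 * (real k ^ 2 * ?e) \<le> 1" by simp
    then have "?e * (2 * 10 ^ 7 * real k) \<le> 1 / (10 ^ 30 * real k)"
      using size_bounds(1) by (simp add: field_simps power2_eq_square)
    from mult_left_mono[OF this, of "real n"] show ?thesis by (simp add: mult.assoc)
  qed
  finally have "\<exists>A\<in>Pow ?U. (\<Sum>y\<in>{1..int n}. of_bool (?low A y)) + 2 * (\<Sum>v\<in>?U. of_bool (v \<in> A \<and> bad A v))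
      \<le> real n * (1 / (10 ^ 30 * real k))"
    by (rule exists_le_weighted_mean[rotated 3]) (use size_bounds in \<open>auto simp: sum_bweight intro: bweight_nonneg\<close>)
  then obtain A where A: "A \<subseteq> ?U"
    and le: "(\<Sum>y\<in>{1..int n}. of_bool (?low A y)) + 2 * (\<Sum>v\<in>?U. of_bool (v \<in> A \<and> bad A v))
      \<le> real n * (1 / (10 ^ 30 * real k))" by blast
  have "(\<Sum>y\<in>{1..int n}. of_bool (?low A y)) = real (card {y\<in>{1..int n}. ?low A y})"
    by (simp add: sum.If_cases of_bool_def Int_def)
  moreover have "{y\<in>{1..int n}. ?low A y} = {y\<in>{1..int n}. real (deg A y) \<le> real k - 3 * real k / 10 ^ 8}"
    by (simp only: deg_def card_sym_closure[OF A])
  moreover have "(\<Sum>v\<in>?U. of_bool (v \<in> A \<and> bad A v)) = real (card (?U \<inter> {v. v \<in> A \<and> bad A v}))"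
    by (simp add: sum.If_cases of_bool_def)
  moreover have "?U \<inter> {v. v \<in> A \<and> bad A v} = {v\<in>A. bad A v}" using A by auto
  ultimately show ?thesis using le A by (intro exI[of _ A]) (simp only: simp_thms mult_1_right times_divide_eq_right)
qed

text \<open>Deletion preserves upper bounds: a line with two remaining points passes through a cell
  that was not bad, or through its mirror image, and so was not too rich even before. A row loses
  points only if a bad cell or its mirror image lies in it, which keeps exceptional rows
  rare.\<close>

lemma exists_sparse_symmetric_set:
  "\<exists>S\<subseteq>{q\<in>square n. fst q mod 20 \<noteq> snd q mod 20}. prod.swap ` S = S \<and>
    (\<forall>a b c. oblique a b \<longrightarrow> card (S \<inter> lat_line a b c) \<le> k - t) \<and>
    (\<forall>y. real (card {q\<in>S. snd q = y}) \<le> real k - real k / 10 ^ 8) \<and>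
    real (card {y\<in>{1..int n}. real (card {q\<in>S. snd q = y}) < real k - 3 * real k / 10 ^ 8})
      \<le> real n / (10 ^ 30 * real k)"
proof -
  obtain A where A: "A \<subseteq> upper_cells n"
    and Z: "real (card {y\<in>{1..int n}. real (deg A y) \<le> real k - 3 * real k / 10 ^ 8})
      + 2 * real (card {v\<in>A. bad A v}) \<le> real n / (10 ^ 30 * real k)"
    using exists_good_subset by blast
  define S1 where "S1 = {v\<in>A. \<not> bad A v}"
  define S where "S = sym_closure S1"
  have finA: "finite A" by (rule finite_subset[OF A]) simp
  have finT: "finite (sym_closure A)" using finA by (simp add: sym_closure_def)
  have ST: "S \<subseteq> sym_closure A" by (auto simp: S_def S1_def sym_closure_def)
  have Ssq: "S \<subseteq> {q\<in>square n. fst q mod 20 \<noteq> snd q mod 20}"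
    using ST sym_closure_subset[OF A] by blast
  have memS: "\<exists>v\<in>S1. q = v \<or> q = prod.swap v" if "q \<in> S" for q
    using that by (auto simp: S_def sym_closure_def)
  have good: "\<not> bad A v" if "v \<in> S1" for v using that by (simp add: S1_def)
  show ?thesis
  proof (intro exI[of _ S] conjI allI impI)
    show "S \<subseteq> {q\<in>square n. fst q mod 20 \<noteq> snd q mod 20}" by (rule Ssq)
    show "prod.swap ` S = S" unfolding S_def by (rule swap_sym_closure)
    fix a b c assume ob: "oblique a b"
    show "card (S \<inter> lat_line a b c) \<le> k - t"
    proof (cases "card (S \<inter> lat_line a b c) \<le> Suc 0")
      case True
      then show ?thesis using size_bounds(10) by linarith
    next
      case False
      have "finite (S \<inter> lat_line a b c)" using finT ST finite_subset by blast
      then obtain p q where pq: "p \<in> S \<inter> lat_line a b c" "q \<in> S \<inter> lat_line a b c" "p \<noteq> q"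
        using False by (auto simp: card_le_Suc0_iff_eq)
      have d: "(a, b) \<in> dirs n"
        using dirs_if_two_points[OF ob, of p n c q] pq Ssq by blast
      then have d': "(b, a) \<in> dirs n" by (auto simp: dirs_def oblique_commute)
      have "card (S \<inter> lat_line a b c) \<le> card (sym_closure A \<inter> lat_line a b c)"
        by (rule card_mono) (use finT ST in auto)
      also have "\<dots> \<le> k - t"
      proof -
        obtain v where v: "v \<in> S1" "p = v \<or> p = prod.swap v" using memS pq by blast
        from v(2) show ?thesis
        proof
          assume "p = v"
          then have "c = b * fst v - a * snd v" using pq by (auto simp: lat_line_def)
          then show ?thesis using good[OF v(1)] d unfolding bad_def by force
        next
          assume "p = prod.swap v"
          then have "- c = a * fst v - b * snd v" using pq by (auto simp: lat_line_def)
          then have "card (sym_closure A \<inter> lat_line b a (- c)) \<le> k - t"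
            using good[OF v(1)] d' unfolding bad_def by force
          then show ?thesis by (simp only: card_sym_closure_swap)
        qed
      qed
      finally show ?thesis .
    qed
  next
    fix y
    show "real (card {q\<in>S. snd q = y}) \<le> real k - real k / 10 ^ 8"
    proof (cases "{q\<in>S. snd q = y} = {}")
      case True
      then have "card {q\<in>S. snd q = y} = 0" by (simp only: card.empty)
      then show ?thesis using size_bounds(1) by simp
    next
      case False
      then obtain q where q: "q \<in> S" "snd q = y" by blast
      then obtain v where v: "v \<in> S1" "q = v \<or> q = prod.swap v" using memS by blast
      then have "y = fst v \<or> y = snd v" using q by auto
      then have "real (deg A y) < real k - real k / 10 ^ 8" using good[OF v(1)] by (auto simp: bad_def)
      moreover have "card {q\<in>S. snd q = y} \<le> deg A y"
        unfolding deg_def by (rule card_mono) (use finT ST in auto)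
      ultimately show ?thesis by linarith
    qed
  next
    let ?low = "{y\<in>{1..int n}. real (deg A y) \<le> real k - 3 * real k / 10 ^ 8}"
    let ?B = "{v\<in>A. bad A v}"
    let ?E = "{y\<in>{1..int n}. real (card {q\<in>S. snd q = y}) < real k - 3 * real k / 10 ^ 8}"
    have "?E \<subseteq> ?low \<union> fst ` ?B \<union> snd ` ?B"
    proof
      fix y assume y: "y \<in> ?E"
      show "y \<in> ?low \<union> fst ` ?B \<union> snd ` ?B"
      proof (rule ccontr)
        assume n: "y \<notin> ?low \<union> fst ` ?B \<union> snd ` ?B"
        have "sym_closure A \<inter> {q. snd q = y} \<subseteq> {q\<in>S. snd q = y}"
        proof
          fix q assume q: "q \<in> sym_closure A \<inter> {q. snd q = y}"
          then obtain v where v: "v \<in> A" "q = v \<or> q = prod.swap v"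
            unfolding sym_closure_def by blast
          then have "y = fst v \<or> y = snd v" using q by auto
          then have "v \<in> S1" using n v(1) by (auto simp: S1_def)
          then show "q \<in> {q\<in>S. snd q = y}" using v(2) q by (auto simp: S_def sym_closure_def)
        qed
        then have "deg A y \<le> card {q\<in>S. snd q = y}"
          unfolding deg_def by (rule card_mono[rotated]) (use finite_subset[OF ST finT] in simp)
        then show False using n y by auto
      qed
    qed
    then have "card ?E \<le> card (?low \<union> fst ` ?B \<union> snd ` ?B)"
      by (rule card_mono[rotated]) (use finA in \<open>auto intro: finite_subset[of _ "{1..int n}"]\<close>)
    also have "\<dots> \<le> card ?low + card (fst ` ?B) + card (snd ` ?B)"
      by (meson add_mono card_Un_le le_trans order_refl)
    also have "\<dots> \<le> card ?low + card ?B + card ?B"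
      by (intro add_mono card_image_le order_refl) (use finA in auto)
    finally have "real (card ?E) \<le> real (card ?low) + 2 * real (card ?B)" by linarith
    then show "real (card ?E) \<le> real n / (10 ^ 30 * real k)" using Z by linarith
  qed
qed

lemma sparse_case:
  "\<exists>S. S \<subseteq> square n \<and> (\<forall>x\<in>{1..int n}. card {p\<in>S. fst p = x} = k) \<and>
    (\<forall>y\<in>{1..int n}. card {p\<in>S. snd p = y} = k) \<and>
    (\<forall>a b c. oblique a b \<longrightarrow> card (S \<inter> lat_line a b c) \<le> k)"
proof -
  obtain S where S: "S \<subseteq> {q\<in>square n. fst q mod 20 \<noteq> snd q mod 20}" "prod.swap ` S = S"
    and S_line: "\<And>a b c. oblique a b \<Longrightarrow> card (S \<inter> lat_line a b c) \<le> k - t"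
    and S_row: "\<And>y. real (card {q\<in>S. snd q = y}) \<le> real k - real k / 10 ^ 8"
    and S_exc: "real (card {y\<in>{1..int n}. real (card {q\<in>S. snd q = y}) < real k - 3 * real k / 10 ^ 8})
      \<le> real n / (10 ^ 30 * real k)"
    using exists_sparse_symmetric_set by blast
  have finS: "finite S" by (rule finite_subset[OF S(1)]) simp
  have S_col: "card {q\<in>S. fst q = x} = card {q\<in>S. snd q = x}" for x
  proof -
    have "{q\<in>S. fst q = x} = prod.swap ` {q\<in>S. snd q = x}"
    proof (intro equalityI subsetI)
      fix q assume q: "q \<in> {q\<in>S. fst q = x}"
      then have "prod.swap q \<in> S" using S(2) by blast
      then have "prod.swap q \<in> {q\<in>S. snd q = x}" using q by simp
      then show "q \<in> prod.swap ` {q\<in>S. snd q = x}"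
        by (rule image_eqI[rotated]) simp
    qed (use S(2) in auto)
    then show ?thesis by (simp add: card_image)
  qed
  define f where "f y = k - card {q\<in>S. snd q = y}" for y
  have deg_le: "card {q\<in>S. snd q = y} \<le> k" for y
  proof -
    have "real (card {q\<in>S. snd q = y}) \<le> real k" using S_row[of y] size_bounds(1) by (smt (verit) divide_pos_pos zero_less_power)
    then show ?thesis by simp
  qed
  have f: "real (f y) = real k - real (card {q\<in>S. snd q = y})" for y
    using deg_le[of y] by (simp add: f_def of_nat_diff)
  have E: "{y\<in>{1..int n}. 3 * real k / 10 ^ 8 < real (f y)}
      = {y\<in>{1..int n}. real (card {q\<in>S. snd q = y}) < real k - 3 * real k / 10 ^ 8}"
    unfolding f by (intro Collect_cong conj_cong refl) linarith
  have "\<exists>R\<subseteq>square n. (\<forall>p\<in>R. fst p mod 20 = snd p mod 20) \<and>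
    (\<forall>x\<in>{1..int n}. card {p\<in>R. fst p = x} = f x) \<and>
    (\<forall>y\<in>{1..int n}. card {p\<in>R. snd p = y} = f y) \<and>
    (\<forall>a b c. oblique a b \<longrightarrow> card (R \<inter> lat_line a b c) \<le> t)"
  proof (rule exists_completion[OF k _ _ _ _ t])
    show "real k / 10 ^ 8 \<le> real (f y)" for y using S_row[of y] unfolding f by linarith
    show "f y \<le> k" for y by (simp add: f_def)
    show "10 ^ 7 * f y \<le> n" if y: "y \<in> {1..int n}" for y
    \<comment> \<open>Below this threshold fewer than one row, hence none, is exceptional, and
      \<open>10 ^ 7 * 3 k / 10 ^ 8 \<le> n\<close>. Above it \<open>n\<close> is so large that even
      a deficit of \<open>k\<close> is harmless.\<close>
    proof (cases "real n < 10 ^ 30 * real k")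
      case True
      then have "real n / (10 ^ 30 * real k) < 1" using size_bounds(1) by simp
      then have "card {y\<in>{1..int n}. 3 * real k / 10 ^ 8 < real (f y)} = 0" using S_exc unfolding E by linarith
      moreover have "finite {y\<in>{1..int n}. 3 * real k / 10 ^ 8 < real (f y)}"
        by (rule finite_subset[of _ "{1..int n}"]) auto
      ultimately have "{y\<in>{1..int n}. 3 * real k / 10 ^ 8 < real (f y)} = {}" by (simp only: card_0_eq)
      then have "real (f y) \<le> 3 * real k / 10 ^ 8" using y by (force simp: not_less)
      then have "10 ^ 7 * real (f y) \<le> real n" using size_bounds(1,4) by simp
      then have "real (10 ^ 7 * f y) \<le> real n" by simp
      then show ?thesis by (simp only: of_nat_le_iff)
    next
      case False
      have "10 ^ 7 * real (f y) \<le> 10 ^ 7 * real k" unfolding f by simp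
      also have "\<dots> \<le> 10 ^ 30 * real k" by simp
      finally have "real (10 ^ 7 * f y) \<le> real n" using False by simp
      then show ?thesis by (simp only: of_nat_le_iff)
    qed
    have "real n / (10 ^ 30 * real k) \<le> real n / 10 ^ 17"
      using size_bounds(1,3) by (intro divide_left_mono) auto
    then show "real (card {y\<in>{1..int n}. 3 * real k / 10 ^ 8 < real (f y)}) \<le> real n / 10 ^ 17"
      using S_exc unfolding E by linarith
  qed
  then obtain R where R1: "R \<subseteq> square n" and R2: "\<forall>p\<in>R. fst p mod 20 = snd p mod 20"
    and R3: "\<forall>x\<in>{1..int n}. card {p\<in>R. fst p = x} = f x"
    and R4: "\<forall>y\<in>{1..int n}. card {p\<in>R. snd p = y} = f y"
    and R5: "\<forall>a b c. oblique a b \<longrightarrow> card (R \<inter> lat_line a b c) \<le> t"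
    by - (erule exE, (erule conjE)+, rule that, assumption+)
  have finR: "finite R" by (rule finite_subset[OF R1]) simp
  have disj: "S \<inter> R = {}" using S(1) R2 by blast
  show ?thesis
  proof (intro exI[of _ "S \<union> R"] conjI ballI allI impI)
    show "S \<union> R \<subseteq> square n" using S(1) R1 by blast
    have union: "card {p\<in>S \<union> R. P p} = card {p\<in>S. P p} + card {p\<in>R. P p}" for P
    proof -
      have "{p\<in>S \<union> R. P p} = {p\<in>S. P p} \<union> {p\<in>R. P p}" by auto
      moreover have "card ({p\<in>S. P p} \<union> {p\<in>R. P p}) = card {p\<in>S. P p} + card {p\<in>R. P p}"
        by (rule card_Un_disjoint) (use finS finR disj in auto)
      ultimately show ?thesis by simp
    qed
    show "card {p\<in>S \<union> R. fst p = x} = k" if "x \<in> {1..int n}" for x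
      unfolding union S_col bspec[OF R3 that] using deg_le[of x] by (simp add: f_def)
    show "card {p\<in>S \<union> R. snd p = y} = k" if "y \<in> {1..int n}" for y
      unfolding union bspec[OF R4 that] using deg_le[of y] by (simp add: f_def)
    fix a b c assume ob: "oblique a b"
    have "card ((S \<union> R) \<inter> lat_line a b c) \<le> card (S \<inter> lat_line a b c) + card (R \<inter> lat_line a b c)"
      unfolding Int_Un_distrib2 by (rule card_Un_le)
    also have "\<dots> \<le> (k - t) + t" using R5 ob by (intro add_mono S_line) simp_all
    also have "\<dots> = k" using size_bounds(10) by simp
    finally show "card ((S \<union> R) \<inter> lat_line a b c) \<le> k" .
  qed
qed

end

theorem theorem1p1:
  fixes n k :: nat
  assumes "10 ^ 37 \<le> k" and "k \<le> n"
  shows "\<exists>S. S \<subseteq> grid n \<and> card S = k * n \<and>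
           (\<forall>L. affine_line L \<longrightarrow> card (S \<inter> L) \<le> k)"
proof -
  have k2: "2 \<le> k" using order_trans[OF _ assms(1), of 2] by simp
  have "\<exists>S. S \<subseteq> square n \<and> (\<forall>x\<in>{1..int n}. card {p\<in>S. fst p = x} = k) \<and>
    (\<forall>y\<in>{1..int n}. card {p\<in>S. snd p = y} = k) \<and>
    (\<forall>a b c. oblique a b \<longrightarrow> card (S \<inter> lat_line a b c) \<le> k)"
  proof (cases "2 * k \<le> n")
    case True
    show ?thesis by (rule sparse_case[OF assms(1) True refl])
  next
    case False
    show ?thesis by (rule dense_case) (use assms k2 False in auto)
  qed
  then obtain S where "S \<subseteq> square n" "\<And>x. x \<in> {1..int n} \<Longrightarrow> card {p\<in>S. fst p = x} = k"
    "\<And>y. y \<in> {1..int n} \<Longrightarrow> card {p\<in>S. snd p = y} = k"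
    "\<And>a b c. oblique a b \<Longrightarrow> card (S \<inter> lat_line a b c) \<le> k"
    by blast
  then show ?thesis using k2 by (intro exists_set_of_regular_lattice_set) auto
qed

end
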